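(* Let $\Omega\subset\mathbb{R}^n$ be open and bounded, and let $Lu=-\sum_{i,j=1}^n (a^{ij}u_{x_i})_{x_j}$, where the coefficients $a^{ij}=a^{ij}(x)$ satisfy $a^{ij}\in L^\infty(\Omega)$, $a^{ij}=a^{ji}$ for $i,j=1,\dots,n$, and there is $\lambda>0$ with $\sum_{i,j=1}^n a^{ij}(x)y_iy_j\ge\lambda|y|^2$ for all $x\in\Omega$, $y\in\mathbb{R}^n$. Let $\{\phi_m\}_{m\in\mathbb{N}}\subset H^1_0(\Omega)$ be the $L^2(\Omega)$-orthonormal sequence of eigenfunctions of $L$, with corresponding eigenvalues $\{\lambda_m\}_{m\in\mathbb{N}}$. Let $g\in H^1_0(\Omega)$, $h\in L^2(\Omega)$, $f\in L^2_{\mathrm{loc}}([0,\infty);L^2(\Omega))\cap L^1(0,\infty;L^2(\Omega))$, and let $u$ be a weak solution of the problem $$\begin{cases}u_{tt}+Lu=f&\text{in }(0,\infty)\times\Omega,\\ u=0&\text{on }(0,\infty)\times\partial\Omega,\\ u=g,\ u_t=h&\text{on }\{0\}\times\Omega.\end{cases}$$ Then $$u(t,\cdot)\to 0\ \text{ in }L^2(\Omega)\ \text{ when } t\to\infty$$ if and only if for all $m\in\mathbb{N}$ $$(g,\phi_m)_{L^2(\Omega)}=\frac{1}{\sqrt{\lambda_m}}\int_0^\infty\sin(\sqrt{\lambda_m}\,s)\,(f(s,\cdot),\phi_m)_{L^2(\Omega)}\,ds,$$ $$(h,\phi_m)_{L^2(\Omega)}=-\int_0^\infty\cos(\sqrt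{\lambda_m}\,s)\,(f(s,\cdot),\phi_m)_{L^2(\Omega)}\,ds.$$
   Context: All functions are real-valued. The bilinear form associated with $L$ is $B(u,v)=\int_\Omega\sum_{i,j=1}^n a^{ij}u_{x_i}v_{x_j}\,dx$ on $H^1_0(\Omega)$. Eigenfunctions and eigenvalues: $\phi_m\in H^1_0(\Omega)$ satisfies $B(\phi_m,v)=\lambda_m(\phi_m,v)_{L^2(\Omega)}$ for all $v\in H^1_0(\Omega)$. Here $\{\phi_m\}$ is a complete system: an orthonormal basis of $L^2(\Omega)$ whose span is dense in $H^1_0(\Omega)$. The eigenvalues are listed with multiplicity, and all $\lambda_m>0$. $L^2_{\mathrm{loc}}([0,\infty);X)$ denotes functions whose restriction to $(0,T)$ lies in $L^2(0,T;X)$ for every $T>0$. Weak solution (standard sense): for every $T>0$, $u\in L^\infty(0,T;H^1_0(\Omega))\cap W^{1,\infty}(0,T;L^2(\Omega))\cap H^2(0,T;H^{-1}(\Omega))$; for every $v\in H^1_0(\Omega)$ and a.e. $t>0$, $\langle u''(t),v\rangle+B(u(t),v)=(f(t),v)_{L^2(\Omega)}$; and $u(0)=g$, $u'(0)=h$. The function $u$ is identified with its representative in $C([0,\infty);L^2(\Omega))$, so $u(t,\cdot)\in L^2(\Omega)$ is defined for every $t\ge0$. *)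

theory Defs
  imports "HOL-Analysis.Analysis" "HOL-Library.Function_Algebras"
begin

section \<open>Pointwise vector space structure on functions\<close>

instantiation "fun" :: (type, scaleR) scaleR
begin
definition scaleR_fun_def: "c *\<^sub>R f = (\<lambda>x. c *\<^sub>R f x)"
instance ..
end

instance "fun" :: (type, real_vector) real_vector
  by standard (simp_all add: scaleR_fun_def plus_fun_def fun_eq_iff scaleR_add_left scaleR_add_right)


section \<open>Test functions\<close>

text \<open>The derivative of \<open>f\<close> in the direction of a basis vector \<open>b\<close> is
  \<open>frechet_derivative f (at x) b\<close>.\<close>

primrec C_k :: "nat \<Rightarrow> ('a::euclidean_space \<Rightarrow> real) \<Rightarrow> bool" where
  "C_k 0 f \<longleftrightarrow> continuous_on UNIV f"
| "C_k (Suc k) f \<longleftrightarrow> (\<forall>x. f differentiable (at x)) \<and>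
     (\<forall>b\<in>Basis. C_k k (\<lambda>x. frechet_derivative f (at x) b))"

definition test_functions :: "'a::euclidean_space set \<Rightarrow> ('a \<Rightarrow> real) set" where
  "test_functions U = {\<psi>. (\<forall>k. C_k k \<psi>) \<and> (\<exists>K. compact K \<and> K \<subseteq> U \<and> (\<forall>x. x \<notin> K \<longrightarrow> \<psi> x = 0))}"


section \<open>Function spaces on a domain\<close>

text \<open>Elements of \<open>L\<^sup>2(\<Omega>)\<close> and of the Sobolev spaces are represented by functions on the whole
  space, whose values outside \<open>\<Omega>\<close> are irrelevant; equality in these spaces is equality almost
  everywhere on \<open>\<Omega>\<close>, so the norms below are seminorms on representatives.\<close>

definition L2 :: "'a::euclidean_space set \<Rightarrow> ('a \<Rightarrow> real) set" where
  "L2 \<Omega> = {f. f \<in> borel_measurable (lebesgue_on \<Omega>) \<and> integrable (lebesgue_on \<Omega>) (\<lambda>x. (f x)\<^sup>2)}"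

definition L2_inner :: "'a::euclidean_space set \<Rightarrow> ('a \<Rightarrow> real) \<Rightarrow> ('a \<Rightarrow> real) \<Rightarrow> real" where
  "L2_inner \<Omega> f g = (LINT x|lebesgue_on \<Omega>. f x * g x)"

definition L2_norm :: "'a::euclidean_space set \<Rightarrow> ('a \<Rightarrow> real) \<Rightarrow> real" where
  "L2_norm \<Omega> f = sqrt (L2_inner \<Omega> f f)"

definition Linf :: "'a::euclidean_space set \<Rightarrow> ('a \<Rightarrow> real) set" where
  "Linf \<Omega> = {f. f \<in> borel_measurable (lebesgue_on \<Omega>) \<and> (\<exists>C. AE x in lebesgue_on \<Omega>. \<bar>f x\<bar> \<le> C)}"

definition has_weak_pderiv ::
    "(real^'n) set \<Rightarrow> 'n \<Rightarrow> (real^'n \<Rightarrow> real) \<Rightarrow> (real^'n \<Rightarrow> real) \<Rightarrow> bool" where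
  "has_weak_pderiv \<Omega> i f w \<longleftrightarrow>
     (\<forall>\<psi>\<in>test_functions \<Omega>.
        (LINT x|lebesgue_on \<Omega>. f x * frechet_derivative \<psi> (at x) (axis i 1)) =
        - (LINT x|lebesgue_on \<Omega>. w x * \<psi> x))"

text \<open>The weak derivative is unique only up to null sets; an arbitrary representative is chosen.\<close>

definition weak_pderiv :: "(real^'n) set \<Rightarrow> 'n \<Rightarrow> (real^'n \<Rightarrow> real) \<Rightarrow> real^'n \<Rightarrow> real" where
  "weak_pderiv \<Omega> i f = (SOME w. w \<in> L2 \<Omega> \<and> has_weak_pderiv \<Omega> i f w)"

definition H1 :: "(real^'n) set \<Rightarrow> (real^'n \<Rightarrow> real) set" where
  "H1 \<Omega> = {f \<in> L2 \<Omega>. \<forall>i. \<exists>w\<in>L2 \<Omega>. has_weak_pderiv \<Omega> i f w}"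

definition H1_norm :: "(real^'n) set \<Rightarrow> (real^'n \<Rightarrow> real) \<Rightarrow> real" where
  "H1_norm \<Omega> f = sqrt ((L2_norm \<Omega> f)\<^sup>2 + (\<Sum>i\<in>UNIV. (L2_norm \<Omega> (weak_pderiv \<Omega> i f))\<^sup>2))"

definition H10 :: "(real^'n) set \<Rightarrow> (real^'n \<Rightarrow> real) set" where
  "H10 \<Omega> = {f \<in> H1 \<Omega>. \<forall>\<epsilon>>0. \<exists>\<psi>\<in>test_functions \<Omega>. H1_norm \<Omega> (f - \<psi>) < \<epsilon>}"

text \<open>\<open>H\<^sup>-\<^sup>1(\<Omega>)\<close> is the space of bounded linear functionals on \<open>H\<^sup>1\<^sub>0(\<Omega>)\<close>, with the operator norm;
  the values of a functional outside \<open>H\<^sup>1\<^sub>0(\<Omega>)\<close> are irrelevant.\<close>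

definition Hm1 :: "(real^'n) set \<Rightarrow> ((real^'n \<Rightarrow> real) \<Rightarrow> real) set" where
  "Hm1 \<Omega> = {F. (\<forall>u\<in>H10 \<Omega>. \<forall>v\<in>H10 \<Omega>. F (u + v) = F u + F v) \<and>
               (\<forall>c. \<forall>u\<in>H10 \<Omega>. F (c *\<^sub>R u) = c * F u) \<and>
               (\<exists>C. \<forall>u\<in>H10 \<Omega>. \<bar>F u\<bar> \<le> C * H1_norm \<Omega> u)}"

definition Hm1_norm :: "(real^'n) set \<Rightarrow> ((real^'n \<Rightarrow> real) \<Rightarrow> real) \<Rightarrow> real" where
  "Hm1_norm \<Omega> F = (SUP v\<in>{v \<in> H10 \<Omega>. H1_norm \<Omega> v \<le> 1}. \<bar>F v\<bar>)"

text \<open>The canonical embedding \<open>L\<^sup>2(\<Omega>) \<subseteq> H\<^sup>-\<^sup>1(\<Omega>)\<close>.\<close>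

definition L2_to_Hm1 :: "(real^'n) set \<Rightarrow> (real^'n \<Rightarrow> real) \<Rightarrow> (real^'n \<Rightarrow> real) \<Rightarrow> real" where
  "L2_to_Hm1 \<Omega> f = (\<lambda>v. L2_inner \<Omega> f v)"


section \<open>Functions of time with values in a (semi)normed space\<close>

text \<open>The spaces above depend on the set \<open>\<Omega>\<close>, so they are not types of class \<open>banach\<close>.
  The notions of the library's Bochner integral are therefore
  repeated for a subspace \<open>X\<close> of a real vector space with a seminorm \<open>N\<close> on \<open>X\<close>.\<close>

definition strongly_measurable ::
    "real measure \<Rightarrow> 'b::real_vector set \<Rightarrow> ('b \<Rightarrow> real) \<Rightarrow> (real \<Rightarrow> 'b) \<Rightarrow> bool" where
  "strongly_measurable M X N u \<longleftrightarrow>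
     (AE t in M. u t \<in> X) \<and>
     (\<exists>s. (\<forall>k::nat. simple_function M (s k) \<and> s k ` space M \<subseteq> X) \<and>
          (AE t in M. (\<lambda>k. N (u t - s k t)) \<longlonglongrightarrow> 0))"

definition bochner_Lp ::
    "nat \<Rightarrow> real measure \<Rightarrow> 'b::real_vector set \<Rightarrow> ('b \<Rightarrow> real) \<Rightarrow> (real \<Rightarrow> 'b) set" where
  "bochner_Lp p M X N = {u. strongly_measurable M X N u \<and> integrable M (\<lambda>t. N (u t) ^ p)}"

definition bochner_Linf ::
    "real measure \<Rightarrow> 'b::real_vector set \<Rightarrow> ('b \<Rightarrow> real) \<Rightarrow> (real \<Rightarrow> 'b) set" where
  "bochner_Linf M X N = {u. strongly_measurable M X N u \<and> (\<exists>C. AE t in M. N (u t) \<le> C)}"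

text \<open>Compare \<^const>\<open>has_bochner_integral\<close>.\<close>

definition has_bochner_integral_in ::
    "real measure \<Rightarrow> 'b::real_vector set \<Rightarrow> ('b \<Rightarrow> real) \<Rightarrow> (real \<Rightarrow> 'b) \<Rightarrow> 'b \<Rightarrow> bool" where
  "has_bochner_integral_in M X N u w \<longleftrightarrow>
     w \<in> X \<and> strongly_measurable M X N u \<and>
     (\<exists>s. (\<forall>k::nat. Bochner_Integration.simple_bochner_integrable M (s k) \<and> s k ` space M \<subseteq> X) \<and>
          (\<lambda>k. \<integral>\<^sup>+t. ennreal (N (u t - s k t)) \<partial>M) \<longlonglongrightarrow> 0 \<and>
          (\<lambda>k. N (Bochner_Integration.simple_bochner_integral M (s k) - w)) \<longlonglongrightarrow> 0)"

text \<open>\<open>\<integral> \<psi>' u dt = - \<integral> \<psi> w dt\<close> for all test functions \<open>\<psi>\<close> on \<open>(0,T)\<close>.\<close>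

definition has_weak_time_deriv ::
    "real \<Rightarrow> 'b::real_vector set \<Rightarrow> ('b \<Rightarrow> real) \<Rightarrow> (real \<Rightarrow> 'b) \<Rightarrow> (real \<Rightarrow> 'b) \<Rightarrow> bool" where
  "has_weak_time_deriv T X N u w \<longleftrightarrow>
     (\<forall>\<psi>\<in>test_functions {0<..<T}. \<exists>I.
        has_bochner_integral_in (lebesgue_on {0<..<T}) X N (\<lambda>t. deriv \<psi> t *\<^sub>R u t) I \<and>
        has_bochner_integral_in (lebesgue_on {0<..<T}) X N (\<lambda>t. \<psi> t *\<^sub>R w t) (- I))"

text \<open>\<open>u \<in> W\<^sup>1\<^sup>,\<^sup>\<infinity>(0,T;X)\<close> with weak derivative \<open>u1\<close>.\<close>

definition W1inf_with ::
    "real \<Rightarrow> 'b::real_vector set \<Rightarrow> ('b \<Rightarrow> real) \<Rightarrow> (real \<Rightarrow> 'b) \<Rightarrow> (real \<Rightarrow> 'b) \<Rightarrow> bool" where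
  "W1inf_with T X N u u1 \<longleftrightarrow>
     u \<in> bochner_Linf (lebesgue_on {0<..<T}) X N \<and>
     u1 \<in> bochner_Linf (lebesgue_on {0<..<T}) X N \<and>
     has_weak_time_deriv T X N u u1"

text \<open>\<open>u \<in> H\<^sup>2(0,T;X)\<close> with first and second weak derivatives \<open>u1\<close> and \<open>u2\<close>.\<close>

definition H2_with ::
    "real \<Rightarrow> 'b::real_vector set \<Rightarrow> ('b \<Rightarrow> real) \<Rightarrow>
     (real \<Rightarrow> 'b) \<Rightarrow> (real \<Rightarrow> 'b) \<Rightarrow> (real \<Rightarrow> 'b) \<Rightarrow> bool" where
  "H2_with T X N u u1 u2 \<longleftrightarrow>
     u \<in> bochner_Lp 2 (lebesgue_on {0<..<T}) X N \<and>
     u1 \<in> bochner_Lp 2 (lebesgue_on {0<..<T}) X N \<and>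
     u2 \<in> bochner_Lp 2 (lebesgue_on {0<..<T}) X N \<and>
     has_weak_time_deriv T X N u u1 \<and>
     has_weak_time_deriv T X N u1 u2"

definition time_continuous ::
    "real set \<Rightarrow> 'b::real_vector set \<Rightarrow> ('b \<Rightarrow> real) \<Rightarrow> (real \<Rightarrow> 'b) \<Rightarrow> bool" where
  "time_continuous S X N u \<longleftrightarrow>
     (\<forall>t\<in>S. u t \<in> X \<and> ((\<lambda>s. N (u s - u t)) \<longlongrightarrow> 0) (at t within S))"


section \<open>The operator, its eigenfunctions, and weak solutions\<close>

definition bilinear_form ::
    "(real^'n) set \<Rightarrow> ('n \<Rightarrow> 'n \<Rightarrow> real^'n \<Rightarrow> real) \<Rightarrow> (real^'n \<Rightarrow> real) \<Rightarrow> (real^'n \<Rightarrow> real) \<Rightarrow> real" where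
  "bilinear_form \<Omega> a u v =
     (LINT x|lebesgue_on \<Omega>. (\<Sum>i\<in>UNIV. \<Sum>j\<in>UNIV. a i j x * weak_pderiv \<Omega> i u x * weak_pderiv \<Omega> j v x))"

definition uniformly_elliptic ::
    "(real^'n) set \<Rightarrow> ('n \<Rightarrow> 'n \<Rightarrow> real^'n \<Rightarrow> real) \<Rightarrow> bool" where
  "uniformly_elliptic \<Omega> a \<longleftrightarrow>
     (\<exists>l>0. \<forall>x\<in>\<Omega>. \<forall>y::real^'n. (\<Sum>i\<in>UNIV. \<Sum>j\<in>UNIV. a i j x * y $ i * y $ j) \<ge> l * (norm y)\<^sup>2)"

definition complete_eigensystem ::
    "(real^'n) set \<Rightarrow> ('n \<Rightarrow> 'n \<Rightarrow> real^'n \<Rightarrow> real) \<Rightarrow> (nat \<Rightarrow> real^'n \<Rightarrow> real) \<Rightarrow> (nat \<Rightarrow> real) \<Rightarrow> bool" where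
  "complete_eigensystem \<Omega> a \<phi> \<mu> \<longleftrightarrow>
     (\<forall>m. \<phi> m \<in> H10 \<Omega> \<and> \<mu> m > 0 \<and>
          (\<forall>v\<in>H10 \<Omega>. bilinear_form \<Omega> a (\<phi> m) v = \<mu> m * L2_inner \<Omega> (\<phi> m) v)) \<and>
     (\<forall>m k. L2_inner \<Omega> (\<phi> m) (\<phi> k) = (if m = k then 1 else 0)) \<and>
     (\<forall>v\<in>L2 \<Omega>. \<forall>\<epsilon>>0. \<exists>w\<in>span (range \<phi>). L2_norm \<Omega> (v - w) < \<epsilon>) \<and>
     (\<forall>v\<in>H10 \<Omega>. \<forall>\<epsilon>>0. \<exists>w\<in>span (range \<phi>). H1_norm \<Omega> (v - w) < \<epsilon>)"

text \<open>The function \<open>u\<close> is the representative in \<open>C([0,\<infinity>);L\<^sup>2(\<Omega>))\<close>. The functions \<open>u1\<close> and \<open>u2\<close> are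
  \<open>u'\<close> and \<open>u''\<close>. The initial condition \<open>u'(0) = h\<close> refers to the representative \<open>w\<close> of \<open>u'\<close> in
  \<open>C([0,\<infinity>);H\<^sup>-\<^sup>1(\<Omega>))\<close>, which exists since \<open>u' \<in> H\<^sup>1(0,T;H\<^sup>-\<^sup>1(\<Omega>))\<close> for every \<open>T\<close>. Its equality with
  the images of \<open>u'(t)\<close> and of \<open>h\<close> is equality of functionals on \<open>H\<^sup>1\<^sub>0(\<Omega>)\<close>.\<close>

definition weak_solution ::
    "(real^'n) set \<Rightarrow> ('n \<Rightarrow> 'n \<Rightarrow> real^'n \<Rightarrow> real) \<Rightarrow> (real \<Rightarrow> real^'n \<Rightarrow> real) \<Rightarrow>
     (real^'n \<Rightarrow> real) \<Rightarrow> (real^'n \<Rightarrow> real) \<Rightarrow> (real \<Rightarrow> real^'n \<Rightarrow> real) \<Rightarrow> bool" where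
  "weak_solution \<Omega> a f g h u \<longleftrightarrow>
     time_continuous {0..} (L2 \<Omega>) (L2_norm \<Omega>) u \<and>
     (\<exists>u1 u2.
        (\<forall>T>0. u \<in> bochner_Linf (lebesgue_on {0<..<T}) (H10 \<Omega>) (H1_norm \<Omega>) \<and>
               W1inf_with T (L2 \<Omega>) (L2_norm \<Omega>) u u1 \<and>
               H2_with T (Hm1 \<Omega>) (Hm1_norm \<Omega>)
                 (\<lambda>t. L2_to_Hm1 \<Omega> (u t)) (\<lambda>t. L2_to_Hm1 \<Omega> (u1 t)) u2) \<and>
        (\<forall>v\<in>H10 \<Omega>. AE t in lebesgue_on {0<..}.
           u2 t v + bilinear_form \<Omega> a (u t) v = L2_inner \<Omega> (f t) v) \<and>
        (AE x in lebesgue_on \<Omega>. u 0 x = g x) \<and>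
        (\<exists>w. time_continuous {0..} (Hm1 \<Omega>) (Hm1_norm \<Omega>) w \<and>
             (AE t in lebesgue_on {0<..}. \<forall>v\<in>H10 \<Omega>. w t v = L2_to_Hm1 \<Omega> (u1 t) v) \<and>
             (\<forall>v\<in>H10 \<Omega>. w 0 v = L2_to_Hm1 \<Omega> h v)))"

end

theory Submission
  imports Defs
begin

text \<open>
  Write \<open>\<omega> = sqrt (\<mu> m)\<close> and let \<open>y\<close>, \<open>F\<close>, \<open>g\<^sub>m\<close>, \<open>h\<^sub>m\<close> be the coefficients of \<open>u t\<close>, \<open>f t\<close>, \<open>g\<close>, \<open>h\<close>
  along the eigenfunction \<open>\<phi> m\<close>. Testing the wave equation with \<open>\<phi> m\<close> decouples it into the forced
  oscillators \<open>y'' + \<omega>\<^sup>2 y = F\<close>, whose solution is given by Duhamel's formula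
  \<open>y t = cos (\<omega> t) (g\<^sub>m - 1/\<omega> \<integral>\<^sub>0\<^sup>t sin (\<omega> s) F s ds) + sin (\<omega> t)/\<omega> (h\<^sub>m + \<integral>\<^sub>0\<^sup>t cos (\<omega> s) F s ds)\<close>
  (\<open>weak_solution_mode_formula\<close>). Since \<open>F\<close> is integrable on the half line, both brackets have limits
  as \<open>t\<close> grows, and the two moment conditions for \<open>m\<close> say exactly that these limits are \<open>0\<close>.

  If \<open>u t\<close> tends to \<open>0\<close>, so does each coefficient; hence \<open>A cos (\<omega> t) + B sin (\<omega> t)\<close> tends to \<open>0\<close>, where
  \<open>A\<close> and \<open>\<omega> B\<close> are the two limits, and this forces \<open>A = B = 0\<close>.

  Conversely, under the moment conditions Duhamel's formula becomes an integral over the future,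
  \<open>y t = 1/\<omega> \<integral>\<^sub>t\<^sup>\<infinity> sin (\<omega> (s - t)) F s ds\<close>. This makes every mode decay, but the norm of \<open>u t\<close> needs all
  modes at once. Minkowski's integral inequality combined with Bessel's inequality bounds the square
  sum of the modes, and gives \<open>\<parallel>u t\<parallel> \<le> 1/sqrt c \<integral>\<^sub>t\<^sup>\<infinity> \<parallel>f s\<parallel> ds\<close>, where \<open>c > 0\<close> is a lower bound of the
  eigenvalues (\<open>moment_conditions_imp_L2_norm_le\<close>). Such a \<open>c\<close> exists by ellipticity and the Poincare
  inequality on the bounded set \<open>\<Omega>\<close> (\<open>eigenvalues_bounded_below\<close>).

  Two points need care for weak solutions. The time derivatives live in \<open>H\<^sup>-\<^sup>1\<close>, and scalar equations
  are obtained by applying the functional ``evaluate at \<open>\<phi> m\<close>'' to vector-valued integrals. That this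
  functional is bounded by \<open>Hm1_norm\<close> requires \<open>H1_norm\<close> to be homogeneous, although it is defined
  through arbitrarily chosen representatives of weak derivatives; so weak derivatives have to be shown
  unique almost everywhere, by the fundamental lemma of the calculus of variations. Secondly, the
  oscillator equation holds only in the distributional sense. Its first integrals are found
  by absorbing the smooth factors \<open>cos (\<omega> t)\<close> and \<open>sin (\<omega> t)\<close> into the test functions, after which one
  integration by du Bois-Reymond's lemma (\<open>weak_derivative_imp_integral\<close>) is enough.
\<close>

section \<open>Smooth functions and box bumps\<close>

lemma C_k_SucI:
  assumes "\<And>x. (f has_derivative D x) (at x)" "\<And>b. b \<in> Basis \<Longrightarrow> C_k k (\<lambda>x. D x b)"
  shows "C_k (Suc k) f"
proof -
  have "frechet_derivative f (at x) = D x" for x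
    using frechet_derivative_at[OF assms(1)[of x]] by simp
  then show ?thesis
    using assms by (auto simp: differentiable_def)
qed

lemma C_k_SucD: "C_k (Suc k) f \<Longrightarrow> C_k k f"
proof (induction k arbitrary: f)
  case 0
  then have "f differentiable (at x)" for x by auto
  then show ?case
    by (auto simp: continuous_on_eq_continuous_at intro: differentiable_imp_continuous_within)
next
  case (Suc k)
  then show ?case by (metis C_k.simps(2))
qed

lemma C_k_has_derivative:
  "C_k (Suc k) f \<Longrightarrow> (f has_derivative frechet_derivative f (at x)) (at x)"
  using frechet_derivative_works by (auto simp del: One_nat_def)

lemma C_k_const [simp]: "C_k k (\<lambda>x. c)"
proof (induction k arbitrary: c)
  case (Suc k)
  show ?case by (rule C_k_SucI[where D="\<lambda>_ _. 0"]) (auto simp: Suc.IH)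
qed auto

lemma C_k_add: "C_k k f \<Longrightarrow> C_k k g \<Longrightarrow> C_k k (\<lambda>x. f x + g x)"
proof (induction k arbitrary: f g)
  case (Suc k)
  show ?case
  proof (rule C_k_SucI)
    show "((\<lambda>x. f x + g x) has_derivative
        (\<lambda>h. frechet_derivative f (at x) h + frechet_derivative g (at x) h)) (at x)" for x
      using Suc.prems by (intro has_derivative_add C_k_has_derivative)
  qed (use Suc in auto)
qed (auto intro: continuous_intros)

lemma C_k_mult: "C_k k f \<Longrightarrow> C_k k g \<Longrightarrow> C_k k (\<lambda>x. f x * g x)"
proof (induction k arbitrary: f g)
  case (Suc k)
  show ?case
  proof (rule C_k_SucI)
    show "((\<lambda>x. f x * g x) has_derivative
        (\<lambda>h. f x * frechet_derivative g (at x) h + frechet_derivative f (at x) h * g x)) (at x)" for x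
      using Suc.prems by (intro has_derivative_mult C_k_has_derivative)
    fix b :: 'a assume "b \<in> Basis"
    then show "C_k k (\<lambda>x. f x * frechet_derivative g (at x) b + frechet_derivative f (at x) b * g x)"
      using Suc.prems C_k_SucD[OF Suc.prems(1)] C_k_SucD[OF Suc.prems(2)]
      by (intro C_k_add Suc.IH) auto
  qed
qed (auto intro: continuous_intros)

lemma C_k_prod:
  assumes "finite I" "\<And>i. i \<in> I \<Longrightarrow> C_k k (f i)"
  shows "C_k k (\<lambda>x. \<Prod>i\<in>I. f i x)"
  using assms by (induction I rule: finite_induct) (auto intro: C_k_mult)

lemma C_k_inner: "C_k k (\<lambda>x. x \<bullet> b)"
proof (cases k)
  case (Suc j)
  show ?thesis unfolding Suc
    by (rule C_k_SucI[where D="\<lambda>_ h. h \<bullet> b"]) (auto intro: derivative_eq_intros)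
qed (auto intro: continuous_intros)

text \<open>Both coefficients are kept general because differentiation exchanges sine and cosine.\<close>

lemma C_k_sin_cos:
  fixes \<omega> :: real
  shows "C_k k (\<lambda>t::real. \<alpha> * sin (\<omega> * t) + \<beta> * cos (\<omega> * t))"
proof (induction k arbitrary: \<alpha> \<beta>)
  case (Suc k)
  show ?case
  proof (rule C_k_SucI)
    show "((\<lambda>t. \<alpha> * sin (\<omega> * t) + \<beta> * cos (\<omega> * t)) has_derivative
      (\<lambda>h. h * ((- \<beta> * \<omega>) * sin (\<omega> * t) + (\<alpha> * \<omega>) * cos (\<omega> * t)))) (at t)" for t
      by (auto intro!: derivative_eq_intros simp: algebra_simps)
    show "C_k k (\<lambda>x. b * ((- \<beta> * \<omega>) * sin (\<omega> * x) + (\<alpha> * \<omega>) * cos (\<omega> * x)))" for b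
      by (intro C_k_mult C_k_const Suc.IH)
  qed
qed (auto intro!: continuous_intros)

text \<open>For \<open>j = 0\<close> this is the standard smooth function that vanishes to infinite order at \<open>0\<close>. The powers of
  \<open>1 / x\<close> are included since derivatives of \<open>flat j\<close> are then linear combinations of the same family,
  which makes smoothness a plain induction.\<close>

definition flat :: "nat \<Rightarrow> real \<Rightarrow> real" where
  "flat j x = (if x \<le> 0 then 0 else exp (- 1 / x) / x ^ j)"

lemma flat_tendsto_0: "(flat j \<longlongrightarrow> 0) (at 0)"
proof -
  have "((\<lambda>z::real. z ^ j / exp z) \<longlongrightarrow> 0) at_top"
    by (rule tendsto_power_div_exp_0)
  then have "((\<lambda>x::real. inverse x ^ j / exp (inverse x)) \<longlongrightarrow> 0) (at_right 0)"
    by (rule filterlim_compose) (rule filterlim_inverse_at_top_right)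
  then have 1: "(flat j \<longlongrightarrow> 0) (at_right 0)"
    by (rule Lim_transform_eventually)
      (auto simp: flat_def eventually_at_filter exp_minus field_simps)
  have 2: "(flat j \<longlongrightarrow> 0) (at_left 0)"
    by (rule tendsto_eventually) (auto simp: flat_def eventually_at_filter)
  show ?thesis using 1 2 filterlim_split_at by blast
qed

lemma flat_has_field_derivative:
  "(flat j has_field_derivative (flat (j + 2) x - j * flat (j + 1) x)) (at x)"
proof -
  consider "x < 0" | "x = 0" | "x > 0" by linarith
  then show ?thesis
  proof cases
    case 1
    have "((\<lambda>_. 0) has_field_derivative 0) (at x)" by simp
    then have "(flat j has_field_derivative 0) (at x)"
      by (rule has_field_derivative_transform_within_open[of _ _ _ "{..<0}"])
        (use 1 in \<open>auto simp: flat_def\<close>)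
    then show ?thesis using 1 by (simp add: flat_def)
  next
    case 2
    have "((\<lambda>h. flat j h / h) \<longlongrightarrow> 0) (at 0)"
      using flat_tendsto_0[of "j + 1"]
      by (rule Lim_transform_eventually) (auto simp: flat_def eventually_at_filter)
    then show ?thesis using 2 by (simp add: has_field_derivative_iff flat_def)
  next
    case 3
    have "x ^ j = x * x ^ (j - 1)" if "j \<noteq> 0"
      using that by (simp add: power_eq_if)
    then have "((\<lambda>x. exp (- 1 / x) / x ^ j) has_field_derivative
        (flat (j + 2) x - j * flat (j + 1) x)) (at x)"
      using 3 by (cases "j = 0") (auto intro!: derivative_eq_intros simp: flat_def field_simps power2_eq_square)
    then show ?thesis
      by (rule has_field_derivative_transform_within_open[of _ _ _ "{0<..}"])
        (use 3 in \<open>auto simp: flat_def\<close>)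
  qed
qed

lemma C_k_flat: "C_k k (\<lambda>x::'a::euclidean_space. flat j (s * (x \<bullet> b) + r))"
proof (induction k arbitrary: j)
  case 0
  have "continuous_on UNIV (flat j)"
    using flat_has_field_derivative by (intro DERIV_continuous_on) (auto intro: has_field_derivative_at_within)
  then show ?case
    by (auto intro!: continuous_intros continuous_on_compose2[of UNIV "flat j"])
next
  case (Suc k)
  show ?case
  proof (rule C_k_SucI)
    show "((\<lambda>x. flat j (s * (x \<bullet> b) + r)) has_derivative (\<lambda>h. (s * (h \<bullet> b)) *
        (flat (j + 2) (s * (x \<bullet> b) + r) + (- real j) * flat (j + 1) (s * (x \<bullet> b) + r)))) (at x)" for x
    proof -
      have "((\<lambda>x. s * (x \<bullet> b) + r) has_derivative (\<lambda>h. s * (h \<bullet> b))) (at x)"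
        by (auto intro!: derivative_eq_intros)
      from has_derivative_compose[OF this
          flat_has_field_derivative[of j "s * (x \<bullet> b) + r", unfolded has_field_derivative_def]]
      show ?thesis by (simp add: algebra_simps)
    qed
    show "C_k k (\<lambda>x. (s * (b' \<bullet> b)) *
        (flat (j + 2) (s * (x \<bullet> b) + r) + (- real j) * flat (j + 1) (s * (x \<bullet> b) + r)))" for b'
      by (intro C_k_mult C_k_add C_k_const Suc.IH)
  qed
qed

text \<open>A smooth function supported in \<open>cbox p q\<close>. As \<open>flat 0 (N x) = flat 0 x powr (1 / N)\<close> for positive
  arguments, its values increase to \<open>1\<close> inside the box as \<open>N\<close> grows, so no mollification is needed to
  approximate indicator functions by test functions.\<close>

definition box_bump :: "real \<Rightarrow> 'a \<Rightarrow> 'a \<Rightarrow> 'a::euclidean_space \<Rightarrow> real" where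
  "box_bump N p q x = (\<Prod>b\<in>Basis. flat 0 (N * (x \<bullet> b - p \<bullet> b)) * flat 0 (N * (q \<bullet> b - x \<bullet> b)))"

lemma box_bump_test_function:
  assumes "cbox p q \<subseteq> U" "N > 0"
  shows "box_bump N p q \<in> test_functions U"
proof -
  have "C_k k (box_bump N p q)" for k
  proof -
    have "C_k k (\<lambda>x. \<Prod>b\<in>Basis. flat 0 (N * (x \<bullet> b) + (- N * (p \<bullet> b))) *
                      flat 0 ((- N) * (x \<bullet> b) + N * (q \<bullet> b)))"
      by (intro C_k_prod C_k_mult C_k_flat finite_Basis)
    then show ?thesis by (simp add: box_bump_def[abs_def] algebra_simps)
  qed
  moreover have "box_bump N p q x = 0" if x: "x \<notin> cbox p q" for x
  proof -
    obtain b where "b \<in> Basis" "x \<bullet> b < p \<bullet> b \<or> x \<bullet> b > q \<bullet> b"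
      using x unfolding mem_box by (meson not_le)
    then show ?thesis using \<open>N > 0\<close>
      by (auto simp: box_bump_def flat_def mult_le_0_iff intro!: prod_zero bexI[of _ b])
  qed
  ultimately show ?thesis using assms(1)
    by (auto simp: test_functions_def intro!: exI[of _ "cbox p q"])
qed

lemma flat_0_bounds: "0 \<le> flat 0 x" "flat 0 x \<le> 1"
  by (auto simp: flat_def)

lemma box_bump_bounds: "0 \<le> box_bump N p q x" "box_bump N p q x \<le> 1"
  unfolding box_bump_def
  by (auto intro!: prod_nonneg prod_le_1 mult_le_one flat_0_bounds mult_nonneg_nonneg)

lemma flat_0_scaled_tendsto:
  "(\<lambda>N. flat 0 (real (Suc N) * y)) \<longlonglongrightarrow> (if y > 0 then 1 else 0)"
proof (cases "y > 0")
  case True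
  have "(\<lambda>N. exp (- 1 / (real (Suc N) * y))) \<longlonglongrightarrow> exp 0"
  proof (rule tendsto_exp)
    have "(\<lambda>N. - inverse y * inverse (real (Suc N))) \<longlonglongrightarrow> - inverse y * 0"
      by (intro tendsto_intros LIMSEQ_inverse_real_of_nat)
    then show "(\<lambda>N. - 1 / (real (Suc N) * y)) \<longlonglongrightarrow> 0"
      by (simp add: field_simps del: of_nat_Suc)
  qed
  then show ?thesis using True by (simp add: flat_def mult_le_0_iff del: of_nat_Suc)
next
  case False
  then show ?thesis by (simp add: flat_def mult_le_0_iff del: of_nat_Suc)
qed

lemma box_bump_tendsto_indicator:
  "(\<lambda>N. box_bump (real (Suc N)) p q x) \<longlonglongrightarrow> indicator (box p q) x"
proof -
  have "(\<lambda>N. box_bump (real (Suc N)) p q x) \<longlonglongrightarrow>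
     (\<Prod>b\<in>Basis. (if x \<bullet> b - p \<bullet> b > 0 then 1 else 0) * (if q \<bullet> b - x \<bullet> b > 0 then 1 else 0))"
    unfolding box_bump_def by (intro tendsto_prod tendsto_mult flat_0_scaled_tendsto)
  also have "(\<Prod>b\<in>Basis. (if x \<bullet> b - p \<bullet> b > 0 then 1 else 0) * (if q \<bullet> b - x \<bullet> b > 0 then 1 else 0))
      = (indicator (box p q) x :: real)"
    by (auto simp: indicator_def mem_box intro!: prod.neutral prod_zero)
  finally show ?thesis .
qed

lemma test_functions_C_k: "\<psi> \<in> test_functions U \<Longrightarrow> C_k k \<psi>"
  by (auto simp: test_functions_def)

lemma test_functions_has_derivative:
  "\<psi> \<in> test_functions U \<Longrightarrow> (\<psi> has_derivative frechet_derivative \<psi> (at x)) (at x)"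
  by (meson C_k_has_derivative test_functions_C_k)

lemma test_functions_mult:
  assumes "\<psi> \<in> test_functions U" "\<And>k. C_k k c"
  shows "(\<lambda>x. c x * \<psi> x) \<in> test_functions U"
  using assms unfolding test_functions_def by (auto intro!: C_k_mult)

section \<open>Integration by parts and the fundamental lemma\<close>

text \<open>Test functions on \<open>\<Omega>\<close> live on the whole space, so their integrals may be computed with respect to the
  translation-invariant measure \<open>lborel\<close>.\<close>

lemma continuous_compact_support_integral:
  fixes F :: "'a::euclidean_space \<Rightarrow> real"
  assumes cont: "continuous_on UNIV F" and K: "compact K" and supp: "\<And>x. x \<notin> K \<Longrightarrow> F x = 0"
  shows "integrable lborel F"
    and "K \<subseteq> \<Omega> \<Longrightarrow> \<Omega> \<in> sets lebesgue \<Longrightarrow> integrable (lebesgue_on \<Omega>) F"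
    and "K \<subseteq> \<Omega> \<Longrightarrow> \<Omega> \<in> sets lebesgue \<Longrightarrow> (LINT x|lebesgue_on \<Omega>. F x) = (LINT x|lborel. F x)"
proof -
  have "integrable lborel (\<lambda>x. indicator K x *\<^sub>R F x)"
    using K cont by (intro borel_integrable_compact) (auto intro: continuous_on_subset)
  moreover have "(\<lambda>x. indicator K x *\<^sub>R F x) = F"
    using supp by (auto simp: indicator_def fun_eq_iff)
  ultimately show int: "integrable lborel F" by simp
  have [measurable]: "F \<in> borel_measurable borel"
    using cont by (rule borel_measurable_continuous_onI)
  assume "K \<subseteq> \<Omega>" and \<Omega>: "\<Omega> \<in> sets lebesgue"
  then have *: "(\<lambda>x. if x \<in> \<Omega> then F x else 0) = F"
    using supp by (auto simp: fun_eq_iff)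
  show "integrable (lebesgue_on \<Omega>) F"
    using Lebesgue_Measure.integrable_restrict_UNIV[OF \<Omega>, of F] int by (simp add: * integrable_completion)
  show "(LINT x|lebesgue_on \<Omega>. F x) = (LINT x|lborel. F x)"
    using Lebesgue_Measure.integral_restrict_UNIV[OF \<Omega>, of F] by (simp add: * integral_completion)
qed

lemma continuous_compact_support_bounded:
  fixes F :: "'a::euclidean_space \<Rightarrow> real"
  assumes cont: "continuous_on UNIV F" and K: "compact K" and supp: "\<And>x. x \<notin> K \<Longrightarrow> F x = 0"
  obtains C where "\<And>x. \<bar>F x\<bar> \<le> C"
proof -
  have "bounded (F ` K)"
    using K cont by (intro compact_imp_bounded compact_continuous_image) (auto intro: continuous_on_subset)
  then obtain C where C: "\<And>x. x \<in> K \<Longrightarrow> \<bar>F x\<bar> \<le> C"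
    by (auto simp: bounded_iff)
  have "\<bar>F x\<bar> \<le> max C 0" for x
    using C[of x] supp[of x] by (cases "x \<in> K") auto
  then show thesis by (rule that)
qed

lemma has_derivative_eq_zero_off_support:
  fixes F :: "'a::euclidean_space \<Rightarrow> real"
  assumes D: "(F has_derivative D) (at x)"
    and K: "compact K" and supp: "\<And>x. x \<notin> K \<Longrightarrow> F x = 0" and x: "x \<notin> K"
  shows "D b = 0"
proof -
  have "open (- K)" using K by (simp add: compact_imp_closed open_Compl)
  have "((\<lambda>_. 0) has_derivative (\<lambda>_. 0)) (at x)" by simp
  then have "(F has_derivative (\<lambda>_. 0)) (at x)"
    by (rule has_derivative_transform_within_open[OF _ \<open>open (- K)\<close>]) (use x supp in auto)
  then have "D = (\<lambda>_. 0)" using D has_derivative_unique by blast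
  then show ?thesis by simp
qed

text \<open>By translation invariance the difference quotients of \<open>F\<close> have integral \<open>0\<close>. They are bounded by the
  maximum of the derivative and vanish outside a fixed ball, so the integral passes to the limit.\<close>

lemma integral_directional_derivative_eq_0:
  fixes F :: "'a::euclidean_space \<Rightarrow> real"
  assumes D: "\<And>x. (F has_derivative D x) (at x)" and cont: "continuous_on UNIV (\<lambda>x. D x b)"
    and K: "compact K" and supp: "\<And>x. x \<notin> K \<Longrightarrow> F x = 0"
  shows "(LINT x|lborel. D x b) = 0"
proof -
  have contF: "continuous_on UNIV F"
    using D by (auto simp: continuous_on_eq_continuous_at intro: has_derivative_continuous)
  have [measurable]: "F \<in> borel_measurable borel" "(\<lambda>x. D x b) \<in> borel_measurable borel"
    using cont contF by (auto intro: borel_measurable_continuous_onI)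
  have intF: "integrable lborel F"
    by (rule continuous_compact_support_integral(1)[OF contF K supp])
  have D0: "D x b = 0" if "x \<notin> K" for x
    using has_derivative_eq_zero_off_support[OF D K supp that] .
  obtain C where C: "\<And>x. \<bar>D x b\<bar> \<le> C"
    using continuous_compact_support_bounded[OF cont K D0] by blast
  obtain R where R: "\<And>x. x \<in> K \<Longrightarrow> norm x \<le> R"
    using compact_imp_bounded[OF K] by (auto simp: bounded_iff)
  define h where "h n = inverse (real (Suc n))" for n
  have h: "0 < h n" "h n \<le> 1" for n by (auto simp: h_def field_simps)
  define q where "q n x = (F (h n *\<^sub>R b + x) - F x) / h n" for n x
  define Q where "Q = cball (0::'a) (R + norm b)"
  have line: "((\<lambda>t. F (x + t *\<^sub>R b)) has_derivative (\<lambda>s. s * D (x + t *\<^sub>R b) b)) (at t)" for x t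
  proof -
    have "((\<lambda>t. x + t *\<^sub>R b) has_derivative (\<lambda>s. s *\<^sub>R b)) (at t)"
      by (auto intro!: derivative_eq_intros)
    from has_derivative_compose[OF this D]
    show ?thesis
      using linear_scale[OF has_derivative_linear[OF D]] by simp
  qed
  have q_bound: "norm (q n x) \<le> indicator Q x *\<^sub>R C" for n x
  proof (cases "x \<in> Q")
    case True
    obtain t where "F (x + h n *\<^sub>R b) - F (x + 0 *\<^sub>R b) = h n * D (x + t *\<^sub>R b) b"
      using mvt_simple[OF h(1)[of n], of "\<lambda>t. F (x + t *\<^sub>R b)" "\<lambda>t s. s * D (x + t *\<^sub>R b) b",
          OF has_derivative_at_withinI[OF line]] by auto
    then have "q n x = D (x + t *\<^sub>R b) b"
      using h(1)[of n] by (simp add: q_def add.commute)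
    then show ?thesis using True C by simp
  next
    case False
    then have "norm x > R + norm b" by (simp add: Q_def)
    have "norm (h n *\<^sub>R b) \<le> norm b"
      using h[of n] by (simp add: mult_left_le_one_le)
    moreover have "norm x \<le> norm (h n *\<^sub>R b + x) + norm (h n *\<^sub>R b)"
      by (metis add.commute add_diff_cancel norm_triangle_sub norm_triangle_ineq4)
    ultimately have "norm (h n *\<^sub>R b + x) > R" using \<open>norm x > R + norm b\<close> by linarith
    moreover have "norm x > R" using \<open>norm x > R + norm b\<close> norm_ge_zero[of b] by linarith
    ultimately have "F x = 0" "F (h n *\<^sub>R b + x) = 0"
      using supp R by force+
    then show ?thesis using False by (simp add: q_def)
  qed
  have q_lim: "(\<lambda>n. q n x) \<longlonglongrightarrow> D x b" for x
  proof -
    have "((\<lambda>t. F (x + t *\<^sub>R b)) has_field_derivative D x b) (at 0)"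
      using line[of x 0] by (simp add: has_field_derivative_def mult_commute_abs)
    then have "((\<lambda>t. (F (x + t *\<^sub>R b) - F x) / t) \<longlongrightarrow> D x b) (at 0)"
      by (simp add: has_field_derivative_iff)
    moreover have "filterlim h (at 0) sequentially"
      unfolding filterlim_at using h(1) LIMSEQ_inverse_real_of_nat
      by (auto simp: h_def[abs_def] less_imp_neq[symmetric])
    ultimately show ?thesis
      unfolding q_def by (auto dest: filterlim_compose simp: add.commute)
  qed
  have int_q: "(LINT x|lborel. q n x) = 0" for n
  proof -
    have "integrable lborel (\<lambda>x. F (h n *\<^sub>R b + x))"
      using integrable_distr_eq[of "(+) (h n *\<^sub>R b)" lborel borel F] intF
      by (simp add: lborel_distr_plus)
    moreover have "(LINT x|lborel. F (h n *\<^sub>R b + x)) = (LINT x|lborel. F x)"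
      using integral_distr[of "(+) (h n *\<^sub>R b)" lborel borel F]
      by (simp add: lborel_distr_plus)
    ultimately show ?thesis using intF by (simp add: q_def)
  qed
  have "(\<lambda>n. LINT x|lborel. q n x) \<longlonglongrightarrow> (LINT x|lborel. D x b)"
  proof (rule integral_dominated_convergence)
    show "integrable lborel (\<lambda>x. indicator Q x *\<^sub>R C)"
      by (rule borel_integrable_compact) (auto simp: Q_def)
    show "q n \<in> borel_measurable lborel" for n
      unfolding q_def by measurable
  qed (use q_lim q_bound in auto)
  then show ?thesis
    by (simp add: int_q LIMSEQ_const_iff)
qed

lemma test_functions_derivative_continuous:
  assumes "\<psi> \<in> test_functions U" "b \<in> Basis"
  shows "continuous_on UNIV (\<lambda>x. frechet_derivative \<psi> (at x) b)"
  using test_functions_C_k[OF assms(1), of "Suc 0"] assms(2) by auto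

lemma test_functions_continuous: "\<psi> \<in> test_functions U \<Longrightarrow> continuous_on UNIV \<psi>"
  using test_functions_C_k[of \<psi> U 0] by auto

lemma test_functions_support:
  assumes "\<psi> \<in> test_functions U"
  obtains K where "compact K" "K \<subseteq> U" "\<And>x. x \<notin> K \<Longrightarrow> \<psi> x = 0"
    "\<And>x b. x \<notin> K \<Longrightarrow> frechet_derivative \<psi> (at x) b = 0"
proof -
  obtain K where K: "compact K" "K \<subseteq> U" "\<And>x. x \<notin> K \<Longrightarrow> \<psi> x = 0"
    using assms by (auto simp: test_functions_def)
  then show thesis
    using has_derivative_eq_zero_off_support[OF test_functions_has_derivative[OF assms] K(1,3)]
    by (intro that) auto
qed

text \<open>The product \<open>\<psi> \<eta>\<close> has compact support, so its derivative integrates to \<open>0\<close>.\<close>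

lemma test_function_integration_by_parts:
  assumes \<psi>: "\<psi> \<in> test_functions \<Omega>" and \<eta>: "\<eta> \<in> test_functions \<Omega>"
    and \<Omega>: "\<Omega> \<in> sets lebesgue" and b: "b \<in> Basis"
  shows "(LINT x|lebesgue_on \<Omega>. \<psi> x * frechet_derivative \<eta> (at x) b) =
       - (LINT x|lebesgue_on \<Omega>. frechet_derivative \<psi> (at x) b * \<eta> x)"
proof -
  obtain K where K: "compact K" "K \<subseteq> \<Omega>" "\<And>x. x \<notin> K \<Longrightarrow> \<psi> x = 0"
    "\<And>x b. x \<notin> K \<Longrightarrow> frechet_derivative \<psi> (at x) b = 0"
    using test_functions_support[OF \<psi>] by blast
  let ?f = "\<lambda>x. \<psi> x * frechet_derivative \<eta> (at x) b"
  let ?g = "\<lambda>x. frechet_derivative \<psi> (at x) b * \<eta> x"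
  have cont: "continuous_on UNIV ?f" "continuous_on UNIV ?g"
    using test_functions_derivative_continuous[OF \<psi> b] test_functions_derivative_continuous[OF \<eta> b]
      test_functions_continuous[OF \<psi>] test_functions_continuous[OF \<eta>]
    by (auto intro: continuous_on_mult)
  have "((\<lambda>x. \<psi> x * \<eta> x) has_derivative
     (\<lambda>h. \<psi> x * frechet_derivative \<eta> (at x) h + frechet_derivative \<psi> (at x) h * \<eta> x)) (at x)" for x
    by (intro has_derivative_mult test_functions_has_derivative[OF \<psi>] test_functions_has_derivative[OF \<eta>])
  from integral_directional_derivative_eq_0[of "\<lambda>x. \<psi> x * \<eta> x", OF this continuous_on_add[OF cont] K(1)]
  have "(LINT x|lborel. ?f x + ?g x) = 0" by (simp add: K(3))
  also have "(LINT x|lborel. ?f x + ?g x) = (LINT x|lborel. ?f x) + (LINT x|lborel. ?g x)"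
    using cont K continuous_compact_support_integral(1)[of _ K]
    by (intro Bochner_Integration.integral_add) auto
  also have "(LINT x|lborel. ?f x) = (LINT x|lebesgue_on \<Omega>. ?f x)"
    using cont K \<Omega> continuous_compact_support_integral(3)[of ?f K \<Omega>] by auto
  also have "(LINT x|lborel. ?g x) = (LINT x|lebesgue_on \<Omega>. ?g x)"
    using cont K \<Omega> continuous_compact_support_integral(3)[of ?g K \<Omega>] by auto
  finally show ?thesis by linarith
qed

text \<open>The boxes form an intersection-stable generator of the Borel sets, and the sets on which \<open>V\<close> has
  integral \<open>0\<close> are closed under complements and disjoint unions.\<close>

lemma AE_eq_0_if_box_integrals_eq_0:
  fixes V :: "'a::euclidean_space \<Rightarrow> real"
  assumes V: "integrable lborel V" and box: "\<And>p q. (LINT x:box p q|lborel. V x) = 0"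
  shows "AE x in lborel. V x = 0"
proof (rule sigma_finite_measure.density_zero[OF sigma_finite_lborel V])
  have si: "set_integrable lborel A V" if "A \<in> sets borel" for A
    using V that unfolding set_integrable_def by (intro integrable_mult_indicator) auto
  have UN_eq: "(\<Union>n. box (- real n *\<^sub>R One) (real n *\<^sub>R One)) = (UNIV :: 'a set)"
    using UN_box_eq_UNIV by auto
  have "(\<lambda>n. LINT x:box (- real n *\<^sub>R One) (real n *\<^sub>R One)|lborel. V x) \<longlonglongrightarrow>
     (LINT x:(\<Union>n. box (- real n *\<^sub>R One) (real n *\<^sub>R (One::'a)))|lborel. V x)"
  proof (rule set_integral_cont_up)
    have "- real m < y \<and> y < real m" if "m \<ge> n" "- real n < y" "y < real n" for m n y
      using that by auto
    then show "incseq (\<lambda>n. box (- real n *\<^sub>R One) (real n *\<^sub>R (One::'a)))"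
      by (fastforce simp: incseq_def mem_box)
  qed (auto intro!: si simp: UN_eq)
  then have "(LINT x:UNIV|lborel. V x) = 0"
    unfolding UN_eq by (simp add: box LIMSEQ_const_iff)
  then have total: "(LINT x|lborel. V x) = 0"
    by (simp add: set_lebesgue_integral_def)
  fix A :: "'a set" assume "A \<in> sets lborel"
  then have A: "A \<in> sigma_sets UNIV (range (\<lambda>(p, q). box p q))"
    by (simp add: borel_eq_box)
  have "Int_stable (range (\<lambda>(p, q). box p q :: 'a set))"
    by (auto simp: Int_stable_def box_Int_box)
  moreover have "range (\<lambda>(p, q). box p q :: 'a set) \<subseteq> Pow UNIV" by auto
  ultimately show "(LINT x:A|lborel. V x) = 0"
    using A
  proof (induction rule: sigma_sets_induct_disjoint)
    case (compl A)
    then have "A \<in> sets borel" by (simp add: borel_eq_box)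
    have "(LINT x:(UNIV - A)|lborel. V x) = (LINT x|lborel. V x - indicator A x *\<^sub>R V x)"
      unfolding set_lebesgue_integral_def
      by (intro Bochner_Integration.integral_cong) (auto simp: indicator_def)
    also have "\<dots> = (LINT x|lborel. V x) - (LINT x:A|lborel. V x)"
      using V si[OF \<open>A \<in> sets borel\<close>] unfolding set_lebesgue_integral_def set_integrable_def
      by (rule Bochner_Integration.integral_diff)
    finally show ?case using compl total by simp
  next
    case (union F)
    then have F: "F i \<in> sets borel" for i by (auto simp: borel_eq_box)
    have "(LINT x:(\<Union>i. F i)|lborel. V x) = (\<Sum>i. (LINT x:(F i)|lborel. V x))"
      using union(1) F
      by (intro lebesgue_integral_countable_add si) (auto simp: disjoint_family_on_def)
    then show ?case using union by simp
  next
    case empty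
    show ?case by (simp add: set_lebesgue_integral_def)
  qed (auto simp: box)
qed

lemma integral_mult_box_bump_tendsto:
  assumes w: "integrable (lebesgue_on \<Omega>) w"
  shows "(\<lambda>N. LINT x|lebesgue_on \<Omega>. w x * box_bump (real (Suc N)) p q x) \<longlonglongrightarrow>
        (LINT x|lebesgue_on \<Omega>. w x * indicator (box p q) x)"
proof (rule integral_dominated_convergence)
  show "integrable (lebesgue_on \<Omega>) (\<lambda>x. norm (w x))" using w by simp
  have [measurable]: "w \<in> borel_measurable (lebesgue_on \<Omega>)" using w by simp
  have "indicator (box p q) \<in> borel_measurable (lebesgue_on \<Omega>)"
    by (intro measurable_restrict_space1 measurable_completion) simp
  then show "(\<lambda>x. w x * indicator (box p q) x) \<in> borel_measurable (lebesgue_on \<Omega>)"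
    by measurable
  have "box_bump (real (Suc N)) p q \<in> test_functions UNIV" for N
    by (intro box_bump_test_function) auto
  then have "box_bump (real (Suc N)) p q \<in> borel_measurable (lebesgue_on \<Omega>)" for N
    by (intro measurable_restrict_space1 measurable_completion)
      (auto intro!: borel_measurable_continuous_onI test_functions_continuous simp del: of_nat_Suc)
  then show "(\<lambda>x. w x * box_bump (real (Suc N)) p q x) \<in> borel_measurable (lebesgue_on \<Omega>)" for N
    by measurable
  show "AE x in lebesgue_on \<Omega>. (\<lambda>N. w x * box_bump (real (Suc N)) p q x)
      \<longlonglongrightarrow> w x * indicator (box p q) x"
    by (intro AE_I2 tendsto_intros box_bump_tendsto_indicator)
  show "AE x in lebesgue_on \<Omega>. norm (w x * box_bump (real (Suc N)) p q x) \<le> norm (w x)" for N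
    using box_bump_bounds[of "real (Suc N)" p q] by (auto simp: abs_mult mult_left_le)
qed

text \<open>The fundamental lemma of the calculus of variations. Testing with box bumps shows that \<open>w\<close> has integral
  \<open>0\<close> over every box whose closure lies in \<open>\<Omega>\<close>; countably many such boxes cover \<open>\<Omega>\<close>.\<close>

lemma weighted_test_integrals_eq_0_imp_AE_eq_0:
  fixes w :: "'a::euclidean_space \<Rightarrow> real"
  assumes \<Omega>: "open \<Omega>" and w: "integrable (lebesgue_on \<Omega>) w"
    and orth: "\<And>\<psi>. \<psi> \<in> test_functions \<Omega> \<Longrightarrow> (LINT x|lebesgue_on \<Omega>. w x * \<psi> x) = 0"
  shows "AE x in lebesgue_on \<Omega>. w x = 0"
proof -
  have \<Omega>L: "\<Omega> \<in> sets lebesgue" using \<Omega> by auto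
  define W where "W x = (if x \<in> \<Omega> then w x else 0)" for x
  have W: "integrable lebesgue W"
    unfolding W_def using Lebesgue_Measure.integrable_restrict_UNIV[OF \<Omega>L, of w] w by simp
  \<comment> \<open>Boxes generate the Borel sets only, so \<open>W\<close> is replaced by a Borel representative.\<close>
  then obtain V where V: "V \<in> borel_measurable lborel" and WV: "AE x in lborel. W x = V x"
    using completion_ex_borel_measurable_real[of W lborel] by auto
  have [measurable]: "W \<in> borel_measurable lebesgue" "V \<in> borel_measurable borel"
    "V \<in> borel_measurable lebesgue"
    using W V by (auto intro: measurable_completion)
  have WV': "AE x in lebesgue. W x = V x" using WV by (rule AE_completion)
  have "integrable lebesgue V"
    using integrable_cong_AE_imp[OF W _ WV'] by simp
  then have intV: "integrable lborel V" by (simp add: integrable_completion)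
  have box0: "(LINT x:box p q|lborel. V x) = 0" if "cbox p q \<subseteq> \<Omega>" for p q
  proof -
    have "(\<lambda>N. LINT x|lebesgue_on \<Omega>. w x * box_bump (real (Suc N)) p q x) \<longlonglongrightarrow>
          (LINT x|lebesgue_on \<Omega>. w x * indicator (box p q) x)"
      using w by (rule integral_mult_box_bump_tendsto)
    moreover have "(LINT x|lebesgue_on \<Omega>. w x * box_bump (real (Suc N)) p q x) = 0" for N
      using that by (intro orth box_bump_test_function) auto
    ultimately have "(LINT x|lebesgue_on \<Omega>. w x * indicator (box p q) x) = 0"
      by (simp add: LIMSEQ_const_iff del: of_nat_Suc)
    also have "(LINT x|lebesgue_on \<Omega>. w x * indicator (box p q) x)
        = (LINT x|lebesgue. indicator (box p q) x * W x)"
      unfolding Lebesgue_Measure.integral_restrict_UNIV[OF \<Omega>L, symmetric]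
      by (intro Bochner_Integration.integral_cong) (auto simp: W_def)
    also have "\<dots> = (LINT x|lebesgue. indicator (box p q) x * V x)"
      using WV' by (intro integral_cong_AE borel_measurable_times borel_measurable_indicator) auto
    also have "\<dots> = (LINT x|lborel. indicator (box p q) x * V x)"
      by (intro integral_completion) auto
    finally show ?thesis by (simp add: set_lebesgue_integral_def)
  qed
  have cbox0: "AE x in lebesgue. x \<in> cbox p q \<longrightarrow> W x = 0" if sub: "cbox p q \<subseteq> \<Omega>" for p q
  proof -
    have "AE x in lborel. indicator (box p q) x * V x = 0"
    proof (rule AE_eq_0_if_box_integrals_eq_0)
      show "integrable lborel (\<lambda>x. indicator (box p q) x * V x)"
        using integrable_mult_indicator[OF _ intV, of "box p q"] by simp
      fix p' q' :: 'a
      obtain p'' q'' where *: "box p' q' \<inter> box p q = box p'' q''" using box_Int_box[of p' q' p q] by blast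
      have "(LINT x:box p' q'|lborel. indicator (box p q) x * V x) = (LINT x:box p'' q''|lborel. V x)"
        unfolding set_lebesgue_integral_def *[symmetric] by (simp add: indicator_inter_arith mult.assoc)
      also have "\<dots> = 0"
      proof (cases "box p'' q'' = {}")
        case False
        then have "cbox p'' q'' = closure (box p'' q'')" by simp
        also have "\<dots> \<subseteq> closure (box p q)" using * by (intro closure_mono) auto
        also have "\<dots> \<subseteq> cbox p q" using closed_cbox box_subset_cbox by (intro closure_minimal)
        finally show ?thesis using box0 sub by auto
      qed (simp add: set_lebesgue_integral_def)
      finally show "(LINT x:box p' q'|lborel. indicator (box p q) x * V x) = 0" .
    qed
    then have "AE x in lebesgue. indicator (box p q) x * V x = 0" by (rule AE_completion)
    moreover have "AE x in lebesgue. x \<notin> cbox p q - box p q"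
      using negligible_frontier_interval negligible_iff_null_sets AE_not_in by blast
    ultimately show ?thesis using WV' by eventually_elim (auto simp: indicator_def split: if_splits)
  qed
  obtain \<D> where \<D>: "countable \<D>" "\<D> \<subseteq> Pow \<Omega>" "\<And>X. X \<in> \<D> \<Longrightarrow> \<exists>p q. X = cbox p q" "\<Union>\<D> = \<Omega>"
    using open_countable_Union_open_cbox[OF \<Omega>] by metis
  have "AE x in lebesgue. x \<in> X \<longrightarrow> W x = 0" if "X \<in> \<D>" for X
    using cbox0 \<D>(2,3) that by blast
  then have "AE x in lebesgue. \<forall>X\<in>\<D>. x \<in> X \<longrightarrow> W x = 0"
    by (subst AE_ball_countable[OF \<D>(1)]) blast
  then have "AE x in lebesgue. x \<in> \<Omega> \<longrightarrow> w x = 0"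
    by eventually_elim (metis Union_iff \<D>(4) W_def)
  then show ?thesis using \<Omega>L by (simp add: AE_restrict_space_iff)
qed

section \<open>The space \<open>L\<^sup>2\<close> and orthonormal systems\<close>

lemma L2_measurable: "f \<in> L2 \<Omega> \<Longrightarrow> f \<in> borel_measurable (lebesgue_on \<Omega>)"
  by (simp add: L2_def)

lemma L2_mult_integrable:
  assumes "f \<in> L2 \<Omega>" "g \<in> L2 \<Omega>"
  shows "integrable (lebesgue_on \<Omega>) (\<lambda>x. f x * g x)"
proof (rule Bochner_Integration.integrable_bound)
  show "integrable (lebesgue_on \<Omega>) (\<lambda>x. (f x)\<^sup>2 + (g x)\<^sup>2)"
    using assms by (auto simp: L2_def)
  have "\<bar>a * b\<bar> \<le> a\<^sup>2 + b\<^sup>2" for a b :: real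
  proof -
    have "2 * \<bar>a\<bar> * \<bar>b\<bar> \<le> a\<^sup>2 + b\<^sup>2" "0 \<le> \<bar>a\<bar> * \<bar>b\<bar>"
      using sum_squares_bound[of "\<bar>a\<bar>" "\<bar>b\<bar>"] by auto
    then show ?thesis unfolding abs_mult by linarith
  qed
  then show "AE x in lebesgue_on \<Omega>. norm (f x * g x) \<le> norm ((f x)\<^sup>2 + (g x)\<^sup>2)"
    by auto
qed (use assms in \<open>auto simp: L2_def\<close>)

lemma subspace_L2: "subspace (L2 \<Omega>)"
proof (rule subspaceI)
  have "(\<lambda>x. 0) \<in> L2 \<Omega>" by (simp add: L2_def)
  then show "0 \<in> L2 \<Omega>" unfolding zero_fun_def .
next
  fix f g assume fg: "f \<in> L2 \<Omega>" "g \<in> L2 \<Omega>"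
  have "integrable (lebesgue_on \<Omega>) (\<lambda>x. (f x)\<^sup>2 + (g x)\<^sup>2 + 2 * (f x * g x))"
    using fg L2_mult_integrable[OF fg] unfolding L2_def by (intro Bochner_Integration.integrable_add) auto
  moreover have "(\<lambda>x. f x + g x) \<in> borel_measurable (lebesgue_on \<Omega>)"
    using fg by (intro borel_measurable_add L2_measurable)
  ultimately show "f + g \<in> L2 \<Omega>"
    unfolding plus_fun_def L2_def by (simp add: power2_sum mult.assoc)
next
  fix c f assume "f \<in> L2 \<Omega>"
  then show "c *\<^sub>R f \<in> L2 \<Omega>"
    unfolding L2_def scaleR_fun_def by (auto simp: power_mult_distrib)
qed

lemmas L2_closed =
  subspace_add[OF subspace_L2] subspace_diff[OF subspace_L2] subspace_scale[OF subspace_L2]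

lemma L2_inner_commute: "L2_inner \<Omega> f g = L2_inner \<Omega> g f"
  by (simp add: L2_inner_def mult.commute)

lemma L2_inner_add:
  "f \<in> L2 \<Omega> \<Longrightarrow> g \<in> L2 \<Omega> \<Longrightarrow> k \<in> L2 \<Omega> \<Longrightarrow> L2_inner \<Omega> (f + g) k = L2_inner \<Omega> f k + L2_inner \<Omega> g k"
  by (simp add: L2_inner_def L2_mult_integrable distrib_right)

lemma L2_inner_diff:
  "f \<in> L2 \<Omega> \<Longrightarrow> g \<in> L2 \<Omega> \<Longrightarrow> k \<in> L2 \<Omega> \<Longrightarrow> L2_inner \<Omega> (f - g) k = L2_inner \<Omega> f k - L2_inner \<Omega> g k"
  by (simp add: L2_inner_def L2_mult_integrable left_diff_distrib)

lemma L2_inner_scaleR: "L2_inner \<Omega> (c *\<^sub>R f) g = c * L2_inner \<Omega> f g"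
  by (simp add: L2_inner_def scaleR_fun_def mult.assoc)

lemma L2_inner_add_right:
  "f \<in> L2 \<Omega> \<Longrightarrow> g \<in> L2 \<Omega> \<Longrightarrow> k \<in> L2 \<Omega> \<Longrightarrow> L2_inner \<Omega> k (f + g) = L2_inner \<Omega> k f + L2_inner \<Omega> k g"
  by (simp add: L2_inner_add L2_inner_commute[of \<Omega> k])

lemma L2_inner_diff_right:
  "f \<in> L2 \<Omega> \<Longrightarrow> g \<in> L2 \<Omega> \<Longrightarrow> k \<in> L2 \<Omega> \<Longrightarrow> L2_inner \<Omega> k (f - g) = L2_inner \<Omega> k f - L2_inner \<Omega> k g"
  by (simp add: L2_inner_diff L2_inner_commute[of \<Omega> k])

lemma L2_inner_scaleR_right: "L2_inner \<Omega> g (c *\<^sub>R f) = c * L2_inner \<Omega> g f"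
  by (simp add: L2_inner_scaleR L2_inner_commute[of \<Omega> g])

lemma L2_inner_sum:
  assumes "finite I" "\<And>i. i \<in> I \<Longrightarrow> f i \<in> L2 \<Omega>" "k \<in> L2 \<Omega>"
  shows "L2_inner \<Omega> (\<Sum>i\<in>I. c i *\<^sub>R f i) k = (\<Sum>i\<in>I. c i * L2_inner \<Omega> (f i) k)"
  using assms
proof (induction I rule: finite_induct)
  case empty
  show ?case by (simp add: L2_inner_def)
next
  case (insert i I)
  then have "(\<Sum>i\<in>I. c i *\<^sub>R f i) \<in> L2 \<Omega>" "c i *\<^sub>R f i \<in> L2 \<Omega>"
    by (auto intro!: subspace_sum[OF subspace_L2] L2_closed)
  then have "L2_inner \<Omega> (c i *\<^sub>R f i + (\<Sum>i\<in>I. c i *\<^sub>R f i)) k =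
      c i * L2_inner \<Omega> (f i) k + (\<Sum>i\<in>I. c i * L2_inner \<Omega> (f i) k)"
    unfolding L2_inner_add[OF \<open>c i *\<^sub>R f i \<in> L2 \<Omega>\<close> \<open>(\<Sum>i\<in>I. c i *\<^sub>R f i) \<in> L2 \<Omega>\<close> insert.prems(2)]
      L2_inner_scaleR using insert by simp
  then show ?case unfolding sum.insert[OF insert.hyps] .
qed

lemma L2_inner_self_nonneg: "0 \<le> L2_inner \<Omega> f f"
  by (auto simp: L2_inner_def intro!: Bochner_Integration.integral_nonneg)

lemma L2_norm_nonneg: "0 \<le> L2_norm \<Omega> f"
  by (simp add: L2_norm_def L2_inner_self_nonneg)

lemma L2_norm_power2: "(L2_norm \<Omega> f)\<^sup>2 = L2_inner \<Omega> f f"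
  by (simp add: L2_norm_def L2_inner_self_nonneg)

lemma L2_norm_scaleR: "L2_norm \<Omega> (c *\<^sub>R f) = \<bar>c\<bar> * L2_norm \<Omega> f"
  by (simp add: L2_norm_def L2_inner_scaleR L2_inner_scaleR_right real_sqrt_mult
      flip: mult.assoc power2_eq_square)

lemma L2_inner_diff_self:
  assumes "f \<in> L2 \<Omega>" "g \<in> L2 \<Omega>"
  shows "L2_inner \<Omega> (f - g) (f - g) = L2_inner \<Omega> f f - 2 * L2_inner \<Omega> f g + L2_inner \<Omega> g g"
  using assms
  by (simp add: L2_inner_diff L2_inner_diff_right L2_closed L2_inner_commute[of \<Omega> g f])

text \<open>The quadratic polynomial \<open>s \<mapsto> \<parallel>f - s g\<parallel>\<^sup>2\<close> is nonnegative. As the norm is only a seminorm on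
  functions, \<open>\<parallel>g\<parallel> = 0\<close> has to be treated on its own.\<close>

lemma L2_Cauchy_Schwarz:
  assumes f: "f \<in> L2 \<Omega>" and g: "g \<in> L2 \<Omega>"
  shows "\<bar>L2_inner \<Omega> f g\<bar> \<le> L2_norm \<Omega> f * L2_norm \<Omega> g"
proof -
  let ?a = "L2_inner \<Omega> f f" and ?b = "L2_inner \<Omega> f g" and ?c = "L2_inner \<Omega> g g"
  have q: "0 \<le> ?a - 2 * s * ?b + s\<^sup>2 * ?c" for s
  proof -
    have "L2_inner \<Omega> (f - s *\<^sub>R g) (f - s *\<^sub>R g) = ?a - 2 * s * ?b + s\<^sup>2 * ?c"
      using f g by (simp add: L2_inner_diff_self L2_closed L2_inner_scaleR L2_inner_scaleR_right
          power2_eq_square)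
    then show ?thesis using L2_inner_self_nonneg by metis
  qed
  have "?b\<^sup>2 \<le> ?a * ?c"
  proof (cases "?c = 0")
    case True
    have "?b = 0"
    proof (rule ccontr)
      assume "?b \<noteq> 0"
      \<comment> \<open>At this \<open>s\<close> the polynomial, now of degree one, has the value \<open>-1\<close>.\<close>
      then show False using q[of "(?a + 1) / (2 * ?b)"] True by (simp add: field_simps)
    qed
    then show ?thesis using True by simp
  next
    case False
    then have "?c > 0" using L2_inner_self_nonneg[of \<Omega> g] by linarith
    then show ?thesis
      using q[of "?b / ?c"] by (simp add: field_simps power2_eq_square)
  qed
  then have "\<bar>?b\<bar> \<le> sqrt (?a * ?c)"
    by (simp add: real_le_rsqrt flip: real_sqrt_abs)
  then show ?thesis by (simp add: L2_norm_def real_sqrt_mult)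
qed

lemma L2_norm_triangle:
  assumes "f \<in> L2 \<Omega>" "g \<in> L2 \<Omega>"
  shows "L2_norm \<Omega> (f + g) \<le> L2_norm \<Omega> f + L2_norm \<Omega> g"
proof (rule power2_le_imp_le)
  have "(L2_norm \<Omega> (f + g))\<^sup>2 = L2_inner \<Omega> f f + 2 * L2_inner \<Omega> f g + L2_inner \<Omega> g g"
    using assms by (simp add: L2_norm_power2 L2_inner_add L2_inner_add_right L2_closed
        L2_inner_commute[of \<Omega> g f])
  also have "\<dots> \<le> (L2_norm \<Omega> f + L2_norm \<Omega> g)\<^sup>2"
    using L2_Cauchy_Schwarz[OF assms] by (simp add: power2_sum L2_norm_power2)
  finally show "(L2_norm \<Omega> (f + g))\<^sup>2 \<le> (L2_norm \<Omega> f + L2_norm \<Omega> g)\<^sup>2" .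
qed (simp add: L2_norm_nonneg)

lemma L2_inner_cong_AE:
  assumes "f \<in> L2 \<Omega>" "f' \<in> L2 \<Omega>" "g \<in> L2 \<Omega>" "AE x in lebesgue_on \<Omega>. f x = f' x"
  shows "L2_inner \<Omega> f g = L2_inner \<Omega> f' g"
  unfolding L2_inner_def
  using assms by (intro integral_cong_AE borel_measurable_times) (auto simp: L2_def)

lemma L2_norm_cong_AE:
  assumes "f \<in> L2 \<Omega>" "f' \<in> L2 \<Omega>" "AE x in lebesgue_on \<Omega>. f x = f' x"
  shows "L2_norm \<Omega> f = L2_norm \<Omega> f'"
  unfolding L2_norm_def
  using assms L2_inner_cong_AE L2_inner_commute by metis

lemma L2_integrable_on_bounded:
  assumes "f \<in> L2 \<Omega>" "bounded \<Omega>" "\<Omega> \<in> sets lebesgue"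
  shows "integrable (lebesgue_on \<Omega>) f"
proof -
  have "\<Omega> \<in> lmeasurable" using assms by (simp add: bounded_set_imp_lmeasurable)
  then have "finite_measure (lebesgue_on \<Omega>)" by (rule finite_measure_lebesgue_on)
  then have "(\<lambda>x. 1) \<in> L2 \<Omega>"
    by (simp add: L2_def finite_measure.integrable_const)
  from L2_mult_integrable[OF assms(1) this] show ?thesis by simp
qed

definition L2_orthonormal :: "'a::euclidean_space set \<Rightarrow> (nat \<Rightarrow> 'a \<Rightarrow> real) \<Rightarrow> bool" where
  "L2_orthonormal \<Omega> \<phi> \<longleftrightarrow> (\<forall>m. \<phi> m \<in> L2 \<Omega>) \<and>
     (\<forall>m k. L2_inner \<Omega> (\<phi> m) (\<phi> k) = (if m = k then 1 else 0))"

text \<open>Both Bessel's inequality and the optimality of the Fourier coefficients can be read off from this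
  identity.\<close>

lemma L2_dist_to_orthonormal_combination:
  assumes \<phi>: "L2_orthonormal \<Omega> \<phi>" and v: "v \<in> L2 \<Omega>" and I: "finite I"
  shows "(L2_norm \<Omega> (v - (\<Sum>m\<in>I. c m *\<^sub>R \<phi> m)))\<^sup>2 =
    (L2_norm \<Omega> v)\<^sup>2 - (\<Sum>m\<in>I. (L2_inner \<Omega> v (\<phi> m))\<^sup>2) + (\<Sum>m\<in>I. (c m - L2_inner \<Omega> v (\<phi> m))\<^sup>2)"
proof -
  let ?w = "\<Sum>m\<in>I. c m *\<^sub>R \<phi> m"
  have \<phi>L: "\<phi> m \<in> L2 \<Omega>" and on: "L2_inner \<Omega> (\<phi> m) (\<phi> k) = (if m = k then 1 else 0)" for m k
    using \<phi> by (auto simp: L2_orthonormal_def)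
  have w: "?w \<in> L2 \<Omega>" by (intro subspace_sum[OF subspace_L2] L2_closed \<phi>L)
  have w\<phi>: "L2_inner \<Omega> ?w (\<phi> k) = c k" if "k \<in> I" for k
    using that I by (simp add: L2_inner_sum \<phi>L on if_distrib sum.delta cong: if_cong)
  have "L2_inner \<Omega> ?w v = (\<Sum>m\<in>I. c m * L2_inner \<Omega> v (\<phi> m))"
    by (subst L2_inner_sum[OF I \<phi>L v]) (simp add: L2_inner_commute[of \<Omega> v])
  moreover have "L2_inner \<Omega> ?w ?w = (\<Sum>m\<in>I. c m * c m)"
    unfolding L2_inner_sum[OF I \<phi>L w] using w\<phi> by (simp add: L2_inner_commute[of \<Omega> "\<phi> _"])
  ultimately show ?thesis
    unfolding L2_norm_power2 L2_inner_diff_self[OF v w]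
    by (simp add: L2_inner_commute[of \<Omega> v ?w] power2_diff sum.distrib sum_subtractf
        power2_eq_square sum_distrib_left algebra_simps)
qed

lemma L2_Bessel:
  assumes "L2_orthonormal \<Omega> \<phi>" "v \<in> L2 \<Omega>" "finite I"
  shows "(\<Sum>m\<in>I. (L2_inner \<Omega> v (\<phi> m))\<^sup>2) \<le> (L2_norm \<Omega> v)\<^sup>2"
  using L2_dist_to_orthonormal_combination[OF assms, of "\<lambda>m. L2_inner \<Omega> v (\<phi> m)"]
    zero_le_power2[of "L2_norm \<Omega> (v - (\<Sum>m\<in>I. L2_inner \<Omega> v (\<phi> m) *\<^sub>R \<phi> m))"] by simp

text \<open>Half of Parseval's identity: an arbitrary combination close to \<open>v\<close> is at least as far from \<open>v\<close> as the
  one with the Fourier coefficients, so the square sums of the coefficients come close to \<open>\<parallel>v\<parallel>\<^sup>2\<close>.\<close>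

lemma L2_norm_le_if_coefficients_le:
  assumes \<phi>: "L2_orthonormal \<Omega> \<phi>"
    and dense: "\<And>\<epsilon>. \<epsilon> > 0 \<Longrightarrow> \<exists>w\<in>span (range \<phi>). L2_norm \<Omega> (v - w) < \<epsilon>"
    and v: "v \<in> L2 \<Omega>"
    and C: "0 \<le> C" "\<And>I. finite I \<Longrightarrow> (\<Sum>m\<in>I. (L2_inner \<Omega> v (\<phi> m))\<^sup>2) \<le> C\<^sup>2"
  shows "L2_norm \<Omega> v \<le> C"
proof (rule power2_le_imp_le[OF _ C(1)], rule field_le_epsilon)
  fix e :: real assume "e > 0"
  then obtain w where w: "w \<in> span (range \<phi>)" "L2_norm \<Omega> (v - w) < sqrt e"
    using dense[of "sqrt e"] by auto
  obtain I c where I: "finite I" "w = (\<Sum>m\<in>I. c m *\<^sub>R \<phi> m)"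
  proof -
    have "inj \<phi>"
      using \<phi> by (metis L2_orthonormal_def injI zero_neq_one)
    obtain S r where S: "finite S" "S \<subseteq> range \<phi>" "w = (\<Sum>a\<in>S. r a *\<^sub>R a)"
      using w(1) by (auto simp: span_explicit)
    have "S = \<phi> ` (\<phi> -` S)" using S(2) by auto
    then have "w = (\<Sum>m\<in>\<phi> -` S. r (\<phi> m) *\<^sub>R \<phi> m)"
      using S(3) \<open>inj \<phi>\<close> by (metis (no_types, lifting) inj_on_subset subset_UNIV sum.reindex_cong)
    then show thesis
      using that[of "\<phi> -` S" "\<lambda>m. r (\<phi> m)"] finite_vimageI[OF S(1) \<open>inj \<phi>\<close>] by blast
  qed
  have "(L2_norm \<Omega> (v - w))\<^sup>2 < (sqrt e)\<^sup>2"
    using w(2) L2_norm_nonneg by (intro power_strict_mono) auto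
  then have "(L2_norm \<Omega> v)\<^sup>2 - (\<Sum>m\<in>I. (L2_inner \<Omega> v (\<phi> m))\<^sup>2) \<le> e"
    using L2_dist_to_orthonormal_combination[OF \<phi> v I(1), of c] I(2) \<open>e > 0\<close>
      sum_nonneg[of I "\<lambda>m. (c m - L2_inner \<Omega> v (\<phi> m))\<^sup>2"] by auto
  then show "(L2_norm \<Omega> v)\<^sup>2 \<le> C\<^sup>2 + e"
    using C(2)[OF I(1)] by linarith
qed

section \<open>Weak derivatives, the Poincare inequality and eigenvalues\<close>

lemma continuous_compact_support_L2:
  assumes "continuous_on UNIV F" "compact K" "K \<subseteq> \<Omega>" "\<And>x. x \<notin> K \<Longrightarrow> F x = 0" "\<Omega> \<in> sets lebesgue"
  shows "F \<in> L2 \<Omega>"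
proof -
  have "integrable (lebesgue_on \<Omega>) F"
    using assms by (intro continuous_compact_support_integral(2)[where K=K]) auto
  moreover have "integrable (lebesgue_on \<Omega>) (\<lambda>x. (F x)\<^sup>2)"
    using assms by (intro continuous_compact_support_integral(2)[where K=K])
      (auto intro: continuous_on_power)
  ultimately show ?thesis by (simp add: L2_def)
qed

lemma test_functions_L2:
  assumes \<psi>: "\<psi> \<in> test_functions \<Omega>" and \<Omega>: "\<Omega> \<in> sets lebesgue"
  shows "\<psi> \<in> L2 \<Omega>" and "b \<in> Basis \<Longrightarrow> (\<lambda>x. frechet_derivative \<psi> (at x) b) \<in> L2 \<Omega>"
proof -
  obtain K where K: "compact K" "K \<subseteq> \<Omega>" "\<And>x. x \<notin> K \<Longrightarrow> \<psi> x = 0"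
    "\<And>x b. x \<notin> K \<Longrightarrow> frechet_derivative \<psi> (at x) b = 0"
    using test_functions_support[OF \<psi>] by blast
  show "\<psi> \<in> L2 \<Omega>"
    by (rule continuous_compact_support_L2[OF test_functions_continuous[OF \<psi>] K(1-3) \<Omega>])
  show "(\<lambda>x. frechet_derivative \<psi> (at x) b) \<in> L2 \<Omega>" if "b \<in> Basis"
    by (rule continuous_compact_support_L2[OF test_functions_derivative_continuous[OF \<psi> that] K(1,2,4) \<Omega>])
qed

lemma axis_1_Basis [simp]: "axis i (1::real) \<in> Basis"
  by (auto simp: Basis_vec_def)

lemma test_functions_has_weak_pderiv:
  assumes "\<psi> \<in> test_functions \<Omega>" "\<Omega> \<in> sets lebesgue"
  shows "has_weak_pderiv \<Omega> i \<psi> (\<lambda>x. frechet_derivative \<psi> (at x) (axis i 1))"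
  using test_function_integration_by_parts[OF assms(1) _ assms(2)] by (simp add: has_weak_pderiv_def)

lemma has_weak_pderiv_diff:
  assumes "has_weak_pderiv \<Omega> i f w" "has_weak_pderiv \<Omega> i g v"
    and "f \<in> L2 \<Omega>" "g \<in> L2 \<Omega>" "w \<in> L2 \<Omega>" "v \<in> L2 \<Omega>" "\<Omega> \<in> sets lebesgue"
  shows "has_weak_pderiv \<Omega> i (f - g) (w - v)"
  unfolding has_weak_pderiv_def
proof
  fix \<eta> assume \<eta>: "\<eta> \<in> test_functions \<Omega>"
  then have "\<eta> \<in> L2 \<Omega>" "(\<lambda>x. frechet_derivative \<eta> (at x) (axis i 1)) \<in> L2 \<Omega>"
    using assms by (auto intro: test_functions_L2)
  then show "(LINT x|lebesgue_on \<Omega>. (f - g) x * frechet_derivative \<eta> (at x) (axis i 1)) =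
         - (LINT x|lebesgue_on \<Omega>. (w - v) x * \<eta> x)"
    using assms \<eta> by (simp add: has_weak_pderiv_def left_diff_distrib L2_mult_integrable)
qed

lemma has_weak_pderiv_scaleR:
  "has_weak_pderiv \<Omega> i f w \<Longrightarrow> has_weak_pderiv \<Omega> i (c *\<^sub>R f) (c *\<^sub>R w)"
  by (simp add: has_weak_pderiv_def scaleR_fun_def mult.assoc)

lemma has_weak_pderiv_unique:
  assumes "has_weak_pderiv \<Omega> i f w" "has_weak_pderiv \<Omega> i f v" "w \<in> L2 \<Omega>" "v \<in> L2 \<Omega>"
    and "open \<Omega>" "bounded \<Omega>"
  shows "AE x in lebesgue_on \<Omega>. w x = v x"
proof -
  have \<Omega>: "\<Omega> \<in> sets lebesgue" using \<open>open \<Omega>\<close> by auto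
  have "AE x in lebesgue_on \<Omega>. (w - v) x = 0"
  proof (rule weighted_test_integrals_eq_0_imp_AE_eq_0[OF \<open>open \<Omega>\<close>])
    show "integrable (lebesgue_on \<Omega>) (w - v)"
      using assms \<Omega> by (intro L2_integrable_on_bounded L2_closed)
    fix \<eta> assume "\<eta> \<in> test_functions \<Omega>"
    then show "(LINT x|lebesgue_on \<Omega>. (w - v) x * \<eta> x) = 0"
      using assms \<Omega> test_functions_L2(1)[of \<eta> \<Omega>]
      by (simp add: has_weak_pderiv_def left_diff_distrib L2_mult_integrable)
  qed
  then show ?thesis by simp
qed

lemma weak_pderiv_works:
  assumes "f \<in> H1 \<Omega>"
  shows "weak_pderiv \<Omega> i f \<in> L2 \<Omega>" "has_weak_pderiv \<Omega> i f (weak_pderiv \<Omega> i f)"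
proof -
  have "\<exists>w. w \<in> L2 \<Omega> \<and> has_weak_pderiv \<Omega> i f w" using assms by (auto simp: H1_def)
  from someI_ex[OF this]
  show "weak_pderiv \<Omega> i f \<in> L2 \<Omega>" "has_weak_pderiv \<Omega> i f (weak_pderiv \<Omega> i f)"
    by (auto simp: weak_pderiv_def)
qed

lemma H1_L2: "f \<in> H1 \<Omega> \<Longrightarrow> f \<in> L2 \<Omega>"
  by (simp add: H1_def)

lemma H10_H1: "f \<in> H10 \<Omega> \<Longrightarrow> f \<in> H1 \<Omega>"
  by (simp add: H10_def)

lemma H1_diff:
  assumes "f \<in> H1 \<Omega>" "g \<in> H1 \<Omega>" "\<Omega> \<in> sets lebesgue"
  shows "f - g \<in> H1 \<Omega>"
proof -
  have "has_weak_pderiv \<Omega> i (f - g) (weak_pderiv \<Omega> i f - weak_pderiv \<Omega> i g)" for i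
    using assms by (intro has_weak_pderiv_diff weak_pderiv_works H1_L2)
  moreover have "weak_pderiv \<Omega> i f - weak_pderiv \<Omega> i g \<in> L2 \<Omega>" for i
    using assms by (intro L2_closed weak_pderiv_works)
  ultimately show ?thesis
    using assms unfolding H1_def by (blast intro: L2_closed)
qed

lemma H1_scaleR:
  assumes "f \<in> H1 \<Omega>"
  shows "c *\<^sub>R f \<in> H1 \<Omega>"
proof -
  have "has_weak_pderiv \<Omega> i (c *\<^sub>R f) (c *\<^sub>R weak_pderiv \<Omega> i f)" for i
    using assms by (intro has_weak_pderiv_scaleR weak_pderiv_works)
  moreover have "c *\<^sub>R weak_pderiv \<Omega> i f \<in> L2 \<Omega>" for i
    using assms by (intro L2_closed weak_pderiv_works)
  ultimately show ?thesis
    using assms unfolding H1_def by (blast intro: L2_closed)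
qed

lemma test_functions_H1:
  assumes "\<psi> \<in> test_functions \<Omega>" "\<Omega> \<in> sets lebesgue"
  shows "\<psi> \<in> H1 \<Omega>"
  using test_functions_has_weak_pderiv[OF assms] test_functions_L2[OF assms]
  by (auto simp: H1_def intro!: bexI)

text \<open>The representatives that \<open>weak_pderiv\<close> chooses for \<open>c f\<close> and for \<open>f\<close> are unrelated. Uniqueness of
  weak derivatives is what makes the norm homogeneous.\<close>

lemma H1_norm_scaleR:
  assumes \<Omega>: "open \<Omega>" "bounded \<Omega>" and f: "f \<in> H1 \<Omega>"
  shows "H1_norm \<Omega> (c *\<^sub>R f) = \<bar>c\<bar> * H1_norm \<Omega> f"
proof -
  have "L2_norm \<Omega> (weak_pderiv \<Omega> i (c *\<^sub>R f)) = \<bar>c\<bar> * L2_norm \<Omega> (weak_pderiv \<Omega> i f)" for i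
  proof -
    have "AE x in lebesgue_on \<Omega>. weak_pderiv \<Omega> i (c *\<^sub>R f) x = (c *\<^sub>R weak_pderiv \<Omega> i f) x"
      using f \<Omega> by (intro has_weak_pderiv_unique[of \<Omega> i "c *\<^sub>R f"] has_weak_pderiv_scaleR
          weak_pderiv_works L2_closed H1_scaleR)
    then show ?thesis
      using f by (subst L2_norm_cong_AE) (auto simp: L2_norm_scaleR intro: weak_pderiv_works L2_closed H1_scaleR)
  qed
  then have "(L2_norm \<Omega> (c *\<^sub>R f))\<^sup>2 + (\<Sum>i\<in>UNIV. (L2_norm \<Omega> (weak_pderiv \<Omega> i (c *\<^sub>R f)))\<^sup>2) =
      c\<^sup>2 * ((L2_norm \<Omega> f)\<^sup>2 + (\<Sum>i\<in>UNIV. (L2_norm \<Omega> (weak_pderiv \<Omega> i f))\<^sup>2))"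
    by (simp add: L2_norm_scaleR power_mult_distrib sum_distrib_left distrib_left)
  then show ?thesis by (simp add: H1_norm_def real_sqrt_mult)
qed

lemma H1_norm_nonneg: "0 \<le> H1_norm \<Omega> f"
  by (simp add: H1_norm_def sum_nonneg)

lemma L2_norm_le_H1_norm: "L2_norm \<Omega> f \<le> H1_norm \<Omega> f"
  unfolding H1_norm_def by (rule real_le_rsqrt) (simp add: sum_nonneg)

lemma L2_norm_weak_pderiv_le_H1_norm: "L2_norm \<Omega> (weak_pderiv \<Omega> i f) \<le> H1_norm \<Omega> f"
  unfolding H1_norm_def
proof (rule real_le_rsqrt)
  have "(L2_norm \<Omega> (weak_pderiv \<Omega> i f))\<^sup>2 \<le> (\<Sum>i\<in>UNIV. (L2_norm \<Omega> (weak_pderiv \<Omega> i f))\<^sup>2)"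
    by (rule member_le_sum) auto
  then show "(L2_norm \<Omega> (weak_pderiv \<Omega> i f))\<^sup>2
      \<le> (L2_norm \<Omega> f)\<^sup>2 + (\<Sum>i\<in>UNIV. (L2_norm \<Omega> (weak_pderiv \<Omega> i f))\<^sup>2)"
    by (simp add: add_increasing)
qed

lemma test_functions_scaleR: "\<psi> \<in> test_functions U \<Longrightarrow> c *\<^sub>R \<psi> \<in> test_functions U"
  using test_functions_mult[of \<psi> U "\<lambda>_. c"] by (simp add: scaleR_fun_def)

lemma H10_scaleR:
  assumes \<Omega>: "open \<Omega>" "bounded \<Omega>" and f: "f \<in> H10 \<Omega>"
  shows "c *\<^sub>R f \<in> H10 \<Omega>"
proof -
  have \<Omega>L: "\<Omega> \<in> sets lebesgue" using \<Omega> by auto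
  have "\<exists>\<psi>\<in>test_functions \<Omega>. H1_norm \<Omega> (c *\<^sub>R f - \<psi>) < \<epsilon>" if "\<epsilon> > 0" for \<epsilon>
  proof -
    obtain \<psi> where \<psi>: "\<psi> \<in> test_functions \<Omega>" "H1_norm \<Omega> (f - \<psi>) < \<epsilon> / (\<bar>c\<bar> + 1)"
    proof -
      have "\<epsilon> / (\<bar>c\<bar> + 1) > 0" using \<open>\<epsilon> > 0\<close> by simp
      then show thesis using f that unfolding H10_def by blast
    qed
    have "H1_norm \<Omega> (c *\<^sub>R f - c *\<^sub>R \<psi>) = \<bar>c\<bar> * H1_norm \<Omega> (f - \<psi>)"
      using H1_norm_scaleR[OF \<Omega>, of "f - \<psi>" c] f \<psi> \<Omega>L H10_H1 H1_diff test_functions_H1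
      by (metis scaleR_right_diff_distrib)
    also have "\<dots> \<le> (\<bar>c\<bar> + 1) * H1_norm \<Omega> (f - \<psi>)"
      by (simp add: mult_right_mono H1_norm_nonneg)
    also have "\<dots> < \<epsilon>" using \<psi>(2) by (simp add: field_simps)
    finally show ?thesis using test_functions_scaleR[OF \<psi>(1)] by blast
  qed
  then show ?thesis using f H1_scaleR by (auto simp: H10_def)
qed

text \<open>Rescale \<open>v\<close> to the unit sphere of \<open>H1_norm\<close>, and use that the supremum defining \<open>Hm1_norm\<close> is over a
  bounded set.\<close>

lemma Hm1_norm_bound:
  assumes \<Omega>: "open \<Omega>" "bounded \<Omega>" and F: "F \<in> Hm1 \<Omega>" and v: "v \<in> H10 \<Omega>"
  shows "\<bar>F v\<bar> \<le> Hm1_norm \<Omega> F * H1_norm \<Omega> v"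
proof -
  obtain C where C: "\<And>u. u \<in> H10 \<Omega> \<Longrightarrow> \<bar>F u\<bar> \<le> C * H1_norm \<Omega> u"
    using F unfolding Hm1_def by blast
  show ?thesis
  proof (cases "H1_norm \<Omega> v = 0")
    case True
    then show ?thesis using C[OF v] by simp
  next
    case False
    define N where "N = H1_norm \<Omega> v"
    have N: "N > 0" using False H1_norm_nonneg[of \<Omega> v] by (simp add: N_def)
    let ?v = "(1 / N) *\<^sub>R v"
    have v': "?v \<in> H10 \<Omega>" by (rule H10_scaleR[OF \<Omega> v])
    moreover have "H1_norm \<Omega> ?v = 1"
      using N H1_norm_scaleR[OF \<Omega> H10_H1[OF v], of "1 / N"] by (simp flip: N_def)
    ultimately have mem: "?v \<in> {v \<in> H10 \<Omega>. H1_norm \<Omega> v \<le> 1}" by simp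
    have "bdd_above ((\<lambda>v. \<bar>F v\<bar>) ` {v \<in> H10 \<Omega>. H1_norm \<Omega> v \<le> 1})"
    proof (rule bdd_aboveI2)
      fix u assume "u \<in> {v \<in> H10 \<Omega>. H1_norm \<Omega> v \<le> 1}"
      then have "\<bar>F u\<bar> \<le> C * H1_norm \<Omega> u" "H1_norm \<Omega> u \<le> 1" using C by auto
      then show "\<bar>F u\<bar> \<le> \<bar>C\<bar>"
        using mult_mono[OF abs_ge_self, of "H1_norm \<Omega> u" 1 C] H1_norm_nonneg[of \<Omega> u] by simp
    qed
    from cSUP_upper[OF mem this] have "\<bar>F ?v\<bar> \<le> Hm1_norm \<Omega> F"
      by (simp add: Hm1_norm_def)
    moreover have "F ?v = F v / N"
      using F v by (simp add: Hm1_def)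
    ultimately show ?thesis using N by (simp add: N_def[symmetric] field_simps)
  qed
qed

text \<open>For a test function \<open>\<psi>\<close>, integrating \<open>\<psi>\<^sup>2\<close> by parts against the coordinate \<open>x\<^sub>i\<close> gives
  \<open>\<parallel>\<psi>\<parallel>\<^sup>2 = -2 (\<partial>\<^sub>i \<psi>, x\<^sub>i \<psi>)\<close>. As \<open>x\<^sub>i \<psi>\<close> is itself a test function, \<open>\<partial>\<^sub>i \<psi>\<close> may be replaced here by
  \<open>w - r\<close>, where \<open>w\<close> and \<open>r\<close> are the chosen weak derivatives of \<open>f\<close> and of \<open>f - \<psi>\<close>, and \<open>r\<close> is small
  when \<open>\<psi>\<close> is close to \<open>f\<close>. The Cauchy--Schwarz inequality does the rest.\<close>

lemma Poincare_inequality: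
  fixes \<Omega> :: "(real^'n) set"
  assumes \<Omega>: "open \<Omega>" and R: "\<And>x. x \<in> \<Omega> \<Longrightarrow> \<bar>x $ i\<bar> \<le> R" "0 \<le> R" and f: "f \<in> H10 \<Omega>"
  shows "L2_norm \<Omega> f \<le> 2 * R * L2_norm \<Omega> (weak_pderiv \<Omega> i f)"
proof (rule field_le_epsilon)
  fix e :: real assume "e > 0"
  have \<Omega>L: "\<Omega> \<in> sets lebesgue" using \<Omega> by auto
  \<comment> \<open>The error \<open>\<epsilon>\<close> enters once through \<open>f - \<psi>\<close> and \<open>2 R\<close> times through \<open>r\<close>.\<close>
  define \<epsilon> where "\<epsilon> = e / (2 * R + 1)"
  have \<epsilon>: "\<epsilon> > 0" using \<open>e > 0\<close> R(2) by (simp add: \<epsilon>_def)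
  then obtain \<psi> where \<psi>: "\<psi> \<in> test_functions \<Omega>" and close: "H1_norm \<Omega> (f - \<psi>) < \<epsilon>"
    using f by (auto simp: H10_def)
  have fH: "f \<in> H1 \<Omega>" and \<psi>H: "\<psi> \<in> H1 \<Omega>" and dH: "f - \<psi> \<in> H1 \<Omega>"
    using f \<psi> \<Omega>L by (auto intro: H10_H1 test_functions_H1 H1_diff)
  define w where "w = weak_pderiv \<Omega> i f"
  define r where "r = weak_pderiv \<Omega> i (f - \<psi>)"
  define d where "d x = frechet_derivative \<psi> (at x) (axis i 1)" for x
  define \<eta> where "\<eta> x = x $ i * \<psi> x" for x
  have L: "f \<in> L2 \<Omega>" "\<psi> \<in> L2 \<Omega>" "w \<in> L2 \<Omega>" "r \<in> L2 \<Omega>" "d \<in> L2 \<Omega>"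
    using fH \<psi>H dH test_functions_L2[OF \<psi> \<Omega>L] by (auto simp: w_def r_def d_def[abs_def] intro: H1_L2 weak_pderiv_works)
  have \<eta>: "\<eta> \<in> test_functions \<Omega>"
    unfolding \<eta>_def
    using test_functions_mult[OF \<psi> C_k_inner, of "axis i 1"] by (simp add: inner_axis)
  have L\<eta>: "\<eta> \<in> L2 \<Omega>" using \<eta> \<Omega>L by (rule test_functions_L2)
  have "has_weak_pderiv \<Omega> i (f - \<psi>) (w - d)" "has_weak_pderiv \<Omega> i (f - \<psi>) r"
    using fH dH L \<Omega>L test_functions_has_weak_pderiv[OF \<psi> \<Omega>L, of i]
    by (auto simp: w_def r_def d_def[abs_def] intro!: has_weak_pderiv_diff weak_pderiv_works)
  then have "L2_inner \<Omega> (w - d) \<eta> = L2_inner \<Omega> r \<eta>"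
    using \<eta> by (auto simp: has_weak_pderiv_def L2_inner_def)
  then have d\<eta>: "L2_inner \<Omega> d \<eta> = L2_inner \<Omega> (w - r) \<eta>"
    using L L\<eta> by (simp add: L2_inner_diff)
  have \<eta>': "frechet_derivative \<eta> (at x) (axis i 1) = \<psi> x + x $ i * d x" for x
  proof -
    have "((\<lambda>x. x $ i * \<psi> x) has_derivative
        (\<lambda>h. x $ i * frechet_derivative \<psi> (at x) h + h $ i * \<psi> x)) (at x)"
      by (intro has_derivative_mult test_functions_has_derivative[OF \<psi>] bounded_linear_imp_has_derivative
          bounded_linear_vec_nth)
    from frechet_derivative_at[OF this, symmetric] show ?thesis
      unfolding \<eta>_def[abs_def] d_def by simp
  qed
  have x\<psi>d: "\<psi> x * (x $ i * d x) = d x * \<eta> x" for x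
    by (auto simp: \<eta>_def)
  have "(LINT x|lebesgue_on \<Omega>. \<psi> x * (\<psi> x + x $ i * d x)) = - L2_inner \<Omega> d \<eta>"
    using test_function_integration_by_parts[OF \<psi> \<eta> \<Omega>L, of "axis i 1"]
    by (simp add: \<eta>' L2_inner_def d_def)
  moreover have "(LINT x|lebesgue_on \<Omega>. \<psi> x * (\<psi> x + x $ i * d x)) = L2_inner \<Omega> \<psi> \<psi> + L2_inner \<Omega> d \<eta>"
    using L2_mult_integrable[OF L(2) L(2)] L2_mult_integrable[OF L(5) L\<eta>]
    unfolding distrib_left x\<psi>d L2_inner_def by simp
  ultimately have "L2_inner \<Omega> \<psi> \<psi> = - 2 * L2_inner \<Omega> (w - r) \<eta>"
    using d\<eta> by linarith
  also have "\<dots> \<le> 2 * (L2_norm \<Omega> (w - r) * L2_norm \<Omega> \<eta>)"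
    using L2_Cauchy_Schwarz[OF L2_closed(2)[OF L(3,4)] L\<eta>] by linarith
  also have "\<dots> \<le> 2 * (L2_norm \<Omega> (w - r) * (R * L2_norm \<Omega> \<psi>))"
  proof -
    have "L2_inner \<Omega> \<eta> \<eta> \<le> L2_inner \<Omega> (R *\<^sub>R \<psi>) (R *\<^sub>R \<psi>)"
      unfolding L2_inner_def
    proof (rule integral_mono)
      show "integrable (lebesgue_on \<Omega>) (\<lambda>x. \<eta> x * \<eta> x)"
        "integrable (lebesgue_on \<Omega>) (\<lambda>x. (R *\<^sub>R \<psi>) x * (R *\<^sub>R \<psi>) x)"
        using L L\<eta> by (auto intro!: L2_mult_integrable L2_closed)
      fix x assume "x \<in> space (lebesgue_on \<Omega>)"
      then have "\<bar>\<eta> x\<bar> \<le> \<bar>(R *\<^sub>R \<psi>) x\<bar>"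
        using R by (auto simp: \<eta>_def scaleR_fun_def abs_mult intro!: mult_right_mono)
      then show "\<eta> x * \<eta> x \<le> (R *\<^sub>R \<psi>) x * (R *\<^sub>R \<psi>) x"
        by (simp add: abs_le_square_iff flip: power2_eq_square)
    qed
    then have "L2_norm \<Omega> \<eta> \<le> L2_norm \<Omega> (R *\<^sub>R \<psi>)" by (simp add: L2_norm_def)
    then show ?thesis using R(2) by (simp add: L2_norm_scaleR mult_left_mono L2_norm_nonneg)
  qed
  finally have "L2_norm \<Omega> \<psi> * L2_norm \<Omega> \<psi> \<le> (2 * R * L2_norm \<Omega> (w - r)) * L2_norm \<Omega> \<psi>"
    by (simp add: algebra_simps flip: L2_norm_power2 power2_eq_square)
  then have "L2_norm \<Omega> \<psi> \<le> 2 * R * L2_norm \<Omega> (w - r)"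
    using L2_norm_nonneg[of \<Omega> \<psi>] L2_norm_nonneg[of \<Omega> "w - r"] R(2)
    by (cases "L2_norm \<Omega> \<psi> = 0") auto
  also have "L2_norm \<Omega> (w - r) \<le> L2_norm \<Omega> w + L2_norm \<Omega> r"
    using L2_norm_triangle[of w \<Omega> "(- 1) *\<^sub>R r"] L L2_closed(3)[of r \<Omega> "- 1"]
    by (simp only: L2_norm_scaleR) simp
  also have "L2_norm \<Omega> r \<le> \<epsilon>"
    using close L2_norm_weak_pderiv_le_H1_norm[of \<Omega> i "f - \<psi>"] by (simp add: r_def)
  finally have "L2_norm \<Omega> \<psi> \<le> 2 * R * (L2_norm \<Omega> w + \<epsilon>)"
    using R(2) by (simp add: mult_left_mono)
  moreover have "L2_norm \<Omega> f \<le> L2_norm \<Omega> (f - \<psi>) + L2_norm \<Omega> \<psi>"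
    using L2_norm_triangle[OF L2_closed(2)[OF L(1,2)] L(2)] by simp
  moreover have "L2_norm \<Omega> (f - \<psi>) \<le> \<epsilon>"
    using close L2_norm_le_H1_norm[of \<Omega> "f - \<psi>"] by simp
  ultimately have "L2_norm \<Omega> f \<le> 2 * R * L2_norm \<Omega> w + (2 * R + 1) * \<epsilon>"
    by (simp add: algebra_simps)
  then show "L2_norm \<Omega> f \<le> 2 * R * L2_norm \<Omega> (weak_pderiv \<Omega> i f) + e"
    using R(2) by (simp add: w_def \<epsilon>_def)
qed

lemma L2_mult_Linf:
  assumes "a \<in> Linf \<Omega>" "f \<in> L2 \<Omega>"
  shows "(\<lambda>x. a x * f x) \<in> L2 \<Omega>"
proof -
  obtain C where C: "AE x in lebesgue_on \<Omega>. \<bar>a x\<bar> \<le> C" using assms by (auto simp: Linf_def)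
  have "integrable (lebesgue_on \<Omega>) (\<lambda>x. (a x * f x)\<^sup>2)"
  proof (rule Bochner_Integration.integrable_bound)
    show "integrable (lebesgue_on \<Omega>) (\<lambda>x. C\<^sup>2 * (f x)\<^sup>2)" using assms by (simp add: L2_def)
    have sq: "\<bar>p\<bar> \<le> C \<Longrightarrow> (p * q)\<^sup>2 \<le> C\<^sup>2 * q\<^sup>2" for p q :: real
      unfolding power_mult_distrib by (intro mult_right_mono) (auto simp flip: abs_le_square_iff)
    show "AE x in lebesgue_on \<Omega>. norm ((a x * f x)\<^sup>2) \<le> norm (C\<^sup>2 * (f x)\<^sup>2)"
      using C by eventually_elim (simp add: sq)
  qed (use assms in \<open>auto simp: L2_def Linf_def\<close>)
  then show ?thesis using assms by (auto simp: L2_def Linf_def)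
qed

lemma bilinear_form_integrable:
  assumes "\<And>i j. a i j \<in> Linf \<Omega>" "u \<in> H1 \<Omega>" "v \<in> H1 \<Omega>"
  shows "integrable (lebesgue_on \<Omega>) (\<lambda>x. a i j x * weak_pderiv \<Omega> i u x * weak_pderiv \<Omega> j v x)"
  using assms by (intro L2_mult_integrable L2_mult_Linf weak_pderiv_works)

lemma bilinear_form_commute:
  assumes a: "\<And>i j. a i j \<in> Linf \<Omega>" and sym: "\<And>i j. AE x in lebesgue_on \<Omega>. a i j x = a j i x"
    and uv: "u \<in> H1 \<Omega>" "v \<in> H1 \<Omega>"
  shows "bilinear_form \<Omega> a u v = bilinear_form \<Omega> a v u"
  unfolding bilinear_form_def
proof (rule integral_cong_AE)
  have "AE x in lebesgue_on \<Omega>. \<forall>i j. a i j x = a j i x"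
    using sym by (simp add: AE_all_countable)
  then show "AE x in lebesgue_on \<Omega>.
      (\<Sum>i\<in>UNIV. \<Sum>j\<in>UNIV. a i j x * weak_pderiv \<Omega> i u x * weak_pderiv \<Omega> j v x) =
      (\<Sum>i\<in>UNIV. \<Sum>j\<in>UNIV. a i j x * weak_pderiv \<Omega> i v x * weak_pderiv \<Omega> j u x)"
  proof eventually_elim
    case (elim x)
    then show ?case by (subst sum.swap) (simp add: mult_ac)
  qed
qed (use bilinear_form_integrable[OF a] uv in \<open>auto intro!: borel_measurable_sum\<close>)

text \<open>A single partial derivative on the left suffices for the Poincare inequality.\<close>

lemma bilinear_form_coercive:
  fixes \<Omega> :: "(real^'n) set"
  assumes a: "\<And>i j. a i j \<in> Linf \<Omega>" and v: "v \<in> H1 \<Omega>"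
    and l: "0 \<le> l" "\<And>x y. x \<in> \<Omega> \<Longrightarrow> (\<Sum>i\<in>UNIV. \<Sum>j\<in>UNIV. a i j x * y $ i * y $ j) \<ge> l * (norm (y::real^'n))\<^sup>2"
  shows "l * (L2_norm \<Omega> (weak_pderiv \<Omega> k v))\<^sup>2 \<le> bilinear_form \<Omega> a v v"
  unfolding L2_norm_power2 L2_inner_def bilinear_form_def integral_mult_right_zero[symmetric]
proof (rule integral_mono)
  show "integrable (lebesgue_on \<Omega>) (\<lambda>x. l * (weak_pderiv \<Omega> k v x * weak_pderiv \<Omega> k v x))"
    using v by (auto intro!: L2_mult_integrable weak_pderiv_works)
  show "integrable (lebesgue_on \<Omega>)
     (\<lambda>x. \<Sum>i\<in>UNIV. \<Sum>j\<in>UNIV. a i j x * weak_pderiv \<Omega> i v x * weak_pderiv \<Omega> j v x)"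
    using v by (intro Bochner_Integration.integrable_sum bilinear_form_integrable[OF a])
  fix x assume "x \<in> space (lebesgue_on \<Omega>)"
  then have "x \<in> \<Omega>" by simp
  define y :: "real^'n" where "y = (\<chi> i. weak_pderiv \<Omega> i v x)"
  have "l * (y $ k * y $ k) \<le> l * (norm y)\<^sup>2"
    using component_le_norm_cart[of y k] l(1)
    by (intro mult_left_mono) (simp_all add: abs_le_square_iff[of _ "norm y", simplified] flip: power2_eq_square)
  also have "\<dots> \<le> (\<Sum>i\<in>UNIV. \<Sum>j\<in>UNIV. a i j x * y $ i * y $ j)" using l(2)[OF \<open>x \<in> \<Omega>\<close>] .
  finally show "l * (weak_pderiv \<Omega> k v x * weak_pderiv \<Omega> k v x) \<le>
      (\<Sum>i\<in>UNIV. \<Sum>j\<in>UNIV. a i j x * weak_pderiv \<Omega> i v x * weak_pderiv \<Omega> j v x)"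
    by (simp add: y_def)
qed

lemma eigensystem_orthonormal:
  "complete_eigensystem \<Omega> a \<phi> \<mu> \<Longrightarrow> L2_orthonormal \<Omega> \<phi>"
  by (auto simp: complete_eigensystem_def L2_orthonormal_def intro: H1_L2 H10_H1)

text \<open>Coercivity and the Poincare inequality give \<open>\<mu> m = B(\<phi> m, \<phi> m) \<ge> l \<parallel>\<partial>\<^sub>k \<phi> m\<parallel>\<^sup>2 \<ge> l / (2 R)\<^sup>2\<close>.\<close>

lemma eigenvalues_bounded_below:
  fixes \<Omega> :: "(real^'n) set"
  assumes \<Omega>: "open \<Omega>" "bounded \<Omega>" and a: "\<And>i j. a i j \<in> Linf \<Omega>"
    and ell: "uniformly_elliptic \<Omega> a" and eig: "complete_eigensystem \<Omega> a \<phi> \<mu>"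
  obtains c where "c > 0" "\<And>m. c \<le> \<mu> m"
proof -
  obtain l where l: "l > 0"
    "\<And>x y. x \<in> \<Omega> \<Longrightarrow> (\<Sum>i\<in>UNIV. \<Sum>j\<in>UNIV. a i j x * y $ i * y $ j) \<ge> l * (norm (y::real^'n))\<^sup>2"
    using ell by (auto simp: uniformly_elliptic_def)
  obtain R0 where "\<And>x. x \<in> \<Omega> \<Longrightarrow> norm x \<le> R0" using \<Omega>(2) by (auto simp: bounded_iff)
  define R where "R = \<bar>R0\<bar> + 1"
  \<comment> \<open>Any coordinate direction will do.\<close>
  define k :: 'n where "k = undefined"
  have R: "\<bar>x $ k\<bar> \<le> R" if "x \<in> \<Omega>" for x
    using component_le_norm_cart[of x k] \<open>\<And>x. x \<in> \<Omega> \<Longrightarrow> norm x \<le> R0\<close>[OF that] by (simp add: R_def)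
  have "R > 0" by (simp add: R_def)
  have "l / (2 * R)\<^sup>2 \<le> \<mu> m" for m
  proof -
    have \<phi>: "\<phi> m \<in> H10 \<Omega>" "bilinear_form \<Omega> a (\<phi> m) (\<phi> m) = \<mu> m" "L2_norm \<Omega> (\<phi> m) = 1"
      using eig by (auto simp: complete_eigensystem_def L2_norm_def)
    have "1 \<le> 2 * R * L2_norm \<Omega> (weak_pderiv \<Omega> k (\<phi> m))"
      using Poincare_inequality[OF \<Omega>(1) R _ \<phi>(1)] \<open>R > 0\<close> \<phi>(3) by simp
    then have "1 \<le> (2 * R * L2_norm \<Omega> (weak_pderiv \<Omega> k (\<phi> m)))\<^sup>2"
      by (simp add: one_le_power)
    then have "l / (2 * R)\<^sup>2 \<le> l * (L2_norm \<Omega> (weak_pderiv \<Omega> k (\<phi> m)))\<^sup>2"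
      using \<open>l > 0\<close> \<open>R > 0\<close> by (simp add: field_simps power_mult_distrib)
    also have "\<dots> \<le> \<mu> m"
      using bilinear_form_coercive[OF a H10_H1[OF \<phi>(1)] _ l(2)] l(1) \<phi>(2) by auto
    finally show ?thesis .
  qed
  moreover have "l / (2 * R)\<^sup>2 > 0" using l \<open>R > 0\<close> by simp
  ultimately show thesis using that by blast
qed

section \<open>Functionals of vector-valued integrals\<close>

text \<open>Completeness of Lebesgue measure makes limits that exist only almost everywhere measurable.\<close>

lemma borel_measurable_lebesgue_on_cong_AE:
  fixes f g :: "'a::euclidean_space \<Rightarrow> real"
  assumes S: "S \<in> sets lebesgue" and f: "f \<in> borel_measurable (lebesgue_on S)"
    and fg: "AE x in lebesgue_on S. f x = g x"
  shows "g \<in> borel_measurable (lebesgue_on S)"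
proof -
  have "(\<lambda>x. if x \<in> S then f x else 0) \<in> borel_measurable lebesgue"
    using f S by (simp add: borel_measurable_if)
  moreover have "AE x in lebesgue. (if x \<in> S then f x else 0) = (if x \<in> S then g x else 0)"
    using fg S by (auto simp: AE_restrict_space_iff elim!: eventually_mono)
  ultimately have "(\<lambda>x. if x \<in> S then g x else 0) \<in> borel_measurable lebesgue"
    by (rule borel_measurable_AE)
  then show ?thesis using S by (simp add: borel_measurable_if)
qed

text \<open>The values of the functional on the approximating simple functions converge almost everywhere.\<close>

lemma strongly_measurable_functional:
  fixes ell :: "'b::real_vector \<Rightarrow> real"
  assumes S: "S \<in> sets lebesgue" and X: "subspace X"
    and diff: "\<And>x y. x \<in> X \<Longrightarrow> y \<in> X \<Longrightarrow> ell (x - y) = ell x - ell y"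
    and bound: "\<And>x. x \<in> X \<Longrightarrow> \<bar>ell x\<bar> \<le> C * N x"
    and u: "strongly_measurable (lebesgue_on S) X N u"
  shows "(\<lambda>t. ell (u t)) \<in> borel_measurable (lebesgue_on S)"
proof -
  let ?M = "lebesgue_on S"
  obtain s where s: "\<And>k. simple_function ?M (s k)" "\<And>k. s k ` space ?M \<subseteq> X"
      and lim: "AE t in ?M. (\<lambda>k. N (u t - s k t)) \<longlonglongrightarrow> 0" and uX: "AE t in ?M. u t \<in> X"
    using u by (auto simp: strongly_measurable_def)
  have "simple_function ?M (\<lambda>t. ell (s k t))" for k
    using simple_function_compose[OF s(1), of ell] by (simp add: comp_def)
  then have "(\<lambda>t. ell (s k t)) \<in> borel_measurable ?M" for k
    by (rule borel_measurable_simple_function)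
  then have "(\<lambda>t. lim (\<lambda>k. ell (s k t))) \<in> borel_measurable ?M"
    by (rule borel_measurable_lim_metric)
  moreover have "AE t in ?M. lim (\<lambda>k. ell (s k t)) = ell (u t)"
    using lim uX AE_space
  proof eventually_elim
    case (elim t)
    have sX: "s k t \<in> X" for k using s(2) elim(3) by blast
    have "(\<lambda>k. ell (s k t) - ell (u t)) \<longlonglongrightarrow> 0"
    proof (rule Lim_null_comparison)
      show "\<forall>\<^sub>F k in sequentially. norm (ell (s k t) - ell (u t)) \<le> C * N (u t - s k t)"
        using bound[OF subspace_diff[OF X elim(2) sX]] diff[OF elim(2) sX]
        by (simp add: abs_minus_commute)
      show "(\<lambda>k. C * N (u t - s k t)) \<longlonglongrightarrow> 0"
        using tendsto_mult_left[OF elim(1), of C] by simp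
    qed
    then have "(\<lambda>k. ell (s k t)) \<longlonglongrightarrow> ell (u t)"
      by (rule LIM_zero_cancel)
    then show ?case by (rule limI)
  qed
  ultimately show ?thesis by (rule borel_measurable_lebesgue_on_cong_AE[OF S])
qed

text \<open>Bounded functionals commute with the vector-valued integral, since they do so for simple functions. The
  seminorm \<open>N (u t - s k t)\<close> need not be measurable in \<open>t\<close>; this is why the constant \<open>C\<close> is moved to the
  scalar side before the integrals are compared.\<close>

lemma has_bochner_integral_functional:
  fixes ell :: "'b::real_vector \<Rightarrow> real"
  assumes S: "S \<in> sets lebesgue" and X: "subspace X" and lin: "linear ell"
    and bound: "\<And>x. x \<in> X \<Longrightarrow> \<bar>ell x\<bar> \<le> C * N x" and C: "C > 0"
    and u: "has_bochner_integral_in (lebesgue_on S) X N u w"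
  shows "has_bochner_integral (lebesgue_on S) (\<lambda>t. ell (u t)) (ell w)"
proof -
  let ?M = "lebesgue_on S"
  interpret linear ell by (fact lin)
  obtain s where w: "w \<in> X" and sm: "strongly_measurable ?M X N u"
    and s: "\<And>k. Bochner_Integration.simple_bochner_integrable ?M (s k)" "\<And>k. s k ` space ?M \<subseteq> X"
    and L1: "(\<lambda>k. \<integral>\<^sup>+t. ennreal (N (u t - s k t)) \<partial>?M) \<longlonglongrightarrow> 0"
    and int: "(\<lambda>k. N (Bochner_Integration.simple_bochner_integral ?M (s k) - w)) \<longlonglongrightarrow> 0"
    using u by (auto simp: has_bochner_integral_in_def)
  have meas: "(\<lambda>t. ell (u t)) \<in> borel_measurable ?M"
    using S X diff bound sm by (rule strongly_measurable_functional)
  have si: "Bochner_Integration.simple_bochner_integrable ?M (\<lambda>t. ell (s k t))" for k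
    using Bochner_Integration.simple_bochner_integrable_compose2[of "\<lambda>x _. ell x", OF _ s(1) s(1)]
    by (simp add: zero)
  have simple: "simple_function ?M (\<lambda>t. ell (s k t))" for k
    using si by (auto elim: Bochner_Integration.simple_bochner_integrable.cases)
  have sint: "Bochner_Integration.simple_bochner_integral ?M (\<lambda>t. ell (s k t)) =
      ell (Bochner_Integration.simple_bochner_integral ?M (s k))" for k
    using lin s(1) by (rule Bochner_Integration.simple_bochner_integral_linear)
  have sintX: "Bochner_Integration.simple_bochner_integral ?M (s k) \<in> X" for k
    unfolding Bochner_Integration.simple_bochner_integral_def
    using s(2)[of k] by (intro subspace_sum[OF X] subspace_scale[OF X]) auto
  show ?thesis
  proof (rule has_bochner_integral.intros[where s="\<lambda>k t. ell (s k t)"])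
    have uX: "AE t in ?M. u t \<in> X" using sm by (simp add: strongly_measurable_def)
    have "(\<integral>\<^sup>+t. norm (ell (u t) - ell (s k t)) \<partial>?M) \<le>
        ennreal C * (\<integral>\<^sup>+t. ennreal (N (u t - s k t)) \<partial>?M)" for k
    proof -
      have "(\<integral>\<^sup>+t. norm (ell (u t) - ell (s k t)) \<partial>?M) =
          (\<integral>\<^sup>+t. ennreal C * ennreal (\<bar>ell (u t) - ell (s k t)\<bar> / C) \<partial>?M)"
        using C by (intro nn_integral_cong) (simp flip: ennreal_mult')
      also have "\<dots> = ennreal C * (\<integral>\<^sup>+t. ennreal (\<bar>ell (u t) - ell (s k t)\<bar> / C) \<partial>?M)"
      proof (rule nn_integral_cmult, rule measurable_compose[OF _ measurable_ennreal])
        have "(\<lambda>t. ell (u t) - ell (s k t)) \<in> borel_measurable ?M"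
          using meas borel_measurable_simple_function[OF simple] by (rule borel_measurable_diff)
        then have "(\<lambda>t. \<bar>ell (u t) - ell (s k t)\<bar>) \<in> borel_measurable ?M"
          by (rule borel_measurable_abs)
        then show "(\<lambda>t. \<bar>ell (u t) - ell (s k t)\<bar> / C) \<in> borel_measurable ?M"
          by (intro borel_measurable_divide borel_measurable_const)
      qed
      also have "\<dots> \<le> ennreal C * (\<integral>\<^sup>+t. ennreal (N (u t - s k t)) \<partial>?M)"
      proof (intro mult_left_mono nn_integral_mono_AE)
        show "AE t in ?M. ennreal (\<bar>ell (u t) - ell (s k t)\<bar> / C) \<le> ennreal (N (u t - s k t))"
          using uX AE_space
        proof eventually_elim
          case (elim t)
          then have "u t - s k t \<in> X" using s(2) X by (blast intro: subspace_diff)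
          from bound[OF this] show ?case
            using C by (intro ennreal_leI) (simp add: diff field_simps)
        qed
      qed simp
      finally show ?thesis .
    qed
    then have le: "\<forall>\<^sub>F k in sequentially. (\<integral>\<^sup>+t. norm (ell (u t) - ell (s k t)) \<partial>?M) \<le>
        ennreal C * (\<integral>\<^sup>+t. ennreal (N (u t - s k t)) \<partial>?M)"
      by (intro always_eventually allI)
    have lim0: "(\<lambda>k. ennreal C * (\<integral>\<^sup>+t. ennreal (N (u t - s k t)) \<partial>?M)) \<longlonglongrightarrow> 0"
      using ennreal_tendsto_cmult[OF _ L1, of "ennreal C"] by simp
    show "(\<lambda>k. \<integral>\<^sup>+t. norm (ell (u t) - ell (s k t)) \<partial>?M) \<longlonglongrightarrow> 0"
      by (rule tendsto_sandwich[OF always_eventually le tendsto_const lim0]) simp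
    have "(\<lambda>k. ell (Bochner_Integration.simple_bochner_integral ?M (s k)) - ell w) \<longlonglongrightarrow> 0"
    proof (rule Lim_null_comparison)
      show "\<forall>\<^sub>F k in sequentially. norm (ell (Bochner_Integration.simple_bochner_integral ?M (s k)) - ell w)
          \<le> C * N (Bochner_Integration.simple_bochner_integral ?M (s k) - w)"
        using bound[OF subspace_diff[OF X sintX w]] by (simp add: diff)
      show "(\<lambda>k. C * N (Bochner_Integration.simple_bochner_integral ?M (s k) - w)) \<longlonglongrightarrow> 0"
        using tendsto_mult_left[OF int, of C] by simp
    qed
    then show "(\<lambda>k. Bochner_Integration.simple_bochner_integral ?M (\<lambda>t. ell (s k t))) \<longlonglongrightarrow> ell w"
      by (simp add: sint LIM_zero_iff)
  qed (use meas si in auto)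
qed

lemma subspace_Hm1: "subspace (Hm1 \<Omega>)"
proof (rule subspaceI)
  show "0 \<in> Hm1 \<Omega>" unfolding Hm1_def by (auto intro!: exI[of _ 0])
next
  fix F G assume FG: "F \<in> Hm1 \<Omega>" "G \<in> Hm1 \<Omega>"
  obtain C D where CD: "\<forall>u\<in>H10 \<Omega>. \<bar>F u\<bar> \<le> C * H1_norm \<Omega> u" "\<forall>u\<in>H10 \<Omega>. \<bar>G u\<bar> \<le> D * H1_norm \<Omega> u"
    using FG unfolding Hm1_def by blast
  have "\<forall>u\<in>H10 \<Omega>. \<bar>F u + G u\<bar> \<le> (C + D) * H1_norm \<Omega> u"
    using CD by (force simp: distrib_right intro: order_trans[OF abs_triangle_ineq] add_mono)
  then show "F + G \<in> Hm1 \<Omega>"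
    using FG unfolding Hm1_def by (auto simp: distrib_left intro!: exI[of _ "C + D"])
next
  fix c F assume F: "F \<in> Hm1 \<Omega>"
  obtain C where C: "\<forall>u\<in>H10 \<Omega>. \<bar>F u\<bar> \<le> C * H1_norm \<Omega> u"
    using F unfolding Hm1_def by blast
  have "\<forall>u\<in>H10 \<Omega>. \<bar>(c *\<^sub>R F) u\<bar> \<le> (\<bar>c\<bar> * C) * H1_norm \<Omega> u"
    using C by (auto simp: scaleR_fun_def abs_mult mult.assoc intro!: mult_left_mono)
  then show "c *\<^sub>R F \<in> Hm1 \<Omega>"
    using F unfolding Hm1_def
    by (auto simp: scaleR_fun_def distrib_left intro!: exI[of _ "\<bar>c\<bar> * C"])
qed

text \<open>This turns weak time derivatives in \<open>H\<^sup>-\<^sup>1\<close> into scalar ones, mode by mode.\<close>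

lemma weak_time_deriv_Hm1_apply:
  assumes \<Omega>: "open \<Omega>" "bounded \<Omega>" and v: "v \<in> H10 \<Omega>" "H1_norm \<Omega> v > 0"
    and d: "has_weak_time_deriv T (Hm1 \<Omega>) (Hm1_norm \<Omega>) U W" and \<psi>: "\<psi> \<in> test_functions {0<..<T}"
  shows "(LINT t|lebesgue_on {0<..<T}. deriv \<psi> t * U t v) = - (LINT t|lebesgue_on {0<..<T}. \<psi> t * W t v)"
proof -
  have lin: "linear (\<lambda>F. F v)" by (auto intro!: linearI simp: scaleR_fun_def)
  have bound: "\<bar>F v\<bar> \<le> H1_norm \<Omega> v * Hm1_norm \<Omega> F" if "F \<in> Hm1 \<Omega>" for F
    using Hm1_norm_bound[OF \<Omega> that v(1)] by (simp add: mult.commute)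
  obtain I where int: "has_bochner_integral_in (lebesgue_on {0<..<T}) (Hm1 \<Omega>) (Hm1_norm \<Omega>) (\<lambda>t. deriv \<psi> t *\<^sub>R U t) I"
    "has_bochner_integral_in (lebesgue_on {0<..<T}) (Hm1 \<Omega>) (Hm1_norm \<Omega>) (\<lambda>t. \<psi> t *\<^sub>R W t) (- I)"
    using d \<psi> by (auto simp: has_weak_time_deriv_def)
  have S: "{0<..<T} \<in> sets lebesgue" by simp
  note apply_v = has_bochner_integral_functional[where ell="\<lambda>F. F v" and X="Hm1 \<Omega>"
      and N="Hm1_norm \<Omega>" and C="H1_norm \<Omega> v", OF S subspace_Hm1 lin _ v(2)]
  have "has_bochner_integral (lebesgue_on {0<..<T}) (\<lambda>t. (deriv \<psi> t *\<^sub>R U t) v) (I v)"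
    using bound int(1) by (rule apply_v)
  moreover have "has_bochner_integral (lebesgue_on {0<..<T}) (\<lambda>t. (\<psi> t *\<^sub>R W t) v) ((- I) v)"
    using bound int(2) by (rule apply_v)
  ultimately have "has_bochner_integral (lebesgue_on {0<..<T}) (\<lambda>t. deriv \<psi> t * U t v) (I v)"
    "has_bochner_integral (lebesgue_on {0<..<T}) (\<lambda>t. \<psi> t * W t v) (- I v)"
    by (auto simp: scaleR_fun_def)
  then show ?thesis by (auto dest!: has_bochner_integral_integral_eq)
qed

section \<open>Weakly differentiable functions of time\<close>

lemma flat_nonpos: "x \<le> 0 \<Longrightarrow> flat j x = 0"
  by (simp add: flat_def)

lemma flat_0_has_field_derivative: "(flat 0 has_field_derivative flat 2 x) (at x)"
  using flat_has_field_derivative[of 0 x] by (simp add: numeral_2_eq_2)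

lemma continuous_flat: "continuous_on A (flat j)"
  using DERIV_isCont[OF flat_has_field_derivative] by (simp add: continuous_at_imp_continuous_on)

lemma flat_measurable [measurable]: "flat j \<in> borel_measurable borel"
  by (rule borel_measurable_continuous_onI[OF continuous_flat])

lemma flat_nonneg: "0 \<le> flat j x"
  by (simp add: flat_def)

lemma flat_0_tendsto_1: "(flat 0 \<longlongrightarrow> 1) at_top"
proof -
  have "((\<lambda>x::real. exp (- inverse x)) \<longlongrightarrow> exp (- 0)) at_top"
    by (intro tendsto_intros tendsto_inverse_0_at_top filterlim_ident)
  then have "((\<lambda>x::real. exp (- inverse x)) \<longlongrightarrow> 1) at_top" by simp
  then show ?thesis
    by (rule Lim_transform_eventually)
      (use eventually_gt_at_top[of "0::real"] in eventually_elim, simp add: flat_def divide_inverse)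
qed

lemma has_bochner_integral_flat_2: "has_bochner_integral lborel (flat 2) 1"
proof (rule has_bochner_integral_nn_integral)
  have "(\<integral>\<^sup>+x. ennreal (flat 2 x) \<partial>lborel) = (\<integral>\<^sup>+x. ennreal (flat 2 x) * indicator {0..} x \<partial>lborel)"
    by (intro nn_integral_cong) (auto simp: indicator_def flat_nonpos)
  also have "\<dots> = ennreal (1 - flat 0 0)"
    by (rule nn_integral_FTC_atLeast)
      (auto intro: flat_0_has_field_derivative flat_0_tendsto_1 flat_nonneg)
  finally show "(\<integral>\<^sup>+x. ennreal (flat 2 x) \<partial>lborel) = ennreal 1"
    by (simp add: flat_nonpos)
qed (auto intro: flat_nonneg)

text \<open>The function \<open>flat 2\<close>, the derivative of \<open>flat 0\<close>, is a probability density on the half line. Rescaled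
  by \<open>1 / Suc N\<close> it concentrates at \<open>0\<close>, while the cut-off factor tends to \<open>1\<close>.\<close>

lemma flat_kernel_concentrates:
  fixes Z :: "real \<Rightarrow> real"
  assumes Z: "continuous_on UNIV Z" "\<And>x. \<bar>Z x\<bar> \<le> C" and c: "c > 0"
  shows "(\<lambda>N. LINT z|lborel. flat 2 z * flat 0 (real (Suc N) * c - z) * Z (z / real (Suc N))) \<longlonglongrightarrow> Z 0"
proof -
  have [measurable]: "Z \<in> borel_measurable borel" using Z(1) by (rule borel_measurable_continuous_onI)
  have "(\<lambda>N. LINT z|lborel. flat 2 z * flat 0 (real (Suc N) * c - z) * Z (z / real (Suc N))) \<longlonglongrightarrow>
      (LINT z|lborel. flat 2 z * 1 * Z 0)"
  proof (rule integral_dominated_convergence)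
    show "integrable lborel (\<lambda>z. flat 2 z * C)"
      using has_bochner_integral_flat_2 by (auto simp: has_bochner_integral_iff)
    show "AE z in lborel. (\<lambda>N. flat 2 z * flat 0 (real (Suc N) * c - z) * Z (z / real (Suc N)))
        \<longlonglongrightarrow> flat 2 z * 1 * Z 0"
    proof (intro AE_I2 tendsto_intros)
      fix z :: real
      have N: "filterlim (\<lambda>N. real (Suc N)) at_top sequentially"
        using filterlim_compose[OF filterlim_real_sequentially filterlim_Suc] .
      have "filterlim (\<lambda>N. - z + real (Suc N) * c) at_top sequentially"
        by (rule filterlim_tendsto_add_at_top[OF tendsto_const filterlim_at_top_mult_tendsto_pos[OF tendsto_const c N]])
      then have "filterlim (\<lambda>N. real (Suc N) * c - z) at_top sequentially"
        by (simp add: add.commute del: of_nat_Suc)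
      then show "(\<lambda>N. flat 0 (real (Suc N) * c - z)) \<longlonglongrightarrow> 1"
        by (rule filterlim_compose[OF flat_0_tendsto_1])
      have "(\<lambda>N. z / real (Suc N)) \<longlonglongrightarrow> 0"
        by (rule real_tendsto_divide_at_top[OF tendsto_const N])
      then show "(\<lambda>N. Z (z / real (Suc N))) \<longlonglongrightarrow> Z 0"
        by (rule isCont_tendsto_compose[rotated]) (use Z(1) in \<open>simp add: continuous_on_eq_continuous_at\<close>)
    qed
    show "AE z in lborel. norm (flat 2 z * flat 0 (real (Suc N) * c - z) * Z (z / real (Suc N))) \<le> flat 2 z * C" for N
    proof (intro AE_I2)
      fix z
      have "flat 2 z * flat 0 (real (Suc N) * c - z) * \<bar>Z (z / real (Suc N))\<bar> \<le> flat 2 z * 1 * C"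
        using Z(2) by (intro mult_mono) (auto intro: flat_0_bounds flat_nonneg simp del: of_nat_Suc)
      then show "norm (flat 2 z * flat 0 (real (Suc N) * c - z) * Z (z / real (Suc N))) \<le> flat 2 z * C"
        using flat_nonneg by (simp add: abs_mult)
    qed
  qed auto
  also have "(LINT z|lborel. flat 2 z * 1 * Z 0) = Z 0"
    using has_bochner_integral_flat_2 by (simp add: has_bochner_integral_iff)
  finally show ?thesis .
qed

lemma box_bump_real: "box_bump N s t x = flat 0 (N * (x - s)) * flat 0 (N * (t - x))"
  by (simp add: box_bump_def)

lemma box_bump_has_field_derivative:
  "(box_bump N s t has_field_derivative
     N * flat 2 (N * (x - s)) * flat 0 (N * (t - x)) - N * flat 0 (N * (x - s)) * flat 2 (N * (t - x))) (at x)"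
  unfolding box_bump_real[abs_def]
  by (rule derivative_eq_intros DERIV_chain'[OF _ flat_0_has_field_derivative] refl)+ (simp add: algebra_simps)

text \<open>The derivative of a box bump tends to a unit mass at \<open>s\<close> minus a unit mass at \<open>t\<close>.\<close>

lemma deriv_box_bump_concentrates:
  fixes y :: "real \<Rightarrow> real"
  assumes st: "s < t" and y: "continuous_on {s..t} y" and S: "{s..t} \<subseteq> S" "S \<in> sets lebesgue"
  shows "(\<lambda>N. LINT x|lebesgue_on S. deriv (box_bump (real (Suc N)) s t) x * y x) \<longlonglongrightarrow> y s - y t"
proof -
  \<comment> \<open>A bounded continuous extension of \<open>y\<close> to the line, as needed for the substitutions below.\<close>
  define Y where "Y x = y (max s (min t x))" for x
  have contY: "continuous_on UNIV Y"
    unfolding Y_def using st by (intro continuous_on_compose2[OF y] continuous_intros) auto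
  obtain C where C: "\<And>x. x \<in> {s..t} \<Longrightarrow> \<bar>y x\<bar> \<le> C"
    using compact_imp_bounded[OF compact_continuous_image[OF y]]
    unfolding bounded_iff real_norm_def by blast
  have Y: "\<bar>Y x\<bar> \<le> C" "x \<in> {s..t} \<Longrightarrow> Y x = y x" for x
    using st C by (auto simp: Y_def max_def min_def)
  define G where "G N x = N * flat 2 (N * (x - s)) * flat 0 (N * (t - x)) * Y x" for N x
  define H where "H N x = N * flat 0 (N * (x - s)) * flat 2 (N * (t - x)) * Y x" for N x
  have eq: "(LINT x|lebesgue_on S. deriv (box_bump N s t) x * y x) =
      (LINT z|lborel. flat 2 z * flat 0 (N * (t - s) - z) * Y (s + z / N)) -
      (LINT z|lborel. flat 2 z * flat 0 (N * (t - s) - z) * Y (t - z / N))" if N: "N > 0" for N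
  proof -
    have off: "flat j (N * (x - s)) = 0 \<or> flat k (N * (t - x)) = 0" if "x \<notin> {s..t}" for x j k
      using that N by (auto intro!: flat_nonpos simp: mult_le_0_iff)
    have G: "continuous_on UNIV (G N)" "x \<notin> {s..t} \<Longrightarrow> G N x = 0" for x
      unfolding G_def using off[of x 2 0]
      by (auto intro!: continuous_intros contY continuous_on_compose2[OF continuous_flat[of UNIV]])
    have H: "continuous_on UNIV (H N)" "x \<notin> {s..t} \<Longrightarrow> H N x = 0" for x
      unfolding H_def using off[of x 0 2]
      by (auto intro!: continuous_intros contY continuous_on_compose2[OF continuous_flat[of UNIV]])
    have "deriv (box_bump N s t) x * y x = G N x - H N x" for x
    proof (cases "x \<in> {s..t}")
      case True
      then show ?thesis
        using Y(2) DERIV_imp_deriv[OF box_bump_has_field_derivative[of N s t x]]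
        by (simp add: G_def H_def left_diff_distrib)
    next
      case False
      then show ?thesis
        using DERIV_imp_deriv[OF box_bump_has_field_derivative[of N s t x]] off[of x 2 0] off[of x 0 2]
          G(2) H(2) by auto
    qed
    then have "(LINT x|lebesgue_on S. deriv (box_bump N s t) x * y x) = (LINT x|lborel. G N x - H N x)"
      using G H S continuous_compact_support_integral(3)[of "\<lambda>x. G N x - H N x" "{s..t}" S]
      by (simp add: continuous_on_diff)
    also have "\<dots> = (LINT x|lborel. G N x) - (LINT x|lborel. H N x)"
      using G H by (intro Bochner_Integration.integral_diff continuous_compact_support_integral(1)[where K="{s..t}"]) auto
    also have "(LINT x|lborel. G N x) = (LINT z|lborel. flat 2 z * flat 0 (N * (t - s) - z) * Y (s + z / N))"
    proof -
      have "N * (s + 1 / N * z - s) = z" "N * (t - (s + 1 / N * z)) = N * (t - s) - z" for z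
        using N by (auto simp: field_simps)
      then have "G N (s + 1 / N * z) = N * (flat 2 z * flat 0 (N * (t - s) - z) * Y (s + z / N))" for z
        unfolding G_def by (simp only: mult.assoc) simp
      then show ?thesis
        using N lborel_integral_real_affine[of "1 / N" "G N" s] by (simp only: integral_mult_right_zero) simp
    qed
    also have "(LINT x|lborel. H N x) = (LINT z|lborel. flat 2 z * flat 0 (N * (t - s) - z) * Y (t - z / N))"
    proof -
      have "N * (t - (t + (- 1 / N) * z)) = z" "N * (t + (- 1 / N) * z - s) = N * (t - s) - z" for z
        using N by (auto simp: field_simps)
      then have "H N (t + (- 1 / N) * z) = N * (flat 2 z * flat 0 (N * (t - s) - z) * Y (t - z / N))" for z
        unfolding H_def by (simp only: mult.assoc) simp
      then show ?thesis
        using N lborel_integral_real_affine[of "- 1 / N" "H N" t] by (simp only: integral_mult_right_zero) simp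
    qed
    finally show ?thesis .
  qed
  have "(\<lambda>N. (LINT z|lborel. flat 2 z * flat 0 (real (Suc N) * (t - s) - z) * Y (s + z / real (Suc N))) -
      (LINT z|lborel. flat 2 z * flat 0 (real (Suc N) * (t - s) - z) * Y (t - z / real (Suc N))))
      \<longlonglongrightarrow> Y (s + 0) - Y (t - 0)"
    using st Y(1)
    by (intro tendsto_diff flat_kernel_concentrates[of "\<lambda>x. Y (s + x)"] flat_kernel_concentrates[of "\<lambda>x. Y (t - x)"]
        continuous_on_compose2[OF contY]) (auto intro!: continuous_intros)
  then show ?thesis using st by (simp add: eq Y(2) del: of_nat_Suc)
qed

lemma integrable_lebesgue_on_mono:
  fixes v :: "'a::euclidean_space \<Rightarrow> real"
  assumes "integrable (lebesgue_on S) v" "A \<subseteq> S" "S \<in> sets lebesgue" "A \<in> sets lebesgue"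
  shows "integrable (lebesgue_on A) v"
  using assms set_integrable_subset[of lebesgue S v A] by (simp add: set_integrable_eq)

lemma integral_indicator_lebesgue_on:
  fixes v :: "'a::euclidean_space \<Rightarrow> real"
  assumes "A \<subseteq> S" "S \<in> sets lebesgue" "A \<in> sets lebesgue"
  shows "(LINT x|lebesgue_on S. indicator A x * v x) = (LINT x|lebesgue_on A. v x)"
  unfolding Lebesgue_Measure.integral_restrict[OF assms(1,3,2), symmetric]
  by (intro Bochner_Integration.integral_cong) (auto simp: indicator_def)

text \<open>Du Bois-Reymond's lemma. The test function \<open>box_bump N s t\<close> tends to the indicator of the
  interval from \<open>s\<close> to \<open>t\<close>, and its derivative to the difference of the two point evaluations.\<close>

lemma weak_derivative_imp_difference_eq_integral:
  fixes y v :: "real \<Rightarrow> real"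
  assumes y: "continuous_on {s..t} y" and st: "0 < s" "s < t" "t < T"
    and v: "integrable (lebesgue_on {0<..<T}) v"
    and weak: "\<And>\<psi>. \<psi> \<in> test_functions {0<..<T} \<Longrightarrow>
      (LINT x|lebesgue_on {0<..<T}. deriv \<psi> x * y x) = - (LINT x|lebesgue_on {0<..<T}. \<psi> x * v x)"
  shows "y t - y s = (LINT x|lebesgue_on {s<..<t}. v x)"
proof -
  have sub: "{s..t} \<subseteq> {0<..<T}" using st by auto
  let ?\<psi> = "\<lambda>N. box_bump (real (Suc N)) s t"
  have "(\<lambda>N. LINT x|lebesgue_on {0<..<T}. v x * ?\<psi> N x) \<longlonglongrightarrow> (LINT x|lebesgue_on {0<..<T}. v x * indicator {s<..<t} x)"
    using integral_mult_box_bump_tendsto[OF v, of s t] by (simp only: box_real)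
  also have "(LINT x|lebesgue_on {0<..<T}. v x * indicator {s<..<t} x) = (LINT x|lebesgue_on {s<..<t}. v x)"
    using sub integral_indicator_lebesgue_on[of "{s<..<t}" "{0<..<T}" v] by (simp add: mult.commute subset_eq)
  finally have 1: "(\<lambda>N. LINT x|lebesgue_on {0<..<T}. v x * ?\<psi> N x) \<longlonglongrightarrow> (LINT x|lebesgue_on {s<..<t}. v x)" .
  have "?\<psi> N \<in> test_functions {0<..<T}" for N
    using sub by (intro box_bump_test_function) (auto simp del: of_nat_Suc simp: cbox_interval)
  then have "(LINT x|lebesgue_on {0<..<T}. v x * ?\<psi> N x) =
      - (LINT x|lebesgue_on {0<..<T}. deriv (?\<psi> N) x * y x)" for N
    using weak[of "?\<psi> N"] by (simp add: mult.commute)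
  then have "(\<lambda>N. - (LINT x|lebesgue_on {0<..<T}. deriv (?\<psi> N) x * y x)) \<longlonglongrightarrow> (LINT x|lebesgue_on {s<..<t}. v x)"
    using 1 by (simp only:)
  moreover have "(\<lambda>N. - (LINT x|lebesgue_on {0<..<T}. deriv (?\<psi> N) x * y x)) \<longlonglongrightarrow> - (y s - y t)"
    using st sub y by (intro tendsto_minus deriv_box_bump_concentrates) auto
  ultimately show ?thesis using LIMSEQ_unique by fastforce
qed

text \<open>Test functions see only the open half line; continuity at \<open>0\<close> brings in the initial value.\<close>

lemma weak_derivative_imp_integral:
  fixes y v :: "real \<Rightarrow> real"
  assumes y: "continuous_on {0..} y" and v: "integrable (lebesgue_on {0<..}) v"
    and weak: "\<And>T \<psi>. T > 0 \<Longrightarrow> \<psi> \<in> test_functions {0<..<T} \<Longrightarrow>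
      (LINT x|lebesgue_on {0<..<T}. deriv \<psi> x * y x) = - (LINT x|lebesgue_on {0<..<T}. \<psi> x * v x)"
    and t: "0 < t"
  shows "y t = y 0 + (LINT x|lebesgue_on {0<..}. indicator {0<..<t} x * v x)"
proof -
  define s where "s n = t * inverse (real (Suc (Suc n)))" for n
  have s: "0 < s n" "s n < t" for n
    using t by (auto simp: s_def field_simps add_pos_nonneg)
  have "(\<lambda>n. t * inverse (real (Suc (Suc n)))) \<longlonglongrightarrow> t * 0"
    by (intro tendsto_mult tendsto_const LIMSEQ_Suc[OF LIMSEQ_inverse_real_of_nat])
  then have s_lim: "s \<longlonglongrightarrow> 0" by (simp add: s_def[abs_def])
  have eq: "y t - y (s n) = (LINT x|lebesgue_on {0<..}. indicator {s n<..<t} x * v x)" for n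
  proof -
    have "y t - y (s n) = (LINT x|lebesgue_on {s n<..<t}. v x)"
    proof (rule weak_derivative_imp_difference_eq_integral)
      show "continuous_on {s n..t} y" using y by (rule continuous_on_subset) (use s[of n] in auto)
      show "integrable (lebesgue_on {0<..<t + 1}) v"
        using v by (rule integrable_lebesgue_on_mono) auto
    qed (use s[of n] t weak[of "t + 1"] in auto)
    also have "\<dots> = (LINT x|lebesgue_on {0<..}. indicator {s n<..<t} x * v x)"
      using s[of n] by (intro integral_indicator_lebesgue_on[symmetric]) auto
    finally show ?thesis .
  qed
  have "(\<lambda>n. LINT x|lebesgue_on {0<..}. indicator {s n<..<t} x * v x) \<longlonglongrightarrow>
      (LINT x|lebesgue_on {0<..}. indicator {0<..<t} x * v x)"
  proof (rule integral_dominated_convergence)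
    show "integrable (lebesgue_on {0<..}) (\<lambda>x. norm (v x))" using v by simp
    have "indicator {p<..<t} \<in> borel_measurable (lebesgue_on {0<..})" for p
      by (intro measurable_restrict_space1 measurable_completion) simp
    then have "(\<lambda>x. indicator {p<..<t} x * v x) \<in> borel_measurable (lebesgue_on {0<..})" for p
      using v by (intro borel_measurable_times) auto
    then show "(\<lambda>x. indicator {0<..<t} x * v x) \<in> borel_measurable (lebesgue_on {0<..})"
      "(\<lambda>x. indicator {s n<..<t} x * v x) \<in> borel_measurable (lebesgue_on {0<..})" for n
      by blast+
    show "AE x in lebesgue_on {0<..}. (\<lambda>n. indicator {s n<..<t} x * v x) \<longlonglongrightarrow> indicator {0<..<t} x * v x"
    proof (intro AE_I2 tendsto_mult tendsto_const tendsto_eventually)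
      fix x :: real assume "x \<in> space (lebesgue_on {0<..})"
      then have "\<forall>\<^sub>F n in sequentially. s n < x"
        using order_tendstoD(2)[OF s_lim] by simp
      then show "\<forall>\<^sub>F n in sequentially. indicator {s n<..<t} x = (indicator {0<..<t} x :: real)"
        by eventually_elim (use \<open>x \<in> space (lebesgue_on {0<..})\<close> in \<open>simp add: indicator_def\<close>)
    qed
  qed (auto simp: indicator_def)
  then have "(\<lambda>n. y t - y (s n)) \<longlonglongrightarrow> (LINT x|lebesgue_on {0<..}. indicator {0<..<t} x * v x)"
    by (simp only: eq)
  moreover have "(\<lambda>n. y t - y (s n)) \<longlonglongrightarrow> y t - y 0"
    using s by (intro tendsto_intros continuous_on_tendsto_compose[OF y s_lim]) (auto simp: less_imp_le)
  ultimately have "(LINT x|lebesgue_on {0<..}. indicator {0<..<t} x * v x) = y t - y 0"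
    by (rule LIMSEQ_unique)
  then show ?thesis by simp
qed

section \<open>The forced harmonic oscillator\<close>

lemma test_functions_real_derivative:
  assumes "\<psi> \<in> test_functions U"
  shows "(\<psi> has_field_derivative deriv \<psi> x) (at x)" and "continuous_on A (deriv \<psi>)"
proof -
  show der: "(\<psi> has_field_derivative deriv \<psi> x) (at x)" for x
    using test_functions_has_derivative[OF assms, of x]
    by (simp add: DERIV_deriv_iff_real_differentiable differentiableI)
  have "deriv \<psi> x = frechet_derivative \<psi> (at x) 1" for x
    using frechet_derivative_at[OF der[of x, unfolded has_field_derivative_def], symmetric] by simp
  then show "continuous_on A (deriv \<psi>)"
    using test_functions_derivative_continuous[OF assms, of 1] continuous_on_subset[of UNIV _ A] by simp
qed

lemma integral_lebesgue_on_cong_AE: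
  fixes p q :: "'a::euclidean_space \<Rightarrow> real"
  assumes "S \<in> sets lebesgue" "p \<in> borel_measurable (lebesgue_on S)" "AE x in lebesgue_on S. p x = q x"
  shows "(LINT x|lebesgue_on S. q x) = (LINT x|lebesgue_on S. p x)"
  using assms borel_measurable_lebesgue_on_cong_AE[OF assms]
  by (intro integral_cong_AE) (auto elim: eventually_mono)

lemma AE_lebesgue_on_mono:
  assumes "AE x in lebesgue_on S. P x" "A \<subseteq> S" "S \<in> sets lebesgue" "A \<in> sets lebesgue"
  shows "AE x in lebesgue_on A. P x"
  using assms by (auto simp: AE_restrict_space_iff elim!: eventually_mono)

lemma integrable_mult_bounded_continuous:
  fixes F k :: "real \<Rightarrow> real"
  assumes F: "integrable (lebesgue_on S) F"
    and k: "continuous_on UNIV k" "\<And>x. x \<in> S \<Longrightarrow> \<bar>k x\<bar> \<le> B"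
  shows "integrable (lebesgue_on S) (\<lambda>x. k x * F x)"
proof (rule Bochner_Integration.integrable_bound)
  show "integrable (lebesgue_on S) (\<lambda>x. B * F x)" using F by simp
  have "k \<in> borel_measurable (lebesgue_on S)"
    using k(1) by (intro measurable_restrict_space1 measurable_completion) (simp add: borel_measurable_continuous_onI)
  then show "(\<lambda>x. k x * F x) \<in> borel_measurable (lebesgue_on S)" using F by auto
  show "AE x in lebesgue_on S. norm (k x * F x) \<le> norm (B * F x)"
    using k(2) by (intro AE_I2) (force simp: abs_mult intro: mult_right_mono)
qed

text \<open>If \<open>c'' = -\<mu> c\<close> with \<open>c' = d\<close>, then \<open>d y - c y'\<close> has the derivative \<open>- c (y'' + \<mu> y) = - c F\<close>. In the weak
  sense, test the equation for \<open>y\<close> with \<open>d \<psi>\<close> and the equation for \<open>v = y'\<close> with \<open>c \<psi>\<close>; \<open>V\<close> is the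
  continuous representative of \<open>v\<close>, and \<open>w\<close> stands for \<open>y''\<close>.\<close>

lemma oscillator_first_integral:
  fixes y v V w F c d :: "real \<Rightarrow> real"
  assumes y: "continuous_on {0..} y" and V: "continuous_on {0..} V"
    and F: "integrable (lebesgue_on {0<..}) F"
    and vV: "AE t in lebesgue_on {0<..}. V t = v t"
    and ode: "AE t in lebesgue_on {0<..}. F t - \<mu> * y t = w t"
    and weak1: "\<And>T \<psi>. T > 0 \<Longrightarrow> \<psi> \<in> test_functions {0<..<T} \<Longrightarrow>
      (LINT t|lebesgue_on {0<..<T}. deriv \<psi> t * y t) = - (LINT t|lebesgue_on {0<..<T}. \<psi> t * v t)"
    and weak2: "\<And>T \<psi>. T > 0 \<Longrightarrow> \<psi> \<in> test_functions {0<..<T} \<Longrightarrow>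
      (LINT t|lebesgue_on {0<..<T}. deriv \<psi> t * v t) = - (LINT t|lebesgue_on {0<..<T}. \<psi> t * w t)"
    and c: "\<And>t. (c has_field_derivative d t) (at t)" "\<And>k. C_k k c" "\<And>t. \<bar>c t\<bar> \<le> B"
    and d: "\<And>t. (d has_field_derivative - \<mu> * c t) (at t)" "\<And>k. C_k k d"
    and t: "t > 0"
  shows "d t * y t - c t * V t =
    d 0 * y 0 - c 0 * V 0 - (LINT s|lebesgue_on {0<..}. indicator {0<..<t} s * (c s * F s))"
proof -
  have contc: "continuous_on A c" and contd: "continuous_on A d" for A
    using c(2)[of 0] d(2)[of 0] by (auto intro: continuous_on_subset)
  have "d t * y t - c t * V t =
    d 0 * y 0 - c 0 * V 0 + (LINT s|lebesgue_on {0<..}. indicator {0<..<t} s * (- (c s * F s)))"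
  proof (rule weak_derivative_imp_integral[of "\<lambda>t. d t * y t - c t * V t", OF _ _ _ t])
    show "continuous_on {0..} (\<lambda>t. d t * y t - c t * V t)"
      by (intro continuous_intros contc contd y V)
    show "integrable (lebesgue_on {0<..}) (\<lambda>s. - (c s * F s))"
      using integrable_mult_bounded_continuous[OF F contc c(3)] by auto
    fix T :: real and \<psi> assume T: "T > 0" and \<psi>: "\<psi> \<in> test_functions {0<..<T}"
    let ?M = "lebesgue_on {0<..<T}"
    have sub: "{0<..<T} \<subseteq> {0<..}" "{0<..<T} \<in> sets lebesgue" "{0<..} \<in> sets (lebesgue :: real measure)"
      by auto
    have intc: "integrable ?M p" if "continuous_on {0..} p" for p :: "real \<Rightarrow> real"
    proof -
      have "integrable (lebesgue_on {0..T}) p"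
        using that by (intro continuous_imp_integrable_real) (auto intro: continuous_on_subset)
      then show ?thesis by (rule integrable_lebesgue_on_mono) auto
    qed
    have cont\<psi>: "continuous_on A \<psi>" "continuous_on A (deriv \<psi>)" for A
      using test_functions_real_derivative(2)[OF \<psi>] test_functions_continuous[OF \<psi>]
      by (auto intro: continuous_on_subset)
    have test: "(\<lambda>t. d t * \<psi> t) \<in> test_functions {0<..<T}" "(\<lambda>t. c t * \<psi> t) \<in> test_functions {0<..<T}"
      using test_functions_mult[OF \<psi>] c(2) d(2) by auto
    have deriv: "deriv (\<lambda>t. d t * \<psi> t) t = deriv \<psi> t * d t - \<mu> * c t * \<psi> t"
      "deriv (\<lambda>t. c t * \<psi> t) t = deriv \<psi> t * c t + d t * \<psi> t" for t
      using DERIV_imp_deriv[OF DERIV_mult[OF d(1) test_functions_real_derivative(1)[OF \<psi>]], of t]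
        DERIV_imp_deriv[OF DERIV_mult[OF c(1) test_functions_real_derivative(1)[OF \<psi>]], of t]
      by simp_all
    obtain B' where B': "\<And>x. \<bar>c x * \<psi> x\<bar> \<le> B'"
    proof -
      obtain K where K: "compact K" "K \<subseteq> {0<..<T}" "\<And>x. x \<notin> K \<Longrightarrow> c x * \<psi> x = 0"
        using test(2) unfolding test_functions_def by blast
      show thesis
        by (rule continuous_compact_support_bounded[OF test_functions_continuous[OF test(2)] K(1,3) that])
    qed
    have intF: "integrable ?M (\<lambda>t. (c t * \<psi> t) * F t)"
      using integrable_lebesgue_on_mono[OF F sub(1,3,2)] sub B'
      by (intro integrable_mult_bounded_continuous[where B=B'] test_functions_continuous[OF test(2)]) auto
    have vV': "AE t in ?M. V t = v t" and ode': "AE t in ?M. F t - \<mu> * y t = w t"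
      using vV ode sub by (auto intro: AE_lebesgue_on_mono)
    have I1: "integrable ?M (\<lambda>t. deriv \<psi> t * d t * y t)" and I2: "integrable ?M (\<lambda>t. \<mu> * (c t * \<psi> t * y t))"
      and I3: "integrable ?M (\<lambda>t. d t * \<psi> t * V t)" and I4: "integrable ?M (\<lambda>t. deriv \<psi> t * c t * V t)"
      by (intro intc continuous_intros cont\<psi> contc contd y V)+
    have "(LINT t|?M. deriv \<psi> t * d t * y t) - (LINT t|?M. \<mu> * (c t * \<psi> t * y t)) =
        (LINT t|?M. deriv (\<lambda>t. d t * \<psi> t) t * y t)"
      using I1 I2 by (simp add: deriv left_diff_distrib mult.assoc)
    also have "\<dots> = - (LINT t|?M. d t * \<psi> t * v t)"
      using weak1[OF T test(1)] .
    also have "(LINT t|?M. d t * \<psi> t * v t) = (LINT t|?M. d t * \<psi> t * V t)"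
      using vV' I3 by (intro integral_lebesgue_on_cong_AE) (auto elim: eventually_mono)
    finally have E1: "(LINT t|?M. deriv \<psi> t * d t * y t) =
        (LINT t|?M. \<mu> * (c t * \<psi> t * y t)) - (LINT t|?M. d t * \<psi> t * V t)" by simp
    have "(LINT t|?M. deriv \<psi> t * c t * V t) + (LINT t|?M. d t * \<psi> t * V t) =
        (LINT t|?M. deriv (\<lambda>t. c t * \<psi> t) t * V t)"
      using I3 I4 by (simp add: deriv distrib_right)
    also have "\<dots> = (LINT t|?M. deriv (\<lambda>t. c t * \<psi> t) t * v t)"
    proof (rule integral_lebesgue_on_cong_AE[symmetric])
      show "(\<lambda>t. deriv (\<lambda>t. c t * \<psi> t) t * V t) \<in> borel_measurable ?M"
        using I3 I4 by (simp add: deriv distrib_right)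
    qed (use vV' in \<open>auto elim: eventually_mono\<close>)
    also have "\<dots> = - (LINT t|?M. c t * \<psi> t * w t)"
      using weak2[OF T test(2)] .
    also have "(LINT t|?M. c t * \<psi> t * w t) = (LINT t|?M. c t * \<psi> t * F t - \<mu> * (c t * \<psi> t * y t))"
      using ode' intF I2
      by (intro integral_lebesgue_on_cong_AE) (auto elim!: eventually_mono simp: algebra_simps)
    also have "\<dots> = (LINT t|?M. c t * \<psi> t * F t) - (LINT t|?M. \<mu> * (c t * \<psi> t * y t))"
      using intF I2 by (rule Bochner_Integration.integral_diff)
    finally have E2: "(LINT t|?M. deriv \<psi> t * c t * V t) = (LINT t|?M. \<mu> * (c t * \<psi> t * y t)) -
        (LINT t|?M. c t * \<psi> t * F t) - (LINT t|?M. d t * \<psi> t * V t)" by simp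
    have "(LINT t|?M. deriv \<psi> t * (d t * y t - c t * V t)) =
        (LINT t|?M. deriv \<psi> t * d t * y t) - (LINT t|?M. deriv \<psi> t * c t * V t)"
      using I1 I4 by (simp add: right_diff_distrib mult.assoc)
    also have "\<dots> = (LINT t|?M. c t * \<psi> t * F t)" unfolding E1 E2 by simp
    also have "\<dots> = - (LINT t|?M. \<psi> t * - (c t * F t))"
      by (simp add: mult_ac)
    finally show "(LINT t|?M. deriv \<psi> t * (d t * y t - c t * V t)) = - (LINT t|?M. \<psi> t * - (c t * F t))" .
  qed
  then show ?thesis by simp
qed

text \<open>The first integrals for \<open>c = sin (\<omega> t) / \<omega>\<close> and \<open>c = - cos (\<omega> t)\<close> are two linear equations for \<open>y t\<close>
  and \<open>V t\<close>.\<close>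

lemma oscillator_Duhamel:
  fixes y v V w F :: "real \<Rightarrow> real"
  assumes y: "continuous_on {0..} y" and V: "continuous_on {0..} V"
    and F: "integrable (lebesgue_on {0<..}) F"
    and vV: "AE t in lebesgue_on {0<..}. V t = v t"
    and ode: "AE t in lebesgue_on {0<..}. F t - \<omega>\<^sup>2 * y t = w t"
    and weak1: "\<And>T \<psi>. T > 0 \<Longrightarrow> \<psi> \<in> test_functions {0<..<T} \<Longrightarrow>
      (LINT t|lebesgue_on {0<..<T}. deriv \<psi> t * y t) = - (LINT t|lebesgue_on {0<..<T}. \<psi> t * v t)"
    and weak2: "\<And>T \<psi>. T > 0 \<Longrightarrow> \<psi> \<in> test_functions {0<..<T} \<Longrightarrow>
      (LINT t|lebesgue_on {0<..<T}. deriv \<psi> t * v t) = - (LINT t|lebesgue_on {0<..<T}. \<psi> t * w t)"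
    and \<omega>: "\<omega> > 0" and t: "t > 0"
  shows "y t = cos (\<omega> * t) *
      (y 0 - 1 / \<omega> * (LINT s|lebesgue_on {0<..}. indicator {0<..<t} s * (sin (\<omega> * s) * F s))) +
    sin (\<omega> * t) / \<omega> *
      (V 0 + (LINT s|lebesgue_on {0<..}. indicator {0<..<t} s * (cos (\<omega> * s) * F s)))"
proof -
  let ?S = "LINT s|lebesgue_on {0<..}. indicator {0<..<t} s * (sin (\<omega> * s) * F s)"
  let ?C = "LINT s|lebesgue_on {0<..}. indicator {0<..<t} s * (cos (\<omega> * s) * F s)"
  have P: "cos (\<omega> * t) * y t - 1 / \<omega> * sin (\<omega> * t) * V t = y 0 - 1 / \<omega> * ?S"
  proof -
    have "cos (\<omega> * t) * y t - 1 / \<omega> * sin (\<omega> * t) * V t = cos (\<omega> * 0) * y 0 - 1 / \<omega> * sin (\<omega> * 0) * V 0 -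
      (LINT s|lebesgue_on {0<..}. indicator {0<..<t} s * (1 / \<omega> * sin (\<omega> * s) * F s))"
    proof (rule oscillator_first_integral[OF y V F vV ode weak1 weak2 _ _ _ _ _ t])
      show "C_k k (\<lambda>t. 1 / \<omega> * sin (\<omega> * t))" "C_k k (\<lambda>t. cos (\<omega> * t))" for k
        using C_k_sin_cos[of k "1 / \<omega>" \<omega> 0] C_k_sin_cos[of k 0 \<omega> 1] by simp_all
      show "\<bar>1 / \<omega> * sin (\<omega> * t)\<bar> \<le> 1 / \<omega>" for t
        using \<omega> by (simp add: abs_mult divide_right_mono)
    qed (use \<omega> in \<open>auto intro!: derivative_eq_intros simp: power2_eq_square\<close>)
    also have "(LINT s|lebesgue_on {0<..}. indicator {0<..<t} s * (1 / \<omega> * sin (\<omega> * s) * F s)) = 1 / \<omega> * ?S"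
      by (simp flip: integral_mult_right_zero add: mult_ac)
    finally show ?thesis by simp
  qed
  have Q: "\<omega> * sin (\<omega> * t) * y t + cos (\<omega> * t) * V t = V 0 + ?C"
  proof -
    have "\<omega> * sin (\<omega> * t) * y t - (- cos (\<omega> * t)) * V t = \<omega> * sin (\<omega> * 0) * y 0 - (- cos (\<omega> * 0)) * V 0 -
      (LINT s|lebesgue_on {0<..}. indicator {0<..<t} s * (- cos (\<omega> * s) * F s))"
    proof (rule oscillator_first_integral[OF y V F vV ode weak1 weak2 _ _ _ _ _ t])
      show "C_k k (\<lambda>t. \<omega> * sin (\<omega> * t))" "C_k k (\<lambda>t. - cos (\<omega> * t))" for k
        using C_k_sin_cos[of k \<omega> \<omega> 0] C_k_sin_cos[of k 0 \<omega> "- 1"] by simp_all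
      show "\<bar>- cos (\<omega> * t)\<bar> \<le> 1" for t by simp
    qed (auto intro!: derivative_eq_intros simp: power2_eq_square)
    then show ?thesis by simp
  qed
  have "C * (C * Y - 1 / \<omega> * S * Z) + S / \<omega> * (\<omega> * S * Y + C * Z) = (S\<^sup>2 + C\<^sup>2) * Y" for C S Y Z
    using \<omega> by (simp add: field_simps power2_eq_square)
  then show ?thesis unfolding P[symmetric] Q[symmetric] by simp
qed

lemma integral_indicator_tendsto_at_top:
  fixes G :: "real \<Rightarrow> real"
  assumes G: "integrable (lebesgue_on {0<..}) G"
  shows "((\<lambda>t. LINT s|lebesgue_on {0<..}. indicator {0<..<t} s * G s) \<longlongrightarrow> (LINT s|lebesgue_on {0<..}. G s)) at_top"
proof (rule integral_dominated_convergence_at_top)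
  show "integrable (lebesgue_on {0<..}) (\<lambda>s. norm (G s))" using G by simp
  have "indicator {0<..<t} \<in> borel_measurable (lebesgue_on {0<..})" for t :: real
    by (intro measurable_restrict_space1 measurable_completion) simp
  then show "(\<lambda>s. indicator {0<..<t} s * G s) \<in> borel_measurable (lebesgue_on {0<..})" for t
    using G by (intro borel_measurable_times) auto
  show "\<forall>\<^sub>F t in at_top. AE s in lebesgue_on {0<..}. norm (indicator {0<..<t} s * G s) \<le> norm (G s)"
    by (intro always_eventually allI AE_I2) (simp add: indicator_def)
  show "AE s in lebesgue_on {0<..}. ((\<lambda>t. indicator {0<..<t} s * G s) \<longlongrightarrow> G s) at_top"
  proof (rule AE_I2)
    fix s :: real assume "s \<in> space (lebesgue_on {0<..})"
    then show "((\<lambda>t. indicator {0<..<t} s * G s) \<longlongrightarrow> G s) at_top"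
      by (intro tendsto_eventually eventually_mono[OF eventually_gt_at_top[of s]]) simp
  qed
qed (use G in auto)

text \<open>Along times whose phase modulo \<open>2 \<pi>\<close> is constant the combination is constant, hence it vanishes at every
  phase.\<close>

lemma cos_sin_combination_tendsto_0:
  fixes A B \<omega> :: real
  assumes lim: "((\<lambda>t. cos (\<omega> * t) * A + sin (\<omega> * t) * B) \<longlongrightarrow> 0) at_top" and \<omega>: "\<omega> > 0"
  shows "A = 0" "B = 0"
proof -
  have at: "cos \<theta> * A + sin \<theta> * B = 0" for \<theta>
  proof -
    define t where "t n = 1 / \<omega> * (\<theta> + 2 * pi * real n)" for n
    have "filterlim (\<lambda>n. 2 * pi * real n) at_top sequentially"
      by (rule filterlim_tendsto_pos_mult_at_top[OF tendsto_const _ filterlim_real_sequentially]) simp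
    then have "filterlim (\<lambda>n. \<theta> + 2 * pi * real n) at_top sequentially"
      by (rule filterlim_tendsto_add_at_top[OF tendsto_const])
    then have "filterlim t at_top sequentially"
      unfolding t_def
      by (rule filterlim_tendsto_pos_mult_at_top[OF tendsto_const, rotated]) (use \<omega> in simp)
    from filterlim_compose[OF lim this]
    have "(\<lambda>n. cos (\<omega> * t n) * A + sin (\<omega> * t n) * B) \<longlonglongrightarrow> 0" .
    moreover have "cos (\<omega> * t n) = cos \<theta>" "sin (\<omega> * t n) = sin \<theta>" for n
    proof -
      have "\<omega> * t n = \<theta> + 2 * real n * pi" using \<omega> by (simp add: t_def)
      then show "cos (\<omega> * t n) = cos \<theta>" "sin (\<omega> * t n) = sin \<theta>"
        by (simp_all add: cos_add sin_add)
    qed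
    ultimately show ?thesis by (simp add: LIMSEQ_const_iff)
  qed
  show "A = 0" "B = 0" using at[of 0] at[of "pi / 2"] by simp_all
qed

section \<open>Decay of weak solutions\<close>

lemma time_continuous_imp_continuous_on_functional:
  fixes ell :: "'b::real_vector \<Rightarrow> real"
  assumes u: "time_continuous S X N u" and X: "subspace X"
    and diff: "\<And>x y. x \<in> X \<Longrightarrow> y \<in> X \<Longrightarrow> ell (x - y) = ell x - ell y"
    and bound: "\<And>x. x \<in> X \<Longrightarrow> \<bar>ell x\<bar> \<le> C * N x"
  shows "continuous_on S (\<lambda>t. ell (u t))"
  unfolding continuous_on_def
proof
  fix t assume t: "t \<in> S"
  have "((\<lambda>s. ell (u s) - ell (u t)) \<longlongrightarrow> 0) (at t within S)"
  proof (rule Lim_null_comparison)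
    show "\<forall>\<^sub>F s in at t within S. norm (ell (u s) - ell (u t)) \<le> C * N (u s - u t)"
      unfolding eventually_at_filter
    proof (intro always_eventually allI impI)
      fix s assume "s \<in> S"
      then have X': "u s \<in> X" "u t \<in> X" using u t by (auto simp: time_continuous_def)
      then show "norm (ell (u s) - ell (u t)) \<le> C * N (u s - u t)"
        using bound[OF subspace_diff[OF X X']] by (simp add: diff)
    qed
    have "((\<lambda>s. N (u s - u t)) \<longlongrightarrow> 0) (at t within S)"
      using u t by (auto simp: time_continuous_def)
    then show "((\<lambda>s. C * N (u s - u t)) \<longlongrightarrow> 0) (at t within S)"
      using tendsto_mult_left[of _ 0 _ C] by fastforce
  qed
  then show "((\<lambda>t. ell (u t)) \<longlongrightarrow> ell (u t)) (at t within S)"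
    by (rule LIM_zero_cancel)
qed

lemma AE_time_if_AE_bounded_times:
  fixes P :: "real \<Rightarrow> bool"
  assumes "\<And>T. T > 0 \<Longrightarrow> AE t in lebesgue_on {0<..<T}. P t"
  shows "AE t in lebesgue_on {0<..}. P t"
proof -
  have "AE t in lebesgue. \<forall>n. t \<in> {0<..<real (Suc n)} \<longrightarrow> P t"
    unfolding AE_all_countable
    using assms[of "real (Suc _)"] by (simp add: AE_restrict_space_iff del: of_nat_Suc)
  then have "AE t in lebesgue. 0 < t \<longrightarrow> P t"
  proof eventually_elim
    case (elim t)
    obtain n where "t < real n" using reals_Archimedean2 by blast
    then have "t < real (Suc n)" by simp
    then show ?case using elim by auto
  qed
  then show ?thesis by (simp add: AE_restrict_space_iff)
qed

lemma L2_coefficient_integrable: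
  assumes f: "f \<in> bochner_Lp 1 (lebesgue_on {0<..}) (L2 \<Omega>) (L2_norm \<Omega>)" and \<phi>: "\<phi> \<in> L2 \<Omega>"
  shows "integrable (lebesgue_on {0<..}) (\<lambda>t. L2_inner \<Omega> (f t) \<phi>)"
proof (rule Bochner_Integration.integrable_bound)
  have sm: "strongly_measurable (lebesgue_on {0<..}) (L2 \<Omega>) (L2_norm \<Omega>) f"
    and int: "integrable (lebesgue_on {0<..}) (\<lambda>t. L2_norm \<Omega> (f t))"
    using f by (auto simp: bochner_Lp_def)
  have bound: "\<bar>L2_inner \<Omega> x \<phi>\<bar> \<le> L2_norm \<Omega> \<phi> * L2_norm \<Omega> x" if "x \<in> L2 \<Omega>" for x
    using L2_Cauchy_Schwarz[OF that \<phi>] by (simp add: mult.commute)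
  show "(\<lambda>t. L2_inner \<Omega> (f t) \<phi>) \<in> borel_measurable (lebesgue_on {0<..})"
    using sm \<phi> by (intro strongly_measurable_functional[where ell="\<lambda>x. L2_inner \<Omega> x \<phi>", OF _ subspace_L2 _ bound])
      (auto simp: L2_inner_diff)
  show "integrable (lebesgue_on {0<..}) (\<lambda>t. L2_norm \<Omega> \<phi> * L2_norm \<Omega> (f t))" using int by simp
  have "AE t in lebesgue_on {0<..}. f t \<in> L2 \<Omega>" using sm by (simp add: strongly_measurable_def)
  then show "AE t in lebesgue_on {0<..}. norm (L2_inner \<Omega> (f t) \<phi>) \<le> norm (L2_norm \<Omega> \<phi> * L2_norm \<Omega> (f t))"
    by eventually_elim (simp add: bound abs_mult abs_of_nonneg[OF L2_norm_nonneg])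
qed

text \<open>Minkowski's integral inequality for a vector of coefficient integrals \<open>Y\<close>, by duality: write
  \<open>\<parallel>Y\<parallel>\<^sup>2\<close> as a single integral of \<open>\<Sum>m. Y m * k m s * (f s, \<phi> m)\<close>, bound the integrand by the Cauchy--Schwarz
  and Bessel inequalities, and cancel one factor \<open>\<parallel>Y\<parallel>\<close>.\<close>

lemma sum_squares_of_coefficient_integrals_le:
  assumes \<phi>: "L2_orthonormal \<Omega> \<phi>" and I: "finite I"
    and f: "AE s in M. f s \<in> L2 \<Omega>"
    and k: "\<And>m s. \<bar>k m s\<bar> \<le> \<kappa> s"
    and int: "\<And>m. integrable M (\<lambda>s. k m s * L2_inner \<Omega> (f s) (\<phi> m))"
    and int': "integrable M (\<lambda>s. \<kappa> s * L2_norm \<Omega> (f s))"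
  shows "(\<Sum>m\<in>I. (LINT s|M. k m s * L2_inner \<Omega> (f s) (\<phi> m))\<^sup>2) \<le> (LINT s|M. \<kappa> s * L2_norm \<Omega> (f s))\<^sup>2"
proof -
  define Y where "Y m = (LINT s|M. k m s * L2_inner \<Omega> (f s) (\<phi> m))" for m
  define E where "E = (LINT s|M. \<kappa> s * L2_norm \<Omega> (f s))"
  have \<kappa>: "0 \<le> \<kappa> s" for s using k[of undefined s] by linarith
  have E: "0 \<le> E"
    unfolding E_def by (intro Bochner_Integration.integral_nonneg mult_nonneg_nonneg \<kappa> L2_norm_nonneg)
  have "(L2_set Y I)\<^sup>2 = (\<Sum>m\<in>I. Y m * Y m)"
    by (simp add: L2_set_def sum_nonneg flip: power2_eq_square)
  also have "\<dots> = (\<Sum>m\<in>I. (LINT s|M. Y m * (k m s * L2_inner \<Omega> (f s) (\<phi> m))))"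
    by (simp add: Y_def)
  also have "\<dots> = (LINT s|M. (\<Sum>m\<in>I. Y m * (k m s * L2_inner \<Omega> (f s) (\<phi> m))))"
    using int by (intro Bochner_Integration.integral_sum[symmetric]) simp
  also have "\<dots> \<le> (LINT s|M. L2_set Y I * (\<kappa> s * L2_norm \<Omega> (f s)))"
  proof (rule integral_mono_AE)
    show "integrable M (\<lambda>s. \<Sum>m\<in>I. Y m * (k m s * L2_inner \<Omega> (f s) (\<phi> m)))"
      using int by auto
    show "integrable M (\<lambda>s. L2_set Y I * (\<kappa> s * L2_norm \<Omega> (f s)))"
      using int' by simp
    show "AE s in M. (\<Sum>m\<in>I. Y m * (k m s * L2_inner \<Omega> (f s) (\<phi> m))) \<le> L2_set Y I * (\<kappa> s * L2_norm \<Omega> (f s))"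
      using f
    proof eventually_elim
      case (elim s)
      let ?F = "\<lambda>m. k m s * L2_inner \<Omega> (f s) (\<phi> m)"
      have "(\<Sum>m\<in>I. Y m * ?F m) \<le> (\<Sum>m\<in>I. \<bar>Y m\<bar> * \<bar>?F m\<bar>)"
        by (intro sum_mono) (simp flip: abs_mult)
      also have "\<dots> \<le> L2_set Y I * L2_set ?F I" by (rule L2_set_mult_ineq)
      also have "L2_set ?F I \<le> \<kappa> s * L2_norm \<Omega> (f s)"
        unfolding L2_set_def
      proof (rule real_le_lsqrt)
        have "(?F m)\<^sup>2 \<le> (\<kappa> s)\<^sup>2 * (L2_inner \<Omega> (f s) (\<phi> m))\<^sup>2" for m
          unfolding power_mult_distrib using k[of m s] \<kappa>[of s]
          by (intro mult_right_mono) (auto simp: abs_le_square_iff[of "k m s" "\<kappa> s", symmetric])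
        then have "(\<Sum>m\<in>I. (?F m)\<^sup>2) \<le> (\<kappa> s)\<^sup>2 * (\<Sum>m\<in>I. (L2_inner \<Omega> (f s) (\<phi> m))\<^sup>2)"
          by (simp add: sum_distrib_left sum_mono)
        also have "\<dots> \<le> (\<kappa> s)\<^sup>2 * (L2_norm \<Omega> (f s))\<^sup>2"
          by (intro mult_left_mono L2_Bessel[OF \<phi> elim I]) simp
        finally show "(\<Sum>m\<in>I. (?F m)\<^sup>2) \<le> (\<kappa> s * L2_norm \<Omega> (f s))\<^sup>2"
          by (simp add: power_mult_distrib)
      qed (auto intro!: sum_nonneg mult_nonneg_nonneg \<kappa> L2_norm_nonneg)
      finally show ?case by (simp add: mult_left_mono L2_set_nonneg)
    qed
  qed
  also have "\<dots> = L2_set Y I * E" by (simp add: E_def)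
  finally have "L2_set Y I * L2_set Y I \<le> L2_set Y I * E" by (simp add: power2_eq_square)
  then have "L2_set Y I \<le> E"
    using L2_set_nonneg[of Y I] E by (cases "L2_set Y I = 0") auto
  then have "(L2_set Y I)\<^sup>2 \<le> E\<^sup>2" by (intro power_mono L2_set_nonneg)
  then show ?thesis by (simp add: L2_set_def sum_nonneg Y_def E_def)
qed

text \<open>By symmetry of \<open>a\<close> the eigenfunction may be moved to the first argument of the bilinear form, so the
  equation tested with \<open>\<phi>\<close> is the weak oscillator equation for the coefficient of \<open>u\<close>.\<close>

lemma weak_solution_mode_formula:
  fixes \<Omega> :: "(real^'n) set"
  assumes \<Omega>: "open \<Omega>" "bounded \<Omega>"
    and a: "\<And>i j. a i j \<in> Linf \<Omega>" "\<And>i j. AE x in lebesgue_on \<Omega>. a i j x = a j i x"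
    and \<phi>: "\<phi> \<in> H10 \<Omega>" "L2_norm \<Omega> \<phi> > 0" and \<omega>: "\<omega> > 0"
    and eig: "\<And>v. v \<in> H10 \<Omega> \<Longrightarrow> bilinear_form \<Omega> a \<phi> v = \<omega>\<^sup>2 * L2_inner \<Omega> \<phi> v"
    and g: "g \<in> H10 \<Omega>"
    and f: "f \<in> bochner_Lp 1 (lebesgue_on {0<..}) (L2 \<Omega>) (L2_norm \<Omega>)"
    and u: "weak_solution \<Omega> a f g h u" and t: "t > 0"
  shows "L2_inner \<Omega> (u t) \<phi> = cos (\<omega> * t) * (L2_inner \<Omega> g \<phi> - 1 / \<omega> *
        (LINT s|lebesgue_on {0<..}. indicator {0<..<t} s * (sin (\<omega> * s) * L2_inner \<Omega> (f s) \<phi>))) +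
      sin (\<omega> * t) / \<omega> * (L2_inner \<Omega> h \<phi> +
        (LINT s|lebesgue_on {0<..}. indicator {0<..<t} s * (cos (\<omega> * s) * L2_inner \<Omega> (f s) \<phi>)))"
proof -
  have \<phi>L: "\<phi> \<in> L2 \<Omega>" using \<phi> by (auto intro: H1_L2 H10_H1)
  have N\<phi>: "H1_norm \<Omega> \<phi> > 0" using \<phi>(2) L2_norm_le_H1_norm[of \<Omega> \<phi>] by linarith
  obtain u1 u2 w where tc: "time_continuous {0..} (L2 \<Omega>) (L2_norm \<Omega>) u"
    and uH: "\<And>T. T > 0 \<Longrightarrow> u \<in> bochner_Linf (lebesgue_on {0<..<T}) (H10 \<Omega>) (H1_norm \<Omega>)"
    and H2: "\<And>T. T > 0 \<Longrightarrow> H2_with T (Hm1 \<Omega>) (Hm1_norm \<Omega>)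
                 (\<lambda>t. L2_to_Hm1 \<Omega> (u t)) (\<lambda>t. L2_to_Hm1 \<Omega> (u1 t)) u2"
    and pde: "\<And>v. v \<in> H10 \<Omega> \<Longrightarrow> AE t in lebesgue_on {0<..}.
           u2 t v + bilinear_form \<Omega> a (u t) v = L2_inner \<Omega> (f t) v"
    and u0: "AE x in lebesgue_on \<Omega>. u 0 x = g x"
    and w: "time_continuous {0..} (Hm1 \<Omega>) (Hm1_norm \<Omega>) w"
      "AE t in lebesgue_on {0<..}. \<forall>v\<in>H10 \<Omega>. w t v = L2_to_Hm1 \<Omega> (u1 t) v"
      "\<And>v. v \<in> H10 \<Omega> \<Longrightarrow> w 0 v = L2_to_Hm1 \<Omega> h v"
    using u unfolding weak_solution_def by blast
  have "u 0 \<in> L2 \<Omega>" using tc by (simp add: time_continuous_def)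
  moreover have "g \<in> L2 \<Omega>" using g by (auto intro: H1_L2 H10_H1)
  ultimately have y0: "L2_inner \<Omega> (u 0) \<phi> = L2_inner \<Omega> g \<phi>"
    using \<phi>L u0 by (rule L2_inner_cong_AE)
  have V0: "w 0 \<phi> = L2_inner \<Omega> h \<phi>" using w(3)[OF \<phi>(1)] by (simp add: L2_to_Hm1_def)
  have contV: "continuous_on {0..} (\<lambda>t. w t \<phi>)"
  proof (rule time_continuous_imp_continuous_on_functional[OF w(1) subspace_Hm1])
    show "\<bar>F \<phi>\<bar> \<le> H1_norm \<Omega> \<phi> * Hm1_norm \<Omega> F" if "F \<in> Hm1 \<Omega>" for F
      using Hm1_norm_bound[OF \<Omega> that \<phi>(1)] by (simp add: mult.commute)
  qed simp
  have conty: "continuous_on {0..} (\<lambda>t. L2_inner \<Omega> (u t) \<phi>)"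
  proof (rule time_continuous_imp_continuous_on_functional[where ell="\<lambda>x. L2_inner \<Omega> x \<phi>", OF tc subspace_L2])
    show "\<bar>L2_inner \<Omega> x \<phi>\<bar> \<le> L2_norm \<Omega> \<phi> * L2_norm \<Omega> x" if "x \<in> L2 \<Omega>" for x
      using L2_Cauchy_Schwarz[OF that \<phi>L] by (simp add: mult.commute)
  qed (intro L2_inner_diff \<phi>L)
  have weak: "has_weak_time_deriv T (Hm1 \<Omega>) (Hm1_norm \<Omega>) (\<lambda>t. L2_to_Hm1 \<Omega> (u t)) (\<lambda>t. L2_to_Hm1 \<Omega> (u1 t))"
    "has_weak_time_deriv T (Hm1 \<Omega>) (Hm1_norm \<Omega>) (\<lambda>t. L2_to_Hm1 \<Omega> (u1 t)) u2" if "T > 0" for T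
    using H2[OF that] by (auto simp: H2_with_def)
  have uH10: "AE t in lebesgue_on {0<..}. u t \<in> H10 \<Omega>"
    using uH by (intro AE_time_if_AE_bounded_times) (auto simp: bochner_Linf_def strongly_measurable_def)
  have ode: "AE t in lebesgue_on {0<..}. L2_inner \<Omega> (f t) \<phi> - \<omega>\<^sup>2 * L2_inner \<Omega> (u t) \<phi> = u2 t \<phi>"
    using pde[OF \<phi>(1)] uH10
  proof eventually_elim
    case (elim t)
    have "bilinear_form \<Omega> a (u t) \<phi> = bilinear_form \<Omega> a \<phi> (u t)"
      using elim(2) \<phi>(1) by (intro bilinear_form_commute a H10_H1)
    also have "\<dots> = \<omega>\<^sup>2 * L2_inner \<Omega> (u t) \<phi>"
      using eig[OF elim(2)] by (simp add: L2_inner_commute[of \<Omega> \<phi>])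
    finally show ?case using elim(1) by linarith
  qed
  have "AE t in lebesgue_on {0<..}. w t \<phi> = L2_inner \<Omega> (u1 t) \<phi>"
    using w(2) by eventually_elim (use \<phi>(1) in \<open>simp add: L2_to_Hm1_def\<close>)
  from oscillator_Duhamel[OF conty contV L2_coefficient_integrable[OF f \<phi>L] this ode _ _ \<omega> t]
  show ?thesis
    using weak_time_deriv_Hm1_apply[OF \<Omega> \<phi>(1) N\<phi> weak(1)] weak_time_deriv_Hm1_apply[OF \<Omega> \<phi>(1) N\<phi> weak(2)]
    by (simp add: y0 V0 L2_to_Hm1_def)
qed

lemma weak_solution_L2: "weak_solution \<Omega> a f g h u \<Longrightarrow> t \<ge> 0 \<Longrightarrow> u t \<in> L2 \<Omega>"
  by (auto simp: weak_solution_def time_continuous_def)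

text \<open>The right-hand side is \<open>1 / sqrt c\<close> times the integral of \<open>\<parallel>f s\<parallel>\<close> over times after \<open>t\<close>. Under the moment
  conditions the integrals up to \<open>t\<close> in the formula for the modes are minus integrals after \<open>t\<close>, and
  the addition theorem merges them into one kernel \<open>k m s\<close> bounded by \<open>1 / sqrt c\<close>.\<close>

lemma moment_conditions_imp_L2_norm_le:
  fixes \<Omega> :: "(real^'n) set"
  assumes \<Omega>: "open \<Omega>" "bounded \<Omega>"
    and a: "\<And>i j. a i j \<in> Linf \<Omega>" "\<And>i j. AE x in lebesgue_on \<Omega>. a i j x = a j i x"
    and eig: "complete_eigensystem \<Omega> a \<phi> \<mu>"
    and c: "c > 0" "\<And>m. c \<le> \<mu> m"
    and g: "g \<in> H10 \<Omega>"
    and f: "f \<in> bochner_Lp 1 (lebesgue_on {0<..}) (L2 \<Omega>) (L2_norm \<Omega>)"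
    and u: "weak_solution \<Omega> a f g h u" and t: "t > 0"
    and moments: "\<And>m. L2_inner \<Omega> g (\<phi> m) = 1 / sqrt (\<mu> m) *
           (LINT s|lebesgue_on {0<..}. sin (sqrt (\<mu> m) * s) * L2_inner \<Omega> (f s) (\<phi> m))"
      "\<And>m. L2_inner \<Omega> h (\<phi> m) =
           - (LINT s|lebesgue_on {0<..}. cos (sqrt (\<mu> m) * s) * L2_inner \<Omega> (f s) (\<phi> m))"
  shows "L2_norm \<Omega> (u t) \<le> 1 / sqrt c * ((LINT s|lebesgue_on {0<..}. L2_norm \<Omega> (f s)) -
      (LINT s|lebesgue_on {0<..}. indicator {0<..<t} s * L2_norm \<Omega> (f s)))"
proof -
  let ?M = "lebesgue_on {0::real<..}"
  \<comment> \<open>The indicator of the future \<open>s \<ge> t\<close> on the half line of positive times.\<close>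
  define \<tau> :: "real \<Rightarrow> real" where "\<tau> s = 1 - indicator {0<..<t} s" for s
  have \<tau>: "0 \<le> \<tau> s" for s by (simp add: \<tau>_def indicator_def)
  have [measurable]: "\<tau> \<in> borel_measurable ?M"
    unfolding \<tau>_def by (intro measurable_restrict_space1 measurable_completion) simp
  have on: "L2_orthonormal \<Omega> \<phi>" using eig by (rule eigensystem_orthonormal)
  have \<phi>H: "\<phi> m \<in> H10 \<Omega>" and \<phi>1: "L2_norm \<Omega> (\<phi> m) = 1" and \<mu>: "\<mu> m > 0" for m
    using eig by (auto simp: complete_eigensystem_def L2_norm_def)
  have \<phi>L: "\<phi> m \<in> L2 \<Omega>" for m using \<phi>H by (auto intro: H1_L2 H10_H1)
  have intN: "integrable ?M (\<lambda>s. L2_norm \<Omega> (f s))" and fL: "AE s in ?M. f s \<in> L2 \<Omega>"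
    using f by (auto simp: bochner_Lp_def strongly_measurable_def)
  have cut: "integrable ?M (\<lambda>s. \<tau> s * G s)"
    "(LINT s|?M. \<tau> s * G s) = (LINT s|?M. G s) - (LINT s|?M. indicator {0<..<t} s * G s)"
    if G: "integrable ?M G" for G
  proof -
    have "indicator {0<..<t} \<in> borel_measurable ?M"
      by (intro measurable_restrict_space1 measurable_completion) simp
    then have "(\<lambda>s. indicator {0<..<t} s * G s) \<in> borel_measurable ?M"
      using G by (intro borel_measurable_times) auto
    then have i: "integrable ?M (\<lambda>s. indicator {0<..<t} s * G s)"
      by (rule Bochner_Integration.integrable_bound[OF G]) (simp add: indicator_def)
    show "integrable ?M (\<lambda>s. \<tau> s * G s)"
      "(LINT s|?M. \<tau> s * G s) = (LINT s|?M. G s) - (LINT s|?M. indicator {0<..<t} s * G s)"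
      using G i by (simp_all add: \<tau>_def left_diff_distrib)
  qed
  define k where "k m s = \<tau> s * (sin (sqrt (\<mu> m) * (s - t)) / sqrt (\<mu> m))" for m s
  define \<kappa> where "\<kappa> s = \<tau> s * (1 / sqrt c)" for s
  let ?F = "\<lambda>m s. L2_inner \<Omega> (f s) (\<phi> m)"
  have intF: "integrable ?M (?F m)" for m by (rule L2_coefficient_integrable[OF f \<phi>L])
  have intk: "integrable ?M (\<lambda>s. k m s * ?F m s)" for m
  proof -
    have "integrable ?M (\<lambda>s. (sin (sqrt (\<mu> m) * (s - t)) / sqrt (\<mu> m)) * ?F m s)"
      using \<mu>[of m] by (intro integrable_mult_bounded_continuous[where B="1 / sqrt (\<mu> m)", OF intF])
        (auto intro!: continuous_intros simp: divide_right_mono)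
    from cut(1)[OF this] show ?thesis by (simp add: k_def mult.assoc)
  qed
  have k\<kappa>: "\<bar>k m s\<bar> \<le> \<kappa> s" for m s
  proof -
    have "\<bar>sin (sqrt (\<mu> m) * (s - t))\<bar> / sqrt (\<mu> m) \<le> 1 / sqrt c"
      using c(1) c(2)[of m] \<mu>[of m] by (intro frac_le) auto
    then show ?thesis
      unfolding k_def \<kappa>_def abs_mult using \<tau>[of s] \<mu>[of m] by (intro mult_mono) auto
  qed
  have coeff: "L2_inner \<Omega> (u t) (\<phi> m) = (LINT s|?M. k m s * ?F m s)" for m
  proof -
    define \<omega> where "\<omega> = sqrt (\<mu> m)"
    have \<omega>: "\<omega> > 0" "\<omega>\<^sup>2 = \<mu> m" using \<mu>[of m] by (auto simp: \<omega>_def)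
    have iS: "integrable ?M (\<lambda>s. sin (\<omega> * s) * ?F m s)" and iC: "integrable ?M (\<lambda>s. cos (\<omega> * s) * ?F m s)"
      by (intro integrable_mult_bounded_continuous[where B=1, OF intF]; auto intro!: continuous_intros)+
    have eig': "bilinear_form \<Omega> a (\<phi> m) v = \<omega>\<^sup>2 * L2_inner \<Omega> (\<phi> m) v" if "v \<in> H10 \<Omega>" for v
      using eig that \<omega>(2) by (simp add: complete_eigensystem_def)
    have \<phi>_pos: "0 < L2_norm \<Omega> (\<phi> m)" by (simp add: \<phi>1)
    have mode: "L2_inner \<Omega> (u t) (\<phi> m) =
        cos (\<omega> * t) * (L2_inner \<Omega> g (\<phi> m) -
          1 / \<omega> * (LINT s|?M. indicator {0<..<t} s * (sin (\<omega> * s) * ?F m s))) +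
        sin (\<omega> * t) / \<omega> * (L2_inner \<Omega> h (\<phi> m) +
          (LINT s|?M. indicator {0<..<t} s * (cos (\<omega> * s) * ?F m s)))"
      using \<Omega> a \<phi>H \<phi>_pos \<omega>(1) eig' g f u t by (rule weak_solution_mode_formula)
    have "L2_inner \<Omega> (u t) (\<phi> m) = cos (\<omega> * t) * (1 / \<omega> * (LINT s|?M. \<tau> s * (sin (\<omega> * s) * ?F m s))) -
        sin (\<omega> * t) / \<omega> * (LINT s|?M. \<tau> s * (cos (\<omega> * s) * ?F m s))"
      unfolding mode cut(2)[OF iS] cut(2)[OF iC] moments(1)[of m, folded \<omega>_def] moments(2)[of m, folded \<omega>_def]
      by (simp add: algebra_simps)
    also have "\<dots> = (LINT s|?M. cos (\<omega> * t) / \<omega> * (\<tau> s * (sin (\<omega> * s) * ?F m s)) -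
        sin (\<omega> * t) / \<omega> * (\<tau> s * (cos (\<omega> * s) * ?F m s)))"
      using cut(1)[OF iS] cut(1)[OF iC] by simp
    also have "\<dots> = (LINT s|?M. k m s * ?F m s)"
    proof (rule Bochner_Integration.integral_cong[OF refl])
      fix s
      have sin_shift: "sin (\<omega> * (s - t)) = sin (\<omega> * s) * cos (\<omega> * t) - cos (\<omega> * s) * sin (\<omega> * t)"
        by (simp add: right_diff_distrib sin_diff)
      show "cos (\<omega> * t) / \<omega> * (\<tau> s * (sin (\<omega> * s) * ?F m s)) -
          sin (\<omega> * t) / \<omega> * (\<tau> s * (cos (\<omega> * s) * ?F m s)) = k m s * ?F m s"
        unfolding k_def \<omega>_def[symmetric] sin_shift using \<omega>(1) by (simp add: field_simps)
    qed
    finally show ?thesis .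
  qed
  have "L2_norm \<Omega> (u t) \<le> (LINT s|?M. \<kappa> s * L2_norm \<Omega> (f s))"
  proof (rule L2_norm_le_if_coefficients_le[OF on])
    have utL: "u t \<in> L2 \<Omega>" using weak_solution_L2[OF u] t by simp
    then show "\<exists>w\<in>span (range \<phi>). L2_norm \<Omega> (u t - w) < \<epsilon>" if "\<epsilon> > 0" for \<epsilon>
      using eig that by (simp add: complete_eigensystem_def)
    show "u t \<in> L2 \<Omega>" by (fact utL)
    show "0 \<le> (LINT s|?M. \<kappa> s * L2_norm \<Omega> (f s))"
      using c(1) \<tau> by (intro Bochner_Integration.integral_nonneg mult_nonneg_nonneg L2_norm_nonneg) (auto simp: \<kappa>_def)
    show "(\<Sum>m\<in>I. (L2_inner \<Omega> (u t) (\<phi> m))\<^sup>2) \<le> (LINT s|?M. \<kappa> s * L2_norm \<Omega> (f s))\<^sup>2" if "finite I" for I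
      unfolding coeff using cut(1)[OF intN]
      by (intro sum_squares_of_coefficient_integrals_le[OF on that fL k\<kappa> intk]) (simp add: \<kappa>_def mult.commute mult.left_commute)
  qed
  also have "\<dots> = 1 / sqrt c * (LINT s|?M. \<tau> s * L2_norm \<Omega> (f s))"
    by (simp add: \<kappa>_def flip: integral_mult_right_zero)
  finally show ?thesis by (simp add: cut(2)[OF intN])
qed

lemma bounded_mult_tendsto_0:
  fixes b P :: "'a \<Rightarrow> real"
  assumes b: "\<And>t. \<bar>b t\<bar> \<le> K" and P: "(P \<longlongrightarrow> A) F"
  shows "((\<lambda>t. b t * (A - P t)) \<longlongrightarrow> 0) F"
proof (rule Lim_null_comparison)
  show "\<forall>\<^sub>F t in F. norm (b t * (A - P t)) \<le> K * \<bar>A - P t\<bar>"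
    using b by (intro always_eventually allI) (simp add: abs_mult mult_right_mono)
  have "((\<lambda>t. K * \<bar>A - P t\<bar>) \<longlongrightarrow> K * \<bar>A - A\<bar>) F"
    by (intro tendsto_intros P)
  then show "((\<lambda>t. K * \<bar>A - P t\<bar>) \<longlongrightarrow> 0) F" by simp
qed

theorem theorem1p1:
  fixes \<Omega> :: "(real^'n) set"
    and a :: "'n \<Rightarrow> 'n \<Rightarrow> real^'n \<Rightarrow> real"
    and \<phi> :: "nat \<Rightarrow> real^'n \<Rightarrow> real" and \<mu> :: "nat \<Rightarrow> real"
    and g h :: "real^'n \<Rightarrow> real"
    and f u :: "real \<Rightarrow> real^'n \<Rightarrow> real"
  assumes "open \<Omega>" and "bounded \<Omega>"
    and "\<And>i j. a i j \<in> Linf \<Omega>"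
    and "\<And>i j. AE x in lebesgue_on \<Omega>. a i j x = a j i x"
    and "uniformly_elliptic \<Omega> a"
    and "complete_eigensystem \<Omega> a \<phi> \<mu>"
    and "g \<in> H10 \<Omega>" and "h \<in> L2 \<Omega>"
    and "\<And>T. T > 0 \<Longrightarrow> f \<in> bochner_Lp 2 (lebesgue_on {0<..<T}) (L2 \<Omega>) (L2_norm \<Omega>)"
    and "f \<in> bochner_Lp 1 (lebesgue_on {0<..}) (L2 \<Omega>) (L2_norm \<Omega>)"
    and "weak_solution \<Omega> a f g h u"
  shows "((\<lambda>t. L2_norm \<Omega> (u t)) \<longlongrightarrow> 0) at_top \<longleftrightarrow>
    (\<forall>m. L2_inner \<Omega> g (\<phi> m) =
           1 / sqrt (\<mu> m) *
           (LINT s|lebesgue_on {0<..}. sin (sqrt (\<mu> m) * s) * L2_inner \<Omega> (f s) (\<phi> m)) \<and>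
         L2_inner \<Omega> h (\<phi> m) =
           - (LINT s|lebesgue_on {0<..}. cos (sqrt (\<mu> m) * s) * L2_inner \<Omega> (f s) (\<phi> m)))"
proof -
  let ?M = "lebesgue_on {0::real<..}"
  let ?S = "\<lambda>m. LINT s|?M. sin (sqrt (\<mu> m) * s) * L2_inner \<Omega> (f s) (\<phi> m)"
  let ?C = "\<lambda>m. LINT s|?M. cos (sqrt (\<mu> m) * s) * L2_inner \<Omega> (f s) (\<phi> m)"
  note \<Omega> = assms(1,2) and a = assms(3,4) and eig = assms(6) and g = assms(7)
    and f = assms(10) and u = assms(11)
  have \<phi>H: "\<phi> m \<in> H10 \<Omega>" and \<phi>1: "L2_norm \<Omega> (\<phi> m) = 1" and \<mu>: "\<mu> m > 0" for m
    using eig by (auto simp: complete_eigensystem_def L2_norm_def)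
  have \<phi>L: "\<phi> m \<in> L2 \<Omega>" for m using \<phi>H by (auto intro: H1_L2 H10_H1)
  show ?thesis
  proof
    assume lim: "((\<lambda>t. L2_norm \<Omega> (u t)) \<longlongrightarrow> 0) at_top"
    show "\<forall>m. L2_inner \<Omega> g (\<phi> m) = 1 / sqrt (\<mu> m) * ?S m \<and> L2_inner \<Omega> h (\<phi> m) = - ?C m"
    proof
      fix m
      define \<omega> where "\<omega> = sqrt (\<mu> m)"
      have \<omega>: "\<omega> > 0" "\<omega>\<^sup>2 = \<mu> m" using \<mu>[of m] by (auto simp: \<omega>_def)
      have eig': "bilinear_form \<Omega> a (\<phi> m) v = \<omega>\<^sup>2 * L2_inner \<Omega> (\<phi> m) v" if "v \<in> H10 \<Omega>" for v
        using eig that \<omega>(2) by (simp add: complete_eigensystem_def)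
      have intF: "integrable ?M (\<lambda>s. L2_inner \<Omega> (f s) (\<phi> m))" by (rule L2_coefficient_integrable[OF f \<phi>L])
      have iS: "integrable ?M (\<lambda>s. sin (\<omega> * s) * L2_inner \<Omega> (f s) (\<phi> m))"
        and iC: "integrable ?M (\<lambda>s. cos (\<omega> * s) * L2_inner \<Omega> (f s) (\<phi> m))"
        by (intro integrable_mult_bounded_continuous[where B=1, OF intF]; auto intro!: continuous_intros)+
      define P where "P t = L2_inner \<Omega> g (\<phi> m) - 1 / \<omega> *
        (LINT s|?M. indicator {0<..<t} s * (sin (\<omega> * s) * L2_inner \<Omega> (f s) (\<phi> m)))" for t
      define Q where "Q t = L2_inner \<Omega> h (\<phi> m) +
        (LINT s|?M. indicator {0<..<t} s * (cos (\<omega> * s) * L2_inner \<Omega> (f s) (\<phi> m)))" for t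
      define A where "A = L2_inner \<Omega> g (\<phi> m) - 1 / \<omega> * ?S m"
      define B where "B = L2_inner \<Omega> h (\<phi> m) + ?C m"
      have PA: "(P \<longlongrightarrow> A) at_top" and QB: "(Q \<longlongrightarrow> B) at_top"
        unfolding P_def A_def Q_def B_def \<omega>_def[symmetric]
        by (intro tendsto_add tendsto_diff tendsto_mult tendsto_const integral_indicator_tendsto_at_top iS iC)+
      have "((\<lambda>t. L2_inner \<Omega> (u t) (\<phi> m)) \<longlongrightarrow> 0) at_top"
      proof (rule Lim_null_comparison[OF _ lim])
        show "\<forall>\<^sub>F t in at_top. norm (L2_inner \<Omega> (u t) (\<phi> m)) \<le> L2_norm \<Omega> (u t)"
          using eventually_ge_at_top[of 0]
        proof eventually_elim
          case (elim t)
          then show ?case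
            using L2_Cauchy_Schwarz[OF weak_solution_L2[OF u] \<phi>L, of t m] by (simp add: \<phi>1)
        qed
      qed
      moreover have "\<forall>\<^sub>F t in at_top. L2_inner \<Omega> (u t) (\<phi> m) = cos (\<omega> * t) * P t + sin (\<omega> * t) / \<omega> * Q t"
        using eventually_gt_at_top[of 0]
      proof eventually_elim
        case (elim t)
        then show ?case
          unfolding P_def Q_def
          by (intro weak_solution_mode_formula[OF \<Omega> a \<phi>H _ \<omega>(1) eig' g f u]) (simp_all add: \<phi>1)
      qed
      ultimately have sol: "((\<lambda>t. cos (\<omega> * t) * P t + sin (\<omega> * t) / \<omega> * Q t) \<longlongrightarrow> 0) at_top"
        by (rule Lim_transform_eventually)
      have "((\<lambda>t. cos (\<omega> * t) * (A - P t)) \<longlongrightarrow> 0) at_top"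
        by (rule bounded_mult_tendsto_0[where K=1, OF _ PA]) simp
      moreover have "((\<lambda>t. sin (\<omega> * t) / \<omega> * (B - Q t)) \<longlongrightarrow> 0) at_top"
        using \<omega>(1) by (intro bounded_mult_tendsto_0[where K="1 / \<omega>", OF _ QB]) (simp add: divide_right_mono)
      ultimately
      have "((\<lambda>t. (cos (\<omega> * t) * P t + sin (\<omega> * t) / \<omega> * Q t) +
          cos (\<omega> * t) * (A - P t) + (sin (\<omega> * t) / \<omega>) * (B - Q t)) \<longlongrightarrow> 0 + 0 + 0) at_top"
        by (intro tendsto_add sol)
      moreover have "(cos (\<omega> * t) * P t + sin (\<omega> * t) / \<omega> * Q t) +
          cos (\<omega> * t) * (A - P t) + (sin (\<omega> * t) / \<omega>) * (B - Q t) =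
          cos (\<omega> * t) * A + sin (\<omega> * t) * (B / \<omega>)" for t
        using \<omega>(1) by (simp add: field_simps)
      ultimately have "((\<lambda>t. cos (\<omega> * t) * A + sin (\<omega> * t) * (B / \<omega>)) \<longlongrightarrow> 0) at_top"
        by (simp only: add_0)
      from cos_sin_combination_tendsto_0[OF this \<omega>(1)]
      have "A = 0" "B = 0" using \<omega>(1) by auto
      then show "L2_inner \<Omega> g (\<phi> m) = 1 / sqrt (\<mu> m) * ?S m \<and> L2_inner \<Omega> h (\<phi> m) = - ?C m"
        by (simp add: A_def B_def \<omega>_def)
    qed
  next
    assume moments: "\<forall>m. L2_inner \<Omega> g (\<phi> m) = 1 / sqrt (\<mu> m) * ?S m \<and> L2_inner \<Omega> h (\<phi> m) = - ?C m"
    obtain c where c: "c > 0" "\<And>m. c \<le> \<mu> m"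
      using eigenvalues_bounded_below[OF \<Omega> a(1) assms(5) eig] by blast
    let ?N = "LINT s|?M. L2_norm \<Omega> (f s)"
    let ?Nt = "\<lambda>t. LINT s|?M. indicator {0<..<t} s * L2_norm \<Omega> (f s)"
    have intN: "integrable ?M (\<lambda>s. L2_norm \<Omega> (f s))" using f by (auto simp: bochner_Lp_def)
    have "((\<lambda>t. 1 / sqrt c * (?N - ?Nt t)) \<longlongrightarrow> 1 / sqrt c * (?N - ?N)) at_top"
      by (intro tendsto_intros integral_indicator_tendsto_at_top intN)
    then have "((\<lambda>t. 1 / sqrt c * (?N - ?Nt t)) \<longlongrightarrow> 0) at_top" by simp
    moreover have "\<forall>\<^sub>F t in at_top. norm (L2_norm \<Omega> (u t)) \<le> 1 / sqrt c * (?N - ?Nt t)"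
      using eventually_gt_at_top[of 0]
    proof eventually_elim
      case (elim t)
      have "L2_norm \<Omega> (u t) \<le> 1 / sqrt c * (?N - ?Nt t)"
        using moments by (intro moment_conditions_imp_L2_norm_le[OF \<Omega> a eig c g f u elim]) auto
      then show ?case by (simp add: L2_norm_nonneg)
    qed
    ultimately show "((\<lambda>t. L2_norm \<Omega> (u t)) \<longlongrightarrow> 0) at_top"
      by (rule Lim_null_comparison[rotated])
  qed
qed

end
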